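(* Let $Y$ be a closed linear subspace of a separable Banach space $X$. Assume that $Y$ and $X/Y$ each admit an equivalent asymptotically uniformly smooth norm. Then $X$ admits an equivalent asymptotically uniformly smooth norm. More precisely, let $p,q\in[1,+\infty)$ and $c>0$ be such that $$\forall t>0\qquad \overline{\delta}_Y^*(t)\ge c\,t^p\quad\text{and}\quad \overline{\delta}_{X/Y}^*(t)\ge c\,t^q.$$ Then, for all $\delta>0$, there exist an equivalent norm $|\cdot|$ on $X$ and a constant $\gamma>0$ such that $$\forall t>0\qquad \overline{\delta}_{|\cdot|}^*(t)\ge \gamma\, t^{p+q+\delta}.$$
   Context: For a Banach space $(Z,\|\cdot\|)$, $S_Z$ denotes its unit sphere. For $t>0$, the modulus of asymptotic uniform smoothness of $Z$ is $$\overline{\rho}_Z(t)=\sup_{x\in S_Z}\ \inf_{\dim(Z/W)<\infty}\ \Big(\sup_{y\in S_W}\|x+ty\|-1\Big),$$ where $W$ runs through all closed linear subspaces of $Z$ of finite codimension. The norm of $Z$ is asymptotically uniformly smooth if $\lim_{t\to0}\overline{\rho}_Z(t)/t=0$. For $t>0$, the weak$^*$-modulus of asymptotic uniform convexity of the dual norm on $Z^*$ is $$\overline{\delta}_Z^*(t)=\inf_{x^*\in S_{Z^*}}\ \sup_{E}\ \inf_{y^*\in S_E}\{\|x^*+ty^*\|-1\},$$ where $E$ runs through all weak$^*$-closed linear subspaces of $Z^*$ of finite codimension. For an equivalent norm $|\cdot|$ on $X$, $\overline{\delta}_{|\cdot|}^*$ denotes the modulus $\overline{\delta}^*$ of the space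 $(X,|\cdot|)$, i.e. computed with the dual norm of $|\cdot|$ on $X^*$. $Y$ carries the norm induced from $X$ and $X/Y$ the quotient norm.
   Formalization: The bounds "for all t>0" are taken for 0<t≤1 in hypotheses and conclusion, since for infinite-dimensional X the modulus is at most t, so the printed conclusion fails for large t (e.g. X=c_0⊕c_0, Y=c_0⊕0, p=q=c=1). *)

theory Defs
  imports "HOL-Analysis.Analysis"
begin

text \<open>
  The quotient \<open>X/Y\<close> depends on the set \<open>Y\<close>, so it cannot be a type. Normed spaces are
  therefore given by an explicit carrier, operations and norm; the constructions below
  yield \<open>X\<close> itself, its subspaces, quotients, duals and renormings in this form.
\<close>

record 'v nspace =
  vcarrier :: "'v set"
  vadd :: "'v \<Rightarrow> 'v \<Rightarrow> 'v"
  vscale :: "real \<Rightarrow> 'v \<Rightarrow> 'v"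
  vnorm :: "'v \<Rightarrow> real"

definition type_space :: "'a::real_normed_vector nspace" where
  "type_space = \<lparr>vcarrier = UNIV, vadd = (+), vscale = (*\<^sub>R), vnorm = norm\<rparr>"

definition subspace_of :: "'v nspace \<Rightarrow> 'v set \<Rightarrow> 'v nspace" where
  "subspace_of Z W = Z\<lparr>vcarrier := W\<rparr>"

definition renorm :: "'v nspace \<Rightarrow> ('v \<Rightarrow> real) \<Rightarrow> 'v nspace" where
  "renorm Z N = Z\<lparr>vnorm := N\<rparr>"

text \<open>
  \<open>Z/W\<close> consists of the cosets \<open>z + W\<close>. Scaling adds \<open>W\<close> again because \<open>0 \<cdot> A\<close> has to be
  the coset \<open>W\<close>, not \<open>{0}\<close>.
\<close>

definition quotient_space :: "'v nspace \<Rightarrow> 'v set \<Rightarrow> 'v set nspace" where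
  "quotient_space Z W =
    \<lparr>vcarrier = (\<lambda>z. vadd Z z ` W) ` vcarrier Z,
     vadd = (\<lambda>A B. {vadd Z a b | a b. a \<in> A \<and> b \<in> B}),
     vscale = (\<lambda>c A. {vadd Z (vscale Z c a) w | a w. a \<in> A \<and> w \<in> W}),
     vnorm = (\<lambda>A. INF a\<in>A. vnorm Z a)\<rparr>"

text \<open>
  Functionals are extensional (undefined off the carrier), so that equality of functionals
  is equality on the carrier.
\<close>

definition dual_space :: "'v nspace \<Rightarrow> ('v \<Rightarrow> real) nspace" where
  "dual_space Z =
    \<lparr>vcarrier = {f \<in> extensional (vcarrier Z).
        (\<forall>x\<in>vcarrier Z. \<forall>y\<in>vcarrier Z. f (vadd Z x y) = f x + f y) \<and>
        (\<forall>c. \<forall>x\<in>vcarrier Z. f (vscale Z c x) = c * f x) \<and>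
        (\<exists>K. \<forall>x\<in>vcarrier Z. \<bar>f x\<bar> \<le> K * vnorm Z x)},
     vadd = (\<lambda>f g. \<lambda>x\<in>vcarrier Z. f x + g x),
     vscale = (\<lambda>c f. \<lambda>x\<in>vcarrier Z. c * f x),
     vnorm = (\<lambda>f. SUP x\<in>{x \<in> vcarrier Z. vnorm Z x \<le> 1}. \<bar>f x\<bar>)\<rparr>"

text \<open>
  The distance is \<open>0\<close> off the carrier because \<open>Metric_space\<close> requires nonnegativity and
  symmetry for all points of the type.
\<close>

definition norm_topology :: "'v nspace \<Rightarrow> 'v topology" where
  "norm_topology Z =
    Metric_space.mtopology (vcarrier Z)
      (\<lambda>x y. if x \<in> vcarrier Z \<and> y \<in> vcarrier Z
             then vnorm Z (vadd Z x (vscale Z (-1) y)) else 0)"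

definition weak_star_topology :: "'v nspace \<Rightarrow> ('v \<Rightarrow> real) topology" where
  "weak_star_topology Z =
    subtopology (product_topology (\<lambda>_. euclidean) (vcarrier Z)) (vcarrier (dual_space Z))"

definition linear_subspace :: "'v nspace \<Rightarrow> 'v set \<Rightarrow> bool" where
  "linear_subspace Z W \<longleftrightarrow> W \<subseteq> vcarrier Z \<and> W \<noteq> {} \<and>
    (\<forall>x\<in>W. \<forall>y\<in>W. vadd Z x y \<in> W) \<and> (\<forall>c. \<forall>x\<in>W. vscale Z c x \<in> W)"

definition finite_dim :: "'v nspace \<Rightarrow> bool" where
  "finite_dim Z \<longleftrightarrow>
    (\<exists>B. finite B \<and> B \<subseteq> vcarrier Z \<and> linear_subspace Z hull B = vcarrier Z)"

definition finite_codim :: "'v nspace \<Rightarrow> 'v set \<Rightarrow> bool" where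
  "finite_codim Z W \<longleftrightarrow> linear_subspace Z W \<and> finite_dim (quotient_space Z W)"

definition unit_sphere :: "'v nspace \<Rightarrow> 'v set \<Rightarrow> 'v set" where
  "unit_sphere Z W = {w \<in> W. vnorm Z w = 1}"

text \<open>Definiteness of \<open>N\<close> follows from the lower bound.\<close>

definition equivalent_norm :: "'v nspace \<Rightarrow> ('v \<Rightarrow> real) \<Rightarrow> bool" where
  "equivalent_norm Z N \<longleftrightarrow>
    (\<forall>x\<in>vcarrier Z. \<forall>y\<in>vcarrier Z. N (vadd Z x y) \<le> N x + N y) \<and>
    (\<forall>c. \<forall>x\<in>vcarrier Z. N (vscale Z c x) = \<bar>c\<bar> * N x) \<and>
    (\<exists>a>0. \<exists>b>0. \<forall>x\<in>vcarrier Z. a * vnorm Z x \<le> N x \<and> N x \<le> b * vnorm Z x)"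

text \<open>
  The modulus of asymptotic uniform smoothness takes values in \<open>[0,\<infinity>]\<close>, where the supremum
  over an empty sphere is \<open>0\<close>; thus it vanishes for finite-dimensional \<open>Z\<close>. The truncation by
  \<open>ennreal\<close> has no effect otherwise: if the sphere of \<open>W\<close> is nonempty, the supremum
  of \<open>\<parallel>x + ty\<parallel> - 1\<close> is nonnegative, as one sees from \<open>y\<close> and \<open>-y\<close>.
\<close>

definition aus_modulus :: "'v nspace \<Rightarrow> real \<Rightarrow> ennreal" where
  "aus_modulus Z t =
    (SUP x\<in>unit_sphere Z (vcarrier Z).
      INF W\<in>{W. finite_codim Z W \<and> closedin (norm_topology Z) W}.
        SUP y\<in>unit_sphere Z W. ennreal (vnorm Z (vadd Z x (vscale Z t y)) - 1))"

definition asymptotically_uniformly_smooth :: "'v nspace \<Rightarrow> bool" where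
  "asymptotically_uniformly_smooth Z \<longleftrightarrow>
    ((\<lambda>t. aus_modulus Z t / ennreal t) \<longlongrightarrow> 0) (at_right 0)"

definition aus_renormable :: "'v nspace \<Rightarrow> bool" where
  "aus_renormable Z \<longleftrightarrow>
    (\<exists>N. equivalent_norm Z N \<and> asymptotically_uniformly_smooth (renorm Z N))"

text \<open>
  The weak* modulus of asymptotic uniform convexity of the dual norm; an infimum over an
  empty sphere is \<open>\<infinity>\<close>.
\<close>

definition weak_star_auc_modulus :: "'v nspace \<Rightarrow> real \<Rightarrow> ereal" where
  "weak_star_auc_modulus Z t =
    (let D = dual_space Z in
      INF f\<in>unit_sphere D (vcarrier D).
        SUP E\<in>{E. finite_codim D E \<and> closedin (weak_star_topology Z) E}.
          INF g\<in>unit_sphere D E. ereal (vnorm D (vadd D f (vscale D t g)) - 1))"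

text \<open>
  Power type lower bound for the weak* modulus. The range of \<open>t\<close> is \<open>(0,1]\<close>, not \<open>(0,\<infinity>)\<close>:
  by the triangle inequality the modulus at \<open>t\<close> is at most \<open>t\<close> if \<open>Z\<close> is
  infinite-dimensional, so a bound \<open>c t^r\<close> with \<open>r > 1\<close> never holds for all large \<open>t\<close>.
\<close>

definition weak_star_auc_power :: "'v nspace \<Rightarrow> real \<Rightarrow> real \<Rightarrow> bool" where
  "weak_star_auc_power Z c r \<longleftrightarrow>
    (\<forall>t\<in>{0<..1}. ereal (c * t powr r) \<le> weak_star_auc_modulus Z t)"

end

theory Submission
  imports Defs
begin

text \<open>
  Consider the game in which one player names closed subspaces of finite codimension and the other
  picks vectors of norm at most 1 in them; call \<open>y\<close> far out if it lies in a suitable such subspace. Either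
  hypothesis on \<open>Z \<in> {Y, X/Y}\<close> says that for each \<open>L\<close> there is \<open>R = R\<^sub>Z(L)\<close> such that
  \<open>\<parallel>x + y\<parallel> \<le> \<parallel>x\<parallel> + 1/L\<close> whenever \<open>\<parallel>x\<parallel> \<ge> R\<close> and \<open>y\<close> is far out in the unit ball; under the dual
  hypothesis \<open>R\<close> can be a multiple of \<open>L\<close> to the power \<open>p - 1\<close> (respectively \<open>q - 1\<close>), by weak*
  compactness of the dual ball. So in \<open>R L\<close> moves the sum of the vectors can be kept below a multiple of \<open>R\<close>.

  In \<open>X\<close> one plays \<open>R\<^sub>Y L\<close> blocks of \<open>R\<^sub>Q L\<close> moves each, where \<open>Q = X/Y\<close>. The sum of a block has a coset of
  norm \<open>O(R\<^sub>Q)\<close>, hence lies within \<open>O(R\<^sub>Q)\<close> of a far out vector of \<open>Y\<close> of norm \<open>O(R\<^sub>Q L)\<close>; these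
  vectors are moves in the game on \<open>Y\<close>. The sum of all \<open>R\<^sub>Y R\<^sub>Q L\<^sup>2\<close> vectors is therefore bounded by
  a multiple of \<open>R\<^sub>Y R\<^sub>Q L\<close>. Averaging the value functions of this game yields a norm, uniformly
  equivalent to the given one, whose modulus of smoothness at \<open>\<tau> \<approx> 1/(R\<^sub>Y R\<^sub>Q L)\<close> is \<open>O(\<tau>/L)\<close>. The norm
  whose unit ball consists of the finite sums \<open>\<Sum>\<^sub>k a\<^sub>k x\<^sub>k\<close>, with \<open>x\<^sub>k\<close> in the ball of the norm
  belonging to \<open>L\<^sub>k\<close>, has all these properties at once up to the factors \<open>a\<^sub>k\<close>, because any single
  summand can absorb the perturbation. With \<open>L\<^sub>k = 2\<^sup>k\<close> and \<open>a\<^sub>k\<close> a small negative power of \<open>L\<^sub>k\<close>,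
  duality turns this into the exponent \<open>p + q + \<delta>\<close>.
\<close>

section \<open>The Hahn--Banach theorem\<close>

text \<open>Counting fixes the exponents. After scaling, a move of length \<tau>, about 1/(R_Y R_Q
  L), costs one part in R_Y R_Q L^2, so the cost per unit of length is about 1/L. In the dual, a
  perturbation of size s gains a multiple of s \<tau> against that cost, which pays once s exceeds a
  multiple of 1/L; with R_Y R_Q of order L^(p+q-2) the gain is then of order s^(p+q). The weights
  that superpose all scales shorten the admissible length by the factor a_k, and this is where
  \<delta> is spent. The obstacle is the order of the choices. The game on Y demands its subspace
  before a block starts, yet the vector of Y that answers it is known only when the block is over.
  So the conditions imposed during the block must be chosen in advance such that a vector that
  satisfies them and is close to Y is also close to the part of Y in the demanded subspace, with a
  loss that does not depend on this subspace. Subspaces of finite codimension are handled as kernels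
  of finitely many functionals, and Hahn--Banach supplies functionals that attain a seminorm at a
  given point.\<close>

definition sublinear :: "('b::real_vector \<Rightarrow> real) \<Rightarrow> bool" where
  "sublinear p \<longleftrightarrow> (\<forall>x y. p (x + y) \<le> p x + p y) \<and> (\<forall>c>0. \<forall>x. p (c *\<^sub>R x) \<le> c * p x)"

lemma sublinear_add: "sublinear p \<Longrightarrow> p (x + y) \<le> p x + p y"
  by (simp add: sublinear_def)

lemma sublinear_scale:
  assumes "sublinear p" "c > 0"
  shows "p (c *\<^sub>R x) = c * p x"
proof (rule antisym)
  show "p (c *\<^sub>R x) \<le> c * p x"
    using assms by (simp add: sublinear_def)
  have "p (inverse c *\<^sub>R (c *\<^sub>R x)) \<le> inverse c * p (c *\<^sub>R x)"
    using assms unfolding sublinear_def by (meson positive_imp_inverse_positive)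
  then show "c * p x \<le> p (c *\<^sub>R x)"
    using \<open>c > 0\<close> by (simp add: field_simps)
qed

lemma sublinear_zero: "sublinear p \<Longrightarrow> p 0 = 0"
  using sublinear_scale[of p 2 0] by simp

lemma sublinear_minus: "sublinear p \<Longrightarrow> - p (- x) \<le> p x"
  using sublinear_add[of p x "- x"] sublinear_zero[of p] by simp

text \<open>Infimal convolution of \<open>q\<close> with the convex cone \<open>K\<close> of pairs
  (m, s), each read as the demand that the new functional be at most s at m. The hypothesis
  \<open>pos\<close> says that no demand contradicts the lower bound -q(-m) that holds for every
  sublinear functional below \<open>q\<close>; it keeps the infimum finite.\<close>

lemma sublinear_inf_cone:
  fixes q :: "'b::real_vector \<Rightarrow> real" and K :: "('b \<times> real) set"
  assumes q: "sublinear q"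
    and zero: "(0, 0) \<in> K"
    and add: "\<And>m s n t. (m, s) \<in> K \<Longrightarrow> (n, t) \<in> K \<Longrightarrow> (m + n, s + t) \<in> K"
    and scale: "\<And>c m s. c > 0 \<Longrightarrow> (m, s) \<in> K \<Longrightarrow> (c *\<^sub>R m, c * s) \<in> K"
    and pos: "\<And>m s. (m, s) \<in> K \<Longrightarrow> 0 \<le> q (- m) + s"
  obtains q' where "sublinear q'" "\<And>x. q' x \<le> q x" "\<And>m s. (m, s) \<in> K \<Longrightarrow> q' m \<le> s"
proof
  define q' where "q' x = (INF k\<in>K. q (x - fst k) + snd k)" for x
  have bdd: "bdd_below ((\<lambda>k. q (x - fst k) + snd k) ` K)" for x
  proof (rule bdd_belowI2[where m = "- q (- x)"])
    fix k assume "k \<in> K"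
    then have "0 \<le> q (- fst k) + snd k" using pos[of "fst k" "snd k"] by simp
    moreover have "q (- fst k) \<le> q (x - fst k) + q (- x)"
      using sublinear_add[OF q, of "x - fst k" "- x"] by simp
    ultimately show "- q (- x) \<le> q (x - fst k) + snd k" by linarith
  qed
  have le: "q' x \<le> q (x - m) + s" if "(m, s) \<in> K" for x m s
    unfolding q'_def using cINF_lower[OF bdd that, of x] by simp
  have ne: "K \<noteq> {}" using zero by auto
  show "q' x \<le> q x" for x using le[OF zero, of x] by simp
  show "q' m \<le> s" if "(m, s) \<in> K" for m s
    using le[OF that, of m] sublinear_zero[OF q] by simp
  show "sublinear q'"
    unfolding sublinear_def
  proof (intro conjI allI impI)
    fix x y
    have *: "q' (x + y) \<le> (q (x - m) + s) + (q (y - n) + t)" if "(m, s) \<in> K" "(n, t) \<in> K" for m s n t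
      using le[OF add[OF that], of "x + y"] sublinear_add[OF q, of "x - m" "y - n"]
      by (simp add: algebra_simps)
    have "q' (x + y) - (q (x - m) + s) \<le> q' y" if "(m, s) \<in> K" for m s
      unfolding q'_def[of y] using * that by (intro cINF_greatest[OF ne]) force
    then have "q' (x + y) - q' y \<le> q' x"
      unfolding q'_def[of x] by (intro cINF_greatest[OF ne]) force
    then show "q' (x + y) \<le> q' x + q' y" by linarith
  next
    fix c :: real and x assume c: "0 < c"
    have "q' (c *\<^sub>R x) / c \<le> q (x - m) + s" if "(m, s) \<in> K" for m s
      using le[OF scale[OF c that], of "c *\<^sub>R x"] sublinear_scale[OF q c, of "x - m"] c
      by (simp add: field_simps scaleR_diff_right)
    then have "q' (c *\<^sub>R x) / c \<le> q' x"
      unfolding q'_def[of x] by (intro cINF_greatest[OF ne]) force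
    then show "q' (c *\<^sub>R x) \<le> c * q' x" using c by (simp add: field_simps)
  qed
qed

text \<open>
  Zorn's lemma is applied to sublinear functionals instead of to partial extensions: a minimal
  sublinear functional is linear.
\<close>

lemma ex_minimal_sublinear:
  fixes p :: "'b::real_vector \<Rightarrow> real"
  assumes p: "sublinear p"
  obtains g where "sublinear g" "g \<le> p" "\<And>q. sublinear q \<Longrightarrow> q \<le> g \<Longrightarrow> q = g"
proof -
  define A where "A = {q. sublinear q \<and> q \<le> p}"
  have "\<exists>m\<in>A. \<forall>a\<in>A. m \<ge> a \<longrightarrow> a = m"
  proof (rule predicate_Zorn)
    show "partial_order_on A (relation_of (\<ge>) A)"
      by (auto simp: partial_order_on_def preorder_on_def refl_on_def trans_def antisym_def
          relation_of_def)
  next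
    fix C assume C: "C \<in> Chains (relation_of (\<ge>) A)"
    show "\<exists>u\<in>A. \<forall>a\<in>C. a \<ge> u"
    proof (cases "C = {}")
      case True
      then show ?thesis using p by (auto simp: A_def)
    next
      case False
      have CA: "sublinear q" "q \<le> p" if "q \<in> C" for q
        using that C by (auto simp: Chains_def relation_of_def A_def)
      have chain: "q \<le> r \<or> r \<le> q" if "q \<in> C" "r \<in> C" for q r
        using that C by (auto simp: Chains_def relation_of_def)
      define u where "u x = (INF q\<in>C. q x)" for x
      have bdd: "bdd_below ((\<lambda>q. q x) ` C)" for x
      proof (rule bdd_belowI2[where m = "- p (- x)"])
        fix q assume "q \<in> C"
        then show "- p (- x) \<le> q x"
          using sublinear_minus[of q x] CA[of q] by (smt (verit) le_fun_def)
      qed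
      have le: "u x \<le> q x" if "q \<in> C" for q x
        unfolding u_def using cINF_lower[OF bdd that] .
      have "sublinear u"
        unfolding sublinear_def
      proof (intro conjI allI impI)
        fix x y
        have *: "u (x + y) \<le> q x + r y" if "q \<in> C" "r \<in> C" for q r
          using chain[OF that]
        proof
          assume "q \<le> r"
          then show ?thesis
            using le[OF that(1), of "x + y"] sublinear_add[OF CA(1)[OF that(1)], of x y]
            by (smt (verit) le_fun_def)
        next
          assume "r \<le> q"
          then show ?thesis
            using le[OF that(2), of "x + y"] sublinear_add[OF CA(1)[OF that(2)], of x y]
            by (smt (verit) le_fun_def)
        qed
        have "u (x + y) - q x \<le> u y" if "q \<in> C" for q
          unfolding u_def[of y] using * that by (intro cINF_greatest[OF False]) force
        then have "u (x + y) - u y \<le> u x"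
          unfolding u_def[of x] by (intro cINF_greatest[OF False]) force
        then show "u (x + y) \<le> u x + u y" by linarith
      next
        fix c :: real and x assume c: "0 < c"
        have "u (c *\<^sub>R x) / c \<le> q x" if "q \<in> C" for q
          using le[OF that, of "c *\<^sub>R x"] sublinear_scale[OF CA(1)[OF that] c, of x] c
          by (simp add: field_simps)
        then have "u (c *\<^sub>R x) / c \<le> u x"
          unfolding u_def[of x] by (intro cINF_greatest[OF False])
        then show "u (c *\<^sub>R x) \<le> c * u x" using c by (simp add: field_simps)
      qed
      moreover have "u \<le> p"
        using False le CA(2) by (meson all_not_in_conv le_fun_def order_trans)
      ultimately show ?thesis using le by (auto simp: A_def le_fun_def)
    qed
  qed
  then show ?thesis using that by (force simp: A_def)
qed

text \<open>The demands form the ray through (-y, -p y), compatible with \<open>p\<close> by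
  positive homogeneity. The result serves twice: it shows that minimal functionals are odd, and it
  yields functionals attaining \<open>p\<close> at a given point.\<close>

lemma sublinear_below_linear_at:
  fixes p :: "'b::real_vector \<Rightarrow> real"
  assumes p: "sublinear p"
  obtains q where "sublinear q" "q \<le> p" "q (- y) \<le> - p y"
proof -
  define K where "K = {(- t *\<^sub>R y, - t * p y) | t. t \<ge> 0}"
  have K_iff: "(m, s) \<in> K \<longleftrightarrow> (\<exists>t\<ge>0. m = - t *\<^sub>R y \<and> s = - t * p y)" for m s
    by (auto simp: K_def)
  obtain q where q: "sublinear q" "\<And>x. q x \<le> p x" "\<And>m s. (m, s) \<in> K \<Longrightarrow> q m \<le> s"
  proof (rule sublinear_inf_cone[OF p, of K])
    show "(0, 0) \<in> K" by (auto simp: K_def intro: exI[of _ 0])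
    show "(m + n, s + t) \<in> K" if mn: "(m, s) \<in> K" "(n, t) \<in> K" for m s n t
    proof -
      obtain a where "a \<ge> 0" "m = - a *\<^sub>R y" "s = - a * p y" using mn(1) unfolding K_iff by blast
      moreover obtain b where "b \<ge> 0" "n = - b *\<^sub>R y" "t = - b * p y" using mn(2) unfolding K_iff by blast
      ultimately show ?thesis
        unfolding K_iff by (intro exI[of _ "a + b"]) (auto simp: algebra_simps)
    qed
    show "(c *\<^sub>R m, c * s) \<in> K" if mn: "0 < c" "(m, s) \<in> K" for c m s
    proof -
      obtain a where "a \<ge> 0" "m = - a *\<^sub>R y" "s = - a * p y"
        using mn(2) unfolding K_iff by blast
      then show ?thesis
        unfolding K_iff using mn(1) by (intro exI[of _ "c * a"]) auto
    qed
    show "0 \<le> p (- m) + s" if mn: "(m, s) \<in> K" for m s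
    proof -
      obtain a where "a \<ge> 0" "m = - a *\<^sub>R y" "s = - a * p y"
        using mn unfolding K_iff by blast
      then show ?thesis
        using sublinear_scale[OF p, of a y] sublinear_zero[OF p] by (cases "a = 0") auto
    qed
  qed blast
  moreover have "(- y, - p y) \<in> K" by (auto simp: K_def intro: exI[of _ 1])
  ultimately show ?thesis using that[of q] by (simp add: le_fun_def)
qed

text \<open>By minimality the functional of \<open>sublinear_below_linear_at\<close> is g itself, so
  g is odd. For an odd functional, subadditivity at -x and -y is superadditivity at x and y.\<close>

lemma minimal_sublinear_linear:
  assumes g: "sublinear g" and min: "\<And>q. sublinear q \<Longrightarrow> q \<le> g \<Longrightarrow> q = g"
  shows "linear g"
proof -
  have neg: "g (- y) \<le> - g y" for y
  proof -
    obtain q where "sublinear q" "q \<le> g" "q (- y) \<le> - g y"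
      using sublinear_below_linear_at[OF g, where y = y] .
    with min[of q] show ?thesis by simp
  qed
  have odd: "g (- y) = - g y" for y
    using neg[of y] sublinear_minus[OF g, of y] by simp
  have add: "g (x + y) = g x + g y" for x y
    using sublinear_add[OF g, of x y] sublinear_add[OF g, of "- x" "- y"] odd[of "x + y"] odd[of x] odd[of y]
    by simp
  have "g (c *\<^sub>R x) = c * g x" for c x
  proof -
    consider "c > 0" | "c = 0" | "c < 0" by linarith
    then show ?thesis
    proof cases
      case 3
      then show ?thesis using sublinear_scale[OF g, of "- c" x] odd[of "c *\<^sub>R x"] by simp
    qed (use sublinear_scale[OF g] sublinear_zero[OF g] in auto)
  qed
  then show ?thesis by (intro linearI) (auto simp: add)
qed

text \<open>The demands are the graph of \<open>f\<close> over \<open>M\<close>. A minimal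
  functional below the resulting \<open>q\<close> is linear and at most \<open>f\<close> on
  \<open>M\<close>; replacing x by -x gives equality. Only values of \<open>f\<close> on
  \<open>M\<close> enter, which suits functionals given on a carrier.\<close>

theorem Hahn_Banach:
  fixes p :: "'b::real_vector \<Rightarrow> real"
  assumes p: "sublinear p" and M: "subspace M"
    and add: "\<And>x y. x \<in> M \<Longrightarrow> y \<in> M \<Longrightarrow> f (x + y) = f x + f y"
    and scale: "\<And>c x. x \<in> M \<Longrightarrow> f (c *\<^sub>R x) = c * f x"
    and le: "\<And>x. x \<in> M \<Longrightarrow> f x \<le> p x"
  obtains g where "linear g" "\<And>x. x \<in> M \<Longrightarrow> g x = f x" "\<And>x. g x \<le> p x"
proof -
  define K where "K = (\<lambda>m. (m, f m)) ` M"
  have f0: "f 0 = 0" using scale[OF subspace_0[OF M], of 0] by simp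
  have fneg: "f (- x) = - f x" if "x \<in> M" for x
    using scale[OF that, of "-1"] by simp
  obtain q where q: "sublinear q" "\<And>x. q x \<le> p x" "\<And>m s. (m, s) \<in> K \<Longrightarrow> q m \<le> s"
  proof (rule sublinear_inf_cone[OF p, of K])
    show "(0, 0) \<in> K" using subspace_0[OF M] f0 by (force simp: K_def)
    show "0 \<le> p (- m) + s" if "(m, s) \<in> K" for m s
      using that le[of "- m"] fneg[of m] subspace_neg[OF M, of m] by (auto simp: K_def)
  qed (use subspace_add[OF M] subspace_scale[OF M] add scale in \<open>auto simp: K_def image_iff\<close>)
  obtain g where g: "sublinear g" "g \<le> q" "\<And>r. sublinear r \<Longrightarrow> r \<le> g \<Longrightarrow> r = g"
    using ex_minimal_sublinear[OF q(1)] by blast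
  have lin: "linear g" using minimal_sublinear_linear g(1,3) by blast
  have gf: "g x \<le> f x" if "x \<in> M" for x
    using g(2) q(3)[of x "f x"] that by (force simp: K_def le_fun_def intro: order_trans)
  show ?thesis
  proof
    show "linear g" by fact
    show "g x \<le> p x" for x using g(2) q(2) by (meson le_fun_def order_trans)
    show "g x = f x" if "x \<in> M" for x
      using gf[OF that] gf[OF subspace_neg[OF M that]] fneg[OF that] linear_neg[OF lin, of x] by simp
  qed
qed

corollary Hahn_Banach_supporting:
  fixes p :: "'b::real_vector \<Rightarrow> real"
  assumes p: "sublinear p"
  obtains g where "linear g" "\<And>z. g z \<le> p z" "g x = p x"
proof -
  obtain q where q: "sublinear q" "q \<le> p" "q (- x) \<le> - p x"
    using sublinear_below_linear_at[OF p] by blast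
  obtain g where g: "linear g" "\<And>z. g z \<le> q z"
    using Hahn_Banach[OF q(1) subspace_single_0, of "\<lambda>_. 0"] sublinear_zero[OF q(1)] by auto
  have le: "g z \<le> p z" for z using g(2) q(2) by (meson le_fun_def order_trans)
  moreover have "g x = p x"
    using g(2)[of "- x"] q(3) linear_neg[OF g(1), of x] le[of x] by simp
  ultimately show ?thesis using that g(1) by blast
qed

section \<open>Seminorms and closed subspaces of finite codimension\<close>

definition seminorm :: "('b::real_vector \<Rightarrow> real) \<Rightarrow> bool" where
  "seminorm \<nu> \<longleftrightarrow> (\<forall>x y. \<nu> (x + y) \<le> \<nu> x + \<nu> y) \<and> (\<forall>c x. \<nu> (c *\<^sub>R x) = \<bar>c\<bar> * \<nu> x)"

lemma seminorm_add: "seminorm \<nu> \<Longrightarrow> \<nu> (x + y) \<le> \<nu> x + \<nu> y"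
  and seminorm_scale: "seminorm \<nu> \<Longrightarrow> \<nu> (c *\<^sub>R x) = \<bar>c\<bar> * \<nu> x"
  by (auto simp: seminorm_def)

lemma seminormI:
  assumes add: "\<And>x y. \<nu> (x + y) \<le> \<nu> x + \<nu> y"
    and le: "\<And>c x. c \<noteq> 0 \<Longrightarrow> \<nu> (c *\<^sub>R x) \<le> \<bar>c\<bar> * \<nu> x" and zero: "\<nu> 0 \<le> 0"
  shows "seminorm \<nu>"
proof -
  have "\<nu> (c *\<^sub>R x) = \<bar>c\<bar> * \<nu> x" for c x
  proof (cases "c = 0")
    case True
    then show ?thesis using le[of 2 0] zero by simp
  next
    case False
    then show ?thesis using le[OF False, of x] le[of "inverse c" "c *\<^sub>R x"] by (simp add: field_simps)
  qed
  then show ?thesis using add by (simp add: seminorm_def)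
qed

lemma seminorm_zero: "seminorm \<nu> \<Longrightarrow> \<nu> 0 = 0"
  using seminorm_scale[of \<nu> 0 0] by simp

lemma seminorm_minus: "seminorm \<nu> \<Longrightarrow> \<nu> (- x) = \<nu> x"
  using seminorm_scale[of \<nu> "- 1" x] by simp

lemma seminorm_diff: "seminorm \<nu> \<Longrightarrow> \<nu> (x - y) \<le> \<nu> x + \<nu> y"
  using seminorm_add[of \<nu> x "- y"] by (simp add: seminorm_minus)

lemma seminorm_nonneg: "seminorm \<nu> \<Longrightarrow> 0 \<le> \<nu> x"
  using seminorm_diff[of \<nu> x x] by (simp add: seminorm_zero)

lemma seminorm_imp_sublinear: "seminorm \<nu> \<Longrightarrow> sublinear \<nu>"
  by (simp add: seminorm_def sublinear_def)

lemma seminorm_norm: "seminorm norm"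
  by (simp add: seminorm_def norm_triangle_ineq)

lemma linear_le_seminorm_abs:
  assumes "seminorm \<nu>" "linear g" "\<And>x. g x \<le> \<nu> x"
  shows "\<bar>g x\<bar> \<le> \<nu> x"
  using assms(3)[of x] assms(3)[of "- x"] linear_neg[OF assms(2), of x] seminorm_minus[OF assms(1)]
  by (simp add: abs_le_iff)

lemma bounded_linear_le_seminorm:
  fixes g :: "'a::real_normed_vector \<Rightarrow> real"
  assumes "seminorm \<nu>" "linear g" "\<And>x. g x \<le> \<nu> x" "\<And>x. \<nu> x \<le> C * norm x"
  shows "bounded_linear g"
  using linear_le_seminorm_abs[OF assms(1-3)] assms(4) assms(2)
  by (intro bounded_linear_intro[where K = C])
    (auto simp: linear_add linear_scale mult.commute intro: order_trans)

section \<open>Quotients and extensions of seminorms\<close>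

definition quotient_seminorm :: "('b::real_vector \<Rightarrow> real) \<Rightarrow> 'b set \<Rightarrow> 'b \<Rightarrow> real" where
  "quotient_seminorm \<nu> V x = (INF v\<in>V. \<nu> (x - v))"

context
  fixes \<nu> :: "'b::real_vector \<Rightarrow> real" and V :: "'b set"
  assumes \<nu>: "seminorm \<nu>" and V: "subspace V"
begin

lemma quotient_seminorm_le: "v \<in> V \<Longrightarrow> quotient_seminorm \<nu> V x \<le> \<nu> (x - v)"
  unfolding quotient_seminorm_def
  by (rule cINF_lower) (auto intro!: bdd_belowI2[where m = 0] seminorm_nonneg[OF \<nu>])

lemma quotient_seminorm_greatest:
  "(\<And>v. v \<in> V \<Longrightarrow> c \<le> \<nu> (x - v)) \<Longrightarrow> c \<le> quotient_seminorm \<nu> V x"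
  unfolding quotient_seminorm_def using subspace_0[OF V] by (intro cINF_greatest) auto

lemma quotient_seminorm_less:
  assumes "quotient_seminorm \<nu> V x < c"
  obtains v where "v \<in> V" "\<nu> (x - v) < c"
  using assms quotient_seminorm_greatest[of c x] by force

lemma quotient_seminorm_le_self: "quotient_seminorm \<nu> V x \<le> \<nu> x"
  using quotient_seminorm_le[OF subspace_0[OF V], of x] by simp

lemma quotient_seminorm_eq_0: "v \<in> V \<Longrightarrow> quotient_seminorm \<nu> V v = 0"
proof (rule antisym)
  assume v: "v \<in> V"
  then show "quotient_seminorm \<nu> V v \<le> 0"
    using quotient_seminorm_le[OF v, of v] by (simp add: seminorm_zero[OF \<nu>])
  show "0 \<le> quotient_seminorm \<nu> V v"
    by (rule quotient_seminorm_greatest) (rule seminorm_nonneg[OF \<nu>])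
qed

lemma seminorm_quotient: "seminorm (quotient_seminorm \<nu> V)"
proof (rule seminormI)
  let ?q = "quotient_seminorm \<nu> V"
  have *: "?q (x + y) \<le> \<nu> (x - v) + \<nu> (y - w)" if "v \<in> V" "w \<in> V" for x y v w
    using quotient_seminorm_le[OF subspace_add[OF V that], of "x + y"]
      seminorm_add[OF \<nu>, of "x - v" "y - w"] by (simp add: algebra_simps)
  show "?q (x + y) \<le> ?q x + ?q y" for x y
  proof -
    have "?q (x + y) - \<nu> (x - v) \<le> ?q y" if "v \<in> V" for v
    proof (rule quotient_seminorm_greatest)
      fix w assume "w \<in> V"
      then show "?q (x + y) - \<nu> (x - v) \<le> \<nu> (y - w)" using *[OF that, of w x y] by simp
    qed
    then have "?q (x + y) - ?q y \<le> \<nu> (x - v)" if "v \<in> V" for v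
      using that by fastforce
    then have "?q (x + y) - ?q y \<le> ?q x"
      by (rule quotient_seminorm_greatest)
    then show ?thesis by simp
  qed
  show "?q (c *\<^sub>R x) \<le> \<bar>c\<bar> * ?q x" if "c \<noteq> 0" for c x
  proof -
    have "?q (c *\<^sub>R x) / \<bar>c\<bar> \<le> ?q x"
    proof (rule quotient_seminorm_greatest)
      fix v assume "v \<in> V"
      then have "?q (c *\<^sub>R x) \<le> \<nu> (c *\<^sub>R (x - v))"
        using quotient_seminorm_le[OF subspace_scale[OF V, of v c], of "c *\<^sub>R x"]
        by (simp add: scaleR_diff_right)
      also have "\<dots> = \<bar>c\<bar> * \<nu> (x - v)" by (rule seminorm_scale[OF \<nu>])
      finally show "?q (c *\<^sub>R x) / \<bar>c\<bar> \<le> \<nu> (x - v)"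
        using that by (simp add: divide_le_eq mult.commute)
    qed
    then show ?thesis using that by (simp add: field_simps)
  qed
  show "?q 0 \<le> 0" using quotient_seminorm_eq_0[OF subspace_0[OF V]] by simp
qed

end

text \<open>An equivalent norm on \<open>Y\<close> is given on \<open>Y\<close> only, whereas
  flatness and the game use seminorms on the whole type. The extension is the infimal convolution of
  \<open>n\<close> with \<open>C\<close> times the norm; the hypothesis \<open>le\<close> preserves
  the values on \<open>S\<close>.\<close>

lemma seminorm_extension:
  fixes n :: "'a::real_normed_vector \<Rightarrow> real"
  assumes S: "subspace S"
    and add: "\<And>x y. x \<in> S \<Longrightarrow> y \<in> S \<Longrightarrow> n (x + y) \<le> n x + n y"
    and scale: "\<And>c x. x \<in> S \<Longrightarrow> n (c *\<^sub>R x) = \<bar>c\<bar> * n x"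
    and le: "\<And>x. x \<in> S \<Longrightarrow> n x \<le> C * norm x" and C: "C \<ge> 0"
  obtains \<nu> where "seminorm \<nu>" "\<And>x. x \<in> S \<Longrightarrow> \<nu> x = n x" "\<And>x. \<nu> x \<le> C * norm x"
proof
  define \<nu> where "\<nu> x = (INF u\<in>S. n u + C * norm (x - u))" for x
  have n0: "n 0 = 0" using scale[OF subspace_0[OF S], of 0] by simp
  have nm: "n (- u) = n u" if "u \<in> S" for u using scale[OF that, of "- 1"] by simp
  have nn: "0 \<le> n u" if "u \<in> S" for u
    using add[OF that subspace_neg[OF S that]] nm[OF that] n0 by simp
  have bdd: "bdd_below ((\<lambda>u. n u + C * norm (x - u)) ` S)" for x
    by (rule bdd_belowI2[where m = 0]) (use nn C in auto)
  have low: "\<nu> x \<le> n u + C * norm (x - u)" if "u \<in> S" for x u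
    unfolding \<nu>_def by (rule cINF_lower[OF bdd that])
  have great: "c \<le> \<nu> x" if "\<And>u. u \<in> S \<Longrightarrow> c \<le> n u + C * norm (x - u)" for x c
    unfolding \<nu>_def using subspace_0[OF S] that by (intro cINF_greatest) auto
  show "\<nu> x \<le> C * norm x" for x using low[OF subspace_0[OF S], of x] n0 by simp
  show "\<nu> x = n x" if "x \<in> S" for x
  proof (rule antisym)
    show "\<nu> x \<le> n x" using low[OF that, of x] by simp
    show "n x \<le> \<nu> x"
    proof (rule great)
      fix u assume u: "u \<in> S"
      show "n x \<le> n u + C * norm (x - u)"
        using add[OF u subspace_diff[OF S that u]] le[OF subspace_diff[OF S that u]] by simp
    qed
  qed
  show "seminorm \<nu>"
  proof (rule seminormI)
    fix x y
    have *: "\<nu> (x + y) \<le> (n u + C * norm (x - u)) + (n v + C * norm (y - v))"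
      if "u \<in> S" "v \<in> S" for u v
    proof -
      have "norm (x + y - (u + v)) \<le> norm (x - u) + norm (y - v)"
        using norm_triangle_ineq[of "x - u" "y - v"] by (simp add: algebra_simps)
      then have "C * norm (x + y - (u + v)) \<le> C * norm (x - u) + C * norm (y - v)"
        using C mult_left_mono by (fastforce simp flip: distrib_left)
      then show ?thesis
        using low[OF subspace_add[OF S that], of "x + y"] add[OF that] by linarith
    qed
    have "\<nu> (x + y) - (n u + C * norm (x - u)) \<le> \<nu> y" if "u \<in> S" for u
      using *[OF that] by (intro great) (simp add: algebra_simps)
    then have "\<nu> (x + y) - \<nu> y \<le> \<nu> x"
      by (intro great) (simp add: algebra_simps)
    then show "\<nu> (x + y) \<le> \<nu> x + \<nu> y" by simp
  next
    show "\<nu> (c *\<^sub>R x) \<le> \<bar>c\<bar> * \<nu> x" if "c \<noteq> 0" for c x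
    proof -
      have "\<nu> (c *\<^sub>R x) / \<bar>c\<bar> \<le> \<nu> x"
      proof (rule great)
        fix u assume u: "u \<in> S"
        have "\<nu> (c *\<^sub>R x) \<le> \<bar>c\<bar> * n u + C * norm (c *\<^sub>R (x - u))"
          using low[OF subspace_scale[OF S u, of c], of "c *\<^sub>R x"] scale[OF u, of c]
          by (simp add: scaleR_diff_right)
        also have "norm (c *\<^sub>R (x - u)) = \<bar>c\<bar> * norm (x - u)" by (rule norm_scaleR)
        also have "\<bar>c\<bar> * n u + C * (\<bar>c\<bar> * norm (x - u)) = (n u + C * norm (x - u)) * \<bar>c\<bar>" by (simp add: algebra_simps)
        finally show "\<nu> (c *\<^sub>R x) / \<bar>c\<bar> \<le> n u + C * norm (x - u)"
          using that by (simp add: divide_le_eq)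
      qed
      then show ?thesis using that by (simp add: field_simps)
    qed
    show "\<nu> 0 \<le> 0" using low[OF subspace_0[OF S], of 0] n0 by simp
  qed
qed

text \<open>\<open>eventually\<close> in this filter means: for all vectors of some closed subspace
  of finite codimension, presented as a common kernel. Nested \<open>eventually\<close> statements
  express that each subspace may depend on the earlier vectors, and finitely many conditions combine
  automatically.\<close>

definition finite_codim_filter :: "'a::real_normed_vector filter" where
  "finite_codim_filter = (INF \<phi>\<in>{\<phi>. bounded_linear \<phi>}. principal {x. \<phi> x = (0::real)})"

lemma eventually_finite_codim:
  "eventually P finite_codim_filter \<longleftrightarrow>
    (\<exists>\<Phi>. finite \<Phi> \<and> (\<forall>\<phi>\<in>\<Phi>. bounded_linear \<phi>) \<and> (\<forall>x. (\<forall>\<phi>\<in>\<Phi>. \<phi> x = (0::real)) \<longrightarrow> P x))"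
proof -
  have *: "eventually P (INF \<phi>\<in>\<Phi>. principal {x. \<phi> x = (0::real)}) \<longleftrightarrow>
      (\<forall>x. (\<forall>\<phi>\<in>\<Phi>. \<phi> x = 0) \<longrightarrow> P x)" if "finite \<Phi>" for \<Phi>
    using that by (auto simp: INF_principal_finite eventually_principal)
  show ?thesis
    unfolding finite_codim_filter_def by (subst eventually_INF) (use * in blast)
qed

lemma eventually_finite_codim_0: "eventually P finite_codim_filter \<Longrightarrow> P 0"
  unfolding eventually_finite_codim by (metis bounded_linear.linear linear_0)

lemma eventually_finite_codim_scale:
  assumes "eventually P finite_codim_filter"
  shows "\<forall>\<^sub>F y in finite_codim_filter. P (c *\<^sub>R y)"
proof -
  obtain \<Phi> where "finite \<Phi>" "\<And>\<phi>. \<phi> \<in> \<Phi> \<Longrightarrow> bounded_linear \<phi>"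
    "\<And>x. (\<forall>\<phi>\<in>\<Phi>. \<phi> x = (0::real)) \<Longrightarrow> P x"
    using assms unfolding eventually_finite_codim by blast
  then show ?thesis
    unfolding eventually_finite_codim
    by (intro exI[of _ \<Phi>]) (auto simp: linear_scale bounded_linear.linear)
qed

text \<open>Subtracting the sum of the e_i(v) y_i projects \<open>V\<close> onto its intersection
  with the kernel of \<Phi>. The construction is as in Gram--Schmidt: a functional that does not
  vanish on the vectors projected so far contributes one new direction. The class
  \<open>\<C>\<close> records where the coefficients live: the bounded functionals in one use, point
  evaluations on a space of functionals in the other.\<close>

lemma finite_kernel_projection:
  fixes V :: "'b::real_vector set" and \<Phi> \<C> :: "('b \<Rightarrow> real) set"
  assumes "finite \<Phi>" and V: "subspace V" and "\<Phi> \<subseteq> \<C>"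
    and lin: "\<And>f. f \<in> \<C> \<Longrightarrow> linear f"
    and comb: "\<And>f g c. f \<in> \<C> \<Longrightarrow> g \<in> \<C> \<Longrightarrow> (\<lambda>x. f x - c * g x) \<in> \<C>"
  obtains n :: nat and y e
  where "\<forall>i<n. y i \<in> V \<and> e i \<in> \<C> \<and> (\<forall>v\<in>V. (\<forall>\<phi>\<in>\<Phi>. \<phi> v = 0) \<longrightarrow> e i v = 0)"
    "\<forall>v\<in>V. \<forall>\<phi>\<in>\<Phi>. \<phi> (v - (\<Sum>i<n. e i v *\<^sub>R y i)) = 0"
proof -
  have "\<exists>n y e. (\<forall>i<n. y i \<in> V \<and> e i \<in> \<C> \<and> (\<forall>v\<in>V. (\<forall>\<phi>\<in>\<Phi>. \<phi> v = 0) \<longrightarrow> e i v = 0)) \<and>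
      (\<forall>v\<in>V. \<forall>\<phi>\<in>\<Phi>. \<phi> (v - (\<Sum>i<n::nat. e i v *\<^sub>R y i)) = 0)"
    using \<open>finite \<Phi>\<close> \<open>\<Phi> \<subseteq> \<C>\<close>
  proof (induction rule: finite_induct)
    case empty
    show ?case by (rule exI[of _ 0]) auto
  next
    case (insert \<phi> \<Phi>)
    from insert.prems have \<phi>: "\<phi> \<in> \<C>" and sub: "\<Phi> \<subseteq> \<C>" by auto
    obtain n y e where ye: "\<forall>i<n. y i \<in> V \<and> e i \<in> \<C> \<and> (\<forall>v\<in>V. (\<forall>\<phi>\<in>\<Phi>. \<phi> v = 0) \<longrightarrow> e i v = 0)"
      and P0: "\<forall>v\<in>V. \<forall>\<phi>\<in>\<Phi>. \<phi> (v - (\<Sum>i<n::nat. e i v *\<^sub>R y i)) = 0"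
      using insert.IH[OF sub] by (elim exE conjE)
    define P where "P v = v - (\<Sum>i<n. e i v *\<^sub>R y i)" for v
    have PV: "P v \<in> V" if "v \<in> V" for v
      unfolding P_def using that ye by (intro subspace_diff subspace_sum subspace_scale V) auto
    show ?case
    proof (cases "\<forall>v\<in>V. \<phi> (P v) = 0")
      case True
      show ?thesis
        using ye P0 True[unfolded P_def] by (intro exI[of _ n] exI[of _ y] exI[of _ e]) simp
    next
      case False
      then obtain v0 where v0: "v0 \<in> V" "\<phi> (P v0) \<noteq> 0" by blast
      define w where "w = inverse (\<phi> (P v0)) *\<^sub>R P v0"
      have wV: "w \<in> V" unfolding w_def using PV v0 V by (intro subspace_scale) auto
      have w\<phi>: "\<phi> w = 1" unfolding w_def using v0 lin[OF \<phi>] by (simp add: linear_scale)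
      have P0': "\<psi> (P v) = 0" if "\<psi> \<in> \<Phi>" "v \<in> V" for \<psi> v
        using P0 that by (simp add: P_def)
      have lin\<Phi>: "linear \<psi>" if "\<psi> \<in> \<Phi>" for \<psi> using lin sub that by blast
      have w\<psi>: "\<psi> w = 0" if "\<psi> \<in> \<Phi>" for \<psi>
        unfolding w_def using P0'[OF that v0(1)] lin\<Phi>[OF that] by (simp add: linear_scale)
      have \<phi>P: "\<phi> (P v) = \<phi> v - (\<Sum>i<n. e i v * \<phi> (y i))" for v
        unfolding P_def using lin[OF \<phi>] by (simp add: linear_diff linear_sum linear_scale)
      have "(\<lambda>x. \<phi> x - (\<Sum>i<k. e i x * \<phi> (y i))) \<in> \<C>" if "k \<le> n" for k
        using that
      proof (induction k)
        case (Suc k)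
        then have "(\<lambda>x. (\<phi> x - (\<Sum>i<k. e i x * \<phi> (y i))) - \<phi> (y k) * e k x) \<in> \<C>"
          using ye by (intro comb) auto
        then show ?case by (simp add: algebra_simps)
      qed (simp add: \<phi>)
      then have en: "(\<lambda>x. \<phi> (P x)) \<in> \<C>" by (simp add: \<phi>P)
      define y' where "y' = y(n := w)"
      \<comment> \<open>The new coefficient is \<phi> after the old projection, so that the old
        coefficients need no change.\<close>
      define e' where "e' = e(n := \<lambda>x. \<phi> (P x))"
      have P': "v - (\<Sum>i<Suc n. e' i v *\<^sub>R y' i) = P v - \<phi> (P v) *\<^sub>R w" for v
        by (simp add: y'_def e'_def P_def)
      have "e' i v = 0" if "i < Suc n" "v \<in> V" "\<forall>\<psi>\<in>insert \<phi> \<Phi>. \<psi> v = 0" for i v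
      proof (cases "i = n")
        case True
        have "e j v = 0" if "j < n" for j using ye that \<open>v \<in> V\<close> \<open>\<forall>\<psi>\<in>insert \<phi> \<Phi>. \<psi> v = 0\<close> by simp
        then show ?thesis using True that(3) by (simp add: e'_def \<phi>P)
      qed (use that ye in \<open>auto simp: e'_def less_Suc_eq\<close>)
      moreover have "y' i \<in> V \<and> e' i \<in> \<C>" if "i < Suc n" for i
        using that ye wV en by (auto simp: y'_def e'_def less_Suc_eq)
      moreover have "\<psi> (v - (\<Sum>i<Suc n. e' i v *\<^sub>R y' i)) = 0" if "v \<in> V" "\<psi> \<in> insert \<phi> \<Phi>" for v \<psi>
      proof (cases "\<psi> = \<phi>")
        case True
        then show ?thesis
          unfolding P' using w\<phi> lin[OF \<phi>] by (simp add: linear_diff linear_scale)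
      next
        case False
        then have "\<psi> \<in> \<Phi>" using that by simp
        then show ?thesis
          unfolding P' using P0'[of \<psi> v] w\<psi>[of \<psi>] lin\<Phi>[of \<psi>] that(1)
          by (simp add: linear_diff linear_scale)
      qed
      ultimately show ?thesis
        by (intro exI[of _ "Suc n"] exI[of _ y'] exI[of _ e']) blast
    qed
  qed
  then show ?thesis using that by (elim exE conjE)
qed

lemma finite_kernel_projection_bounded:
  fixes V :: "'a::real_normed_vector set" and \<Phi> :: "('a \<Rightarrow> real) set"
  assumes "finite \<Phi>" "subspace V" "\<And>\<phi>. \<phi> \<in> \<Phi> \<Longrightarrow> bounded_linear \<phi>"
  obtains n :: nat and y e
  where "\<forall>i<n. y i \<in> V \<and> bounded_linear (e i) \<and> (\<forall>v\<in>V. (\<forall>\<phi>\<in>\<Phi>. \<phi> v = 0) \<longrightarrow> e i v = 0)"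
    "\<forall>v\<in>V. \<forall>\<phi>\<in>\<Phi>. \<phi> (v - (\<Sum>i<n. e i v *\<^sub>R y i)) = 0"
proof (rule finite_kernel_projection[OF assms(1,2), of "{f. bounded_linear f}"])
  show "(\<lambda>x. f x - c * g x) \<in> {f. bounded_linear f}"
    if "f \<in> {f. bounded_linear f}" "g \<in> {f. bounded_linear f}" for f g and c :: real
    using that by (auto intro: bounded_linear_sub bounded_linear_const_mult)
qed (use assms(3) that in \<open>auto simp: bounded_linear.linear\<close>)

text \<open>Total boundedness with respect to finitely many bounded coordinates: points whose scaled
  coordinates have the same integer parts are \<epsilon>-close, and only finitely many patterns of
  integer parts occur. It is applied to a ball of functionals and to the unit ball of the
  space.\<close>

lemma finite_representatives:
  fixes e :: "nat \<Rightarrow> 'w \<Rightarrow> real"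
  assumes bnd: "\<And>i w. i < n \<Longrightarrow> w \<in> \<Omega> \<Longrightarrow> \<bar>e i w\<bar> \<le> M" and \<epsilon>: "\<epsilon> > 0"
  shows "\<exists>\<Omega>'. finite \<Omega>' \<and> \<Omega>' \<subseteq> \<Omega> \<and> (\<forall>w\<in>\<Omega>. \<exists>w'\<in>\<Omega>'. \<forall>i<n. \<bar>e i w - e i w'\<bar> \<le> \<epsilon>)"
proof -
  define g where "g w = (\<lambda>i\<in>{..<n}. \<lfloor>e i w / \<epsilon>\<rfloor>)" for w
  have "g ` \<Omega> \<subseteq> PiE {..<n} (\<lambda>_. {\<lfloor>- M / \<epsilon>\<rfloor>..\<lfloor>M / \<epsilon>\<rfloor>})"
  proof clarify
    fix w assume "w \<in> \<Omega>"
    then have "- M \<le> e i w \<and> e i w \<le> M" if "i < n" for i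
      using bnd[OF that, of w] by (auto simp: abs_le_iff)
    then show "g w \<in> PiE {..<n} (\<lambda>_. {\<lfloor>- M / \<epsilon>\<rfloor>..\<lfloor>M / \<epsilon>\<rfloor>})"
      using \<epsilon> unfolding g_def restrict_PiE_iff
      by (auto intro!: floor_mono simp: divide_right_mono pos_le_divide_eq pos_divide_le_eq)
  qed
  then have fin: "finite (g ` \<Omega>)" by (rule finite_subset) (auto intro!: finite_PiE)
  obtain \<Omega>' where \<Omega>': "\<Omega>' \<subseteq> \<Omega>" "finite \<Omega>'" "g ` \<Omega> = g ` \<Omega>'"
    using finite_subset_image[OF fin order_refl] by metis
  show ?thesis
  proof (intro exI[of _ \<Omega>'] conjI ballI \<Omega>'(1,2))
    fix w assume "w \<in> \<Omega>"
    then obtain w' where w': "w' \<in> \<Omega>'" "g w = g w'" using \<Omega>'(3) by blast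
    have "\<bar>e i w - e i w'\<bar> \<le> \<epsilon>" if "i < n" for i
    proof -
      have "\<lfloor>e i w / \<epsilon>\<rfloor> = \<lfloor>e i w' / \<epsilon>\<rfloor>" using fun_cong[OF w'(2), of i] that by (simp add: g_def)
      then have "\<bar>e i w / \<epsilon> - e i w' / \<epsilon>\<bar> \<le> 1" by linarith
      then show ?thesis using \<epsilon> by (simp add: field_simps flip: diff_divide_distrib)
    qed
    then show "\<exists>w'\<in>\<Omega>'. \<forall>i<n. \<bar>e i w - e i w'\<bar> \<le> \<epsilon>" using w'(1) by blast
  qed
qed

lemma infdist_eq_quotient_seminorm:
  "V \<noteq> {} \<Longrightarrow> infdist x V = quotient_seminorm norm V x"
  by (simp add: infdist_notempty quotient_seminorm_def dist_norm)

text \<open>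
  The constant 3 does not depend on \<open>\<Phi>\<close>. The functionals on \<open>Y\<close> vanishing on the kernel of \<open>\<Phi>\<close> are
  determined by finitely many values, so rounding these values leaves finitely many representatives
  that still norm the quotient up to a factor 2.
\<close>

lemma eventually_near_subspace_kernel:
  fixes Y :: "'a::real_normed_vector set"
  assumes Y: "subspace Y" and "finite \<Phi>" and bl: "\<And>\<phi>. \<phi> \<in> \<Phi> \<Longrightarrow> bounded_linear (\<phi> :: 'a \<Rightarrow> real)"
  shows "\<forall>\<^sub>F u in finite_codim_filter. \<forall>a. infdist u Y < a \<longrightarrow>
    (\<exists>y\<in>Y. (\<forall>\<phi>\<in>\<Phi>. \<phi> y = 0) \<and> norm (u - y) \<le> 3 * a)"
proof -
  define V where "V = {y \<in> Y. \<forall>\<phi>\<in>\<Phi>. \<phi> y = 0}"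
  have lin\<Phi>: "linear \<phi>" if "\<phi> \<in> \<Phi>" for \<phi> using bl[OF that] bounded_linear.linear by blast
  have V: "subspace V"
    unfolding V_def subspace_def using lin\<Phi> subspace_0[OF Y] subspace_add[OF Y] subspace_scale[OF Y]
    by (auto simp: linear_0 linear_add linear_scale)
  define d where "d = quotient_seminorm norm V"
  have sd: "seminorm d" unfolding d_def by (rule seminorm_quotient[OF seminorm_norm V])
  have d_le: "d x \<le> norm x" for x
    unfolding d_def by (rule quotient_seminorm_le_self[OF seminorm_norm V])
  have d0: "d v = 0" if "v \<in> V" for v
    unfolding d_def by (rule quotient_seminorm_eq_0[OF seminorm_norm V that])
  obtain n :: nat and y e
    where ye: "\<forall>i<n. y i \<in> Y \<and> bounded_linear (e i) \<and> (\<forall>v\<in>Y. (\<forall>\<phi>\<in>\<Phi>. \<phi> v = 0) \<longrightarrow> e i v = 0)"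
      and P0: "\<forall>v\<in>Y. \<forall>\<phi>\<in>\<Phi>. \<phi> (v - (\<Sum>i<n. e i v *\<^sub>R y i)) = 0"
    by (rule finite_kernel_projection_bounded[OF \<open>finite \<Phi>\<close> Y bl]) blast
  have y: "y i \<in> Y" and e: "bounded_linear (e i)" if "i < n" for i using ye that by auto
  define B where "B = (\<Sum>i<n. onorm (e i)) + 1"
  have on: "0 \<le> onorm (e i)" if "i < n" for i using e[OF that] by (simp add: onorm_pos_le)
  have B: "B > 0" unfolding B_def using on by (intro add_nonneg_pos sum_nonneg) auto
  \<comment> \<open>As \<open>e i\<close> vanishes on \<open>V\<close>, it is bounded not only by
    the norm but by the distance \<open>d\<close> to \<open>V\<close>; this measures the rounding
    error in terms of \<open>d z\<close>.\<close>
  have e_le: "\<bar>e i v\<bar> \<le> onorm (e i) * d v" if "i < n" for i v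
  proof (cases "onorm (e i) = 0")
    case True
    then show ?thesis using onorm[of "e i" v] e[OF that] by simp
  next
    case False
    have "\<bar>e i v\<bar> / onorm (e i) \<le> d v"
      unfolding d_def
    proof (rule quotient_seminorm_greatest[OF seminorm_norm V])
      fix w assume "w \<in> V"
      then have "e i w = 0" using ye that by (auto simp: V_def)
      then have "e i v = e i (v - w)" using e[OF that] by (simp add: linear_diff bounded_linear.linear)
      then show "\<bar>e i v\<bar> / onorm (e i) \<le> norm (v - w)"
        using onorm[of "e i" "v - w"] e[OF that] on[OF that] False by (simp add: divide_le_eq mult.commute)
    qed
    then show ?thesis using on[OF that] False by (simp add: divide_le_eq mult.commute)
  qed
  define \<Omega> where "\<Omega> = {\<psi>::'a \<Rightarrow> real. linear \<psi> \<and> (\<forall>x. \<psi> x \<le> d x)}"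
  have \<Omega>V: "\<psi> v = 0" if "\<psi> \<in> \<Omega>" "v \<in> V" for \<psi> v
    using linear_le_seminorm_abs[OF sd, of \<psi> v] that d0 by (auto simp: \<Omega>_def)
  have \<Omega>abs: "\<bar>\<psi> x\<bar> \<le> d x" if "\<psi> \<in> \<Omega>" for \<psi> x
    using linear_le_seminorm_abs[OF sd, of \<psi> x] that by (auto simp: \<Omega>_def)
  have bnd: "\<bar>\<psi> (y i)\<bar> \<le> (\<Sum>j<n. norm (y j))" if "i < n" "\<psi> \<in> \<Omega>" for i \<psi>
  proof -
    have "\<bar>\<psi> (y i)\<bar> \<le> norm (y i)" using \<Omega>abs[OF that(2), of "y i"] d_le[of "y i"] by linarith
    also have "\<dots> \<le> (\<Sum>j<n. norm (y j))" using that by (intro member_le_sum) auto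
    finally show ?thesis .
  qed
  \<comment> \<open>The tolerance 1 / (2 B) is such that rounding changes the value at any z in
    \<open>Y\<close> by at most half of \<open>d z\<close>.\<close>
  have "\<exists>\<Omega>'. finite \<Omega>' \<and> \<Omega>' \<subseteq> \<Omega> \<and>
      (\<forall>\<psi>\<in>\<Omega>. \<exists>\<psi>'\<in>\<Omega>'. \<forall>i<n. \<bar>\<psi> (y i) - \<psi>' (y i)\<bar> \<le> 1 / (2 * B))"
    by (rule finite_representatives[where M = "\<Sum>j<n. norm (y j)"]) (use B bnd in auto)
  then obtain \<Omega>' where \<Omega>': "finite \<Omega>'" "\<Omega>' \<subseteq> \<Omega>"
    "\<And>\<psi>. \<psi> \<in> \<Omega> \<Longrightarrow> \<exists>\<psi>'\<in>\<Omega>'. \<forall>i<n. \<bar>\<psi> (y i) - \<psi>' (y i)\<bar> \<le> 1 / (2 * B)"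
    by blast
  show ?thesis
    unfolding eventually_finite_codim
  proof (intro exI[of _ \<Omega>'] conjI ballI allI impI)
    show "finite \<Omega>'" by fact
    show "bounded_linear \<psi>" if "\<psi> \<in> \<Omega>'" for \<psi>
      using \<Omega>'(2) that d_le bounded_linear_le_seminorm[OF sd, of \<psi> 1] by (auto simp: \<Omega>_def)
    fix u :: 'a and a :: real
    assume u: "\<forall>\<psi>\<in>\<Omega>'. \<psi> u = 0" and "infdist u Y < a"
    then obtain z where z: "z \<in> Y" "norm (u - z) < a"
      using quotient_seminorm_less[OF seminorm_norm Y, of u a] subspace_0[OF Y]
      by (metis empty_iff infdist_eq_quotient_seminorm)
    obtain \<psi> where \<psi>: "linear \<psi>" "\<And>x. \<psi> x \<le> d x" "\<psi> z = d z"
      using Hahn_Banach_supporting[OF seminorm_imp_sublinear[OF sd], of z] by blast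
    have \<psi>\<Omega>: "\<psi> \<in> \<Omega>" using \<psi> by (auto simp: \<Omega>_def)
    obtain \<psi>' where \<psi>': "\<psi>' \<in> \<Omega>'" "\<And>i. i < n \<Longrightarrow> \<bar>\<psi> (y i) - \<psi>' (y i)\<bar> \<le> 1 / (2 * B)"
      using \<Omega>'(3)[OF \<psi>\<Omega>] by blast
    then have \<psi>'\<Omega>: "\<psi>' \<in> \<Omega>" using \<Omega>'(2) by blast
    have lin': "linear \<psi>'" using \<psi>'\<Omega> by (simp add: \<Omega>_def)
    define P where "P = z - (\<Sum>i<n. e i z *\<^sub>R y i)"
    have "(\<Sum>i<n. e i z *\<^sub>R y i) \<in> Y" using y by (intro subspace_sum subspace_scale Y) auto
    then have PV: "P \<in> V" using P0 z(1) Y by (simp add: V_def P_def subspace_diff)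
    have ex: "\<theta> z = (\<Sum>i<n. e i z * \<theta> (y i))" if "\<theta> \<in> \<Omega>" for \<theta>
      using \<Omega>V[OF that PV] that unfolding P_def
      by (simp add: \<Omega>_def linear_diff linear_sum linear_scale)
    have dz: "0 \<le> d z" by (rule seminorm_nonneg[OF sd])
    have "\<psi> z - \<psi>' z = (\<Sum>i<n. e i z * (\<psi> (y i) - \<psi>' (y i)))"
      unfolding ex[OF \<psi>\<Omega>] ex[OF \<psi>'\<Omega>] by (simp add: sum_subtractf algebra_simps)
    also have "\<dots> \<le> (\<Sum>i<n. (onorm (e i) * d z) * (1 / (2 * B)))"
    proof (rule sum_mono)
      fix i assume "i \<in> {..<n}"
      then have i: "i < n" by simp
      have "e i z * (\<psi> (y i) - \<psi>' (y i)) \<le> \<bar>e i z\<bar> * \<bar>\<psi> (y i) - \<psi>' (y i)\<bar>"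
        by (metis abs_ge_self abs_mult)
      also have "\<dots> \<le> (onorm (e i) * d z) * (1 / (2 * B))"
        using e_le[OF i] \<psi>'(2)[OF i] on[OF i] dz by (intro mult_mono) auto
      finally show "e i z * (\<psi> (y i) - \<psi>' (y i)) \<le> (onorm (e i) * d z) * (1 / (2 * B))" .
    qed
    also have "\<dots> = (B - 1) * d z / (2 * B)"
      by (simp add: B_def sum_distrib_right sum_divide_distrib)
    also have "\<dots> \<le> d z / 2" using B dz by (simp add: field_simps)
    \<comment> \<open>Only \<psi>' is known to vanish at \<open>u\<close>, hence the passage from
      \<psi> to \<psi>'. The bound d z < 2 a obtained from it and norm (u - z) < a add up to the
      factor 3.\<close>
    finally have "d z / 2 \<le> \<psi>' z" using \<psi>(3) by simp
    also have "\<dots> = \<psi>' (z - u)" using u \<psi>'(1) lin' by (simp add: linear_diff)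
    also have "\<dots> \<le> norm (u - z)"
      using \<Omega>abs[OF \<psi>'\<Omega>, of "z - u"] d_le[of "z - u"] by (simp add: norm_minus_commute)
    finally have "d z < 2 * a" using z(2) by simp
    then obtain v where v: "v \<in> V" "norm (z - v) < 2 * a"
      unfolding d_def using quotient_seminorm_less[OF seminorm_norm V] by blast
    have "norm (u - v) \<le> norm (u - z) + norm (z - v)"
      using norm_triangle_ineq[of "u - z" "z - v"] by simp
    then have "norm (u - v) \<le> 3 * a" using z(2) v(2) by simp
    then show "\<exists>y\<in>Y. (\<forall>\<phi>\<in>\<Phi>. \<phi> y = 0) \<and> norm (u - y) \<le> 3 * a"
      using v(1) by (auto simp: V_def)
  qed
qed

text \<open>For the dual estimate: there functionals can be required to vanish on a finite set
  \<open>F\<close>, but the vectors are confined to a kernel. \<open>F\<close> contains the y_i and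
  a finite net z' of the ball for the coefficients, so g does not notice when z is corrected to z -
  z' minus a combination of the y_i. Each of the three terms has norm at most 1, which gives the
  bound 3.\<close>

lemma finite_set_norming_kernel:
  fixes \<Phi> :: "('a::real_normed_vector \<Rightarrow> real) set"
  assumes "finite \<Phi>" and bl: "\<And>\<phi>. \<phi> \<in> \<Phi> \<Longrightarrow> bounded_linear \<phi>"
  obtains F where "finite F"
    "\<And>g z. linear g \<Longrightarrow> (\<And>x. x \<in> F \<Longrightarrow> g x = (0::real)) \<Longrightarrow> norm z \<le> 1 \<Longrightarrow>
      \<exists>w. (\<forall>\<phi>\<in>\<Phi>. \<phi> w = 0) \<and> norm w \<le> 3 \<and> g w = g z"
proof -
  obtain n :: nat and y e
    where ye: "\<forall>i<n. y i \<in> UNIV \<and> bounded_linear (e i) \<and> (\<forall>v\<in>UNIV. (\<forall>\<phi>\<in>\<Phi>. \<phi> v = 0) \<longrightarrow> e i v = 0)"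
      and P0: "\<forall>v\<in>UNIV. \<forall>\<phi>\<in>\<Phi>. \<phi> (v - (\<Sum>i<n. e i v *\<^sub>R y i)) = 0"
    by (rule finite_kernel_projection_bounded[OF \<open>finite \<Phi>\<close> subspace_UNIV bl]) blast
  have e: "bounded_linear (e i)" if "i < n" for i using ye that by auto
  define B where "B = (\<Sum>i<n. norm (y i)) + 1"
  have B: "B > 0" unfolding B_def by (intro add_nonneg_pos sum_nonneg) auto
  have on: "0 \<le> onorm (e i)" if "i < n" for i using e[OF that] by (simp add: onorm_pos_le)
  have bnd: "\<bar>e i z\<bar> \<le> (\<Sum>j<n. onorm (e j))" if "i < n" "z \<in> cball 0 1" for i z
  proof -
    have "\<bar>e i z\<bar> \<le> onorm (e i) * norm z" using onorm[of "e i" z] e[OF that(1)] by simp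
    also have "\<dots> \<le> onorm (e i)" using that on[OF that(1)] by (simp add: mult_left_le)
    also have "\<dots> \<le> (\<Sum>j<n. onorm (e j))" using that on by (intro member_le_sum) auto
    finally show ?thesis .
  qed
  have "\<exists>\<Omega>'. finite \<Omega>' \<and> \<Omega>' \<subseteq> cball 0 1 \<and>
      (\<forall>z\<in>cball 0 1. \<exists>z'\<in>\<Omega>'. \<forall>i<n. \<bar>e i z - e i z'\<bar> \<le> 1 / B)"
    by (rule finite_representatives[where M = "\<Sum>j<n. onorm (e j)"]) (use B bnd in auto)
  then obtain \<Omega>' where \<Omega>': "finite \<Omega>'" "\<Omega>' \<subseteq> cball 0 1"
    "\<And>z. z \<in> cball 0 1 \<Longrightarrow> \<exists>z'\<in>\<Omega>'. \<forall>i<n. \<bar>e i z - e i z'\<bar> \<le> 1 / B"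
    by blast
  show ?thesis
  proof (rule that[of "\<Omega>' \<union> y ` {..<n}"])
    show "finite (\<Omega>' \<union> y ` {..<n})" using \<Omega>'(1) by simp
    fix g :: "'a \<Rightarrow> real" and z :: 'a
    assume g: "linear g" and g0: "\<And>x. x \<in> \<Omega>' \<union> y ` {..<n} \<Longrightarrow> g x = 0" and z: "norm z \<le> 1"
    obtain z' where z': "z' \<in> \<Omega>'" "\<And>i. i < n \<Longrightarrow> \<bar>e i z - e i z'\<bar> \<le> 1 / B"
      using \<Omega>'(3)[of z] z by auto
    define w where "w = (z - z') - (\<Sum>i<n. e i (z - z') *\<^sub>R y i)"
    have "\<phi> w = 0" if "\<phi> \<in> \<Phi>" for \<phi> using P0 that by (simp add: w_def)
    moreover have "norm w \<le> 3"
    proof -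
      have "norm (\<Sum>i<n. e i (z - z') *\<^sub>R y i) \<le> (\<Sum>i<n. (1 / B) * norm (y i))"
      proof (rule sum_norm_le)
        fix i assume "i \<in> {..<n}"
        then show "norm (e i (z - z') *\<^sub>R y i) \<le> (1 / B) * norm (y i)"
          using mult_right_mono[OF z'(2)[of i] norm_ge_zero, of "y i"] e[of i]
          by (simp add: bounded_linear.linear linear_diff)
      qed
      also have "\<dots> = (B - 1) / B" by (simp add: B_def sum_divide_distrib)
      also have "\<dots> \<le> 1" using B by simp
      finally have "norm (\<Sum>i<n. e i (z - z') *\<^sub>R y i) \<le> 1" .
      moreover have "norm z' \<le> 1" using \<Omega>'(2) z'(1) by auto
      ultimately show ?thesis
        using norm_triangle_ineq4[of "z - z'" "\<Sum>i<n. e i (z - z') *\<^sub>R y i"] norm_triangle_ineq4[of z z'] z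
        unfolding w_def by linarith
    qed
    moreover have "g w = g z"
      using g g0 z'(1) by (simp add: w_def linear_diff linear_sum linear_scale)
    ultimately show "\<exists>w. (\<forall>\<phi>\<in>\<Phi>. \<phi> w = 0) \<and> norm w \<le> 3 \<and> g w = g z" by blast
  qed
qed

lemma finite_separating_family:
  fixes E S :: "'b::real_vector set" and \<E> :: "('b \<Rightarrow> real) set"
  assumes "finite G" and "E \<subseteq> S" and "S \<subseteq> span (E \<union> G)" and "subspace E" and S: "subspace S"
    and lin: "\<And>e. e \<in> \<E> \<Longrightarrow> linear e"
    and sep: "\<And>f. f \<in> S \<Longrightarrow> f \<notin> E \<Longrightarrow> \<exists>e\<in>\<E>. (\<forall>x\<in>E. e x = 0) \<and> e f \<noteq> 0"
  obtains \<E>' where "finite \<E>'" "\<E>' \<subseteq> \<E>" "\<And>f. f \<in> S \<Longrightarrow> (\<forall>e\<in>\<E>'. e f = 0) \<Longrightarrow> f \<in> E"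
proof -
  have "\<exists>\<E>'. finite \<E>' \<and> \<E>' \<subseteq> \<E> \<and> (\<forall>f\<in>S. (\<forall>e\<in>\<E>'. e f = 0) \<longrightarrow> f \<in> E)"
    using assms(1-3) S sep
  proof (induction "card G" arbitrary: G S rule: less_induct)
    case (less G S)
    show ?case
    proof (cases "S \<subseteq> E")
      case True
      then show ?thesis by (intro exI[of _ "{}"]) auto
    next
      case False
      then obtain f where f: "f \<in> S" "f \<notin> E" by blast
      obtain e where e: "e \<in> \<E>" "\<And>x. x \<in> E \<Longrightarrow> e x = 0" "e f \<noteq> 0"
        using less.prems(5)[OF f] by blast
      have le: "linear e" using lin e(1) .
      have "\<exists>g\<in>G. e g \<noteq> 0"
      proof (rule ccontr)
        assume "\<not> (\<exists>g\<in>G. e g \<noteq> 0)"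
        then have "E \<union> G \<subseteq> {x. e x = 0}" using e(2) by auto
        then have "span (E \<union> G) \<subseteq> {x. e x = 0}"
          by (rule span_minimal) (auto simp: subspace_def linear_0[OF le] linear_add[OF le] linear_scale[OF le])
        then show False using f(1) e(3) less.prems(3) by blast
      qed
      then obtain g where g: "g \<in> G" "e g \<noteq> 0" by blast
      define T where "T z = z - (e z / e g) *\<^sub>R g" for z
      define G' where "G' = T ` (G - {g})"
      have Tlin: "linear T"
        unfolding T_def using linear_add[OF le] linear_scale[OF le]
        by (intro linearI) (simp_all add: algebra_simps add_divide_distrib)
      have "card G' < card G"
        unfolding G'_def using g(1) \<open>finite G\<close>
        by (metis card_Diff1_less card_image_le finite_Diff order_le_less_trans)
      moreover have "finite G'" unfolding G'_def using \<open>finite G\<close> by simp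
      moreover have ES: "E \<subseteq> S \<inter> {x. e x = 0}" using e(2) less.prems(2) by auto
      moreover have "S \<inter> {x. e x = 0} \<subseteq> span (E \<union> G')"
      proof
        fix s assume s: "s \<in> S \<inter> {x. e x = 0}"
        have "T z \<in> span (E \<union> G')" if "z \<in> span (E \<union> G)" for z
        proof -
          have "T z \<in> span (T ` (E \<union> G))"
            using linear_span_image[OF Tlin, of "E \<union> G"] that by blast
          moreover have "T ` (E \<union> G) \<subseteq> insert 0 (E \<union> G')"
            using e(2) g(2) by (auto simp: G'_def T_def)
          ultimately show ?thesis
            by (metis (no_types, lifting) span_insert_0 span_mono subsetD)
        qed
        from this[of s] show "s \<in> span (E \<union> G')" using s less.prems(3) by (auto simp: T_def)
      qed
      moreover have "subspace (S \<inter> {x. e x = 0})"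
        by (intro subspace_inter less.prems(4))
          (auto simp: subspace_def linear_0[OF le] linear_add[OF le] linear_scale[OF le])
      moreover have "\<exists>e\<in>\<E>. (\<forall>x\<in>E. e x = 0) \<and> e f \<noteq> 0" if "f \<in> S \<inter> {x. e x = 0}" "f \<notin> E" for f
        using less.prems(5) that by auto
      ultimately obtain \<E>' where "finite \<E>'" "\<E>' \<subseteq> \<E>"
        "\<forall>f\<in>S \<inter> {x. e x = 0}. (\<forall>e\<in>\<E>'. e f = 0) \<longrightarrow> f \<in> E"
        using less.hyps[of G' "S \<inter> {x. e x = 0}"] by blast
      then show ?thesis using e(1) by (intro exI[of _ "insert e \<E>'"]) auto
    qed
  qed
  then show ?thesis using that by blast
qed

section \<open>Games and renorming\<close>

text \<open>\<open>n\<close> is the number of moves left, and only the final position is tested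
  against \<open>c\<close>. The filter is that of the whole type even when the answers are
  restricted to \<open>S\<close>, so games on \<open>Y\<close> and on the whole space use the same
  kernels. The infimum of the admissible \<open>c\<close> is the value function at
  \<open>x\<close>.\<close>

fun game :: "('a::real_normed_vector \<Rightarrow> real) \<Rightarrow> 'a set \<Rightarrow> real \<Rightarrow> nat \<Rightarrow> 'a \<Rightarrow> real \<Rightarrow> bool" where
  "game \<nu> S r 0 x c \<longleftrightarrow> \<nu> x \<le> c"
| "game \<nu> S r (Suc n) x c \<longleftrightarrow>
    (\<forall>\<^sub>F y in finite_codim_filter. y \<in> S \<and> \<nu> y \<le> r \<longrightarrow> game \<nu> S r n (x + y) c)"

lemma game_mono: "game \<nu> S r n x c \<Longrightarrow> c \<le> c' \<Longrightarrow> game \<nu> S r n x c'"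
  by (induction n arbitrary: x) (auto elim: eventually_mono)

text \<open>Covers rescaling, the change to an equivalent seminorm and, with s = -1, reflection.
  Kernels are invariant under scalars, so the subspaces stay the same.\<close>

lemma game_transfer:
  assumes "game \<nu> S r n (s *\<^sub>R x) c" and S: "subspace S" and "s \<noteq> 0" and "x \<in> S"
    and r: "\<And>y. y \<in> S \<Longrightarrow> \<nu>' y \<le> r' \<Longrightarrow> \<nu> (s *\<^sub>R y) \<le> r"
    and c: "\<And>y. y \<in> S \<Longrightarrow> \<nu> (s *\<^sub>R y) \<le> c \<Longrightarrow> \<nu>' y \<le> c'"
  shows "game \<nu>' S r' n x c'"
  using assms(1,4)
proof (induction n arbitrary: x)
  case 0
  then show ?case using c by simp
next
  case (Suc n)
  have "\<forall>\<^sub>F y in finite_codim_filter. s *\<^sub>R y \<in> S \<and> \<nu> (s *\<^sub>R y) \<le> r \<longrightarrow>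
      game \<nu> S r n (s *\<^sub>R x + s *\<^sub>R y) c"
    using eventually_finite_codim_scale[OF Suc.prems(1)[unfolded game.simps], of s] .
  then show ?case
    unfolding game.simps
  proof eventually_elim
    case (elim y)
    show ?case
    proof
      assume y: "y \<in> S \<and> \<nu>' y \<le> r'"
      then have "game \<nu> S r n (s *\<^sub>R (x + y)) c"
        using elim r S by (simp add: subspace_scale scaleR_add_right)
      then show "game \<nu>' S r' n (x + y) c'"
        using Suc.IH y Suc.prems(2) S by (simp add: subspace_add)
    qed
  qed
qed

text \<open>The answer 0 lies in every subspace and wastes a move.\<close>

lemma game_Suc_imp:
  assumes "seminorm \<nu>" "subspace S" "r \<ge> 0" "game \<nu> S r (Suc n) x c"
  shows "game \<nu> S r n x c"
  using eventually_finite_codim_0[OF assms(4)[unfolded game.simps]] assms(1-3)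
  by (simp add: seminorm_zero subspace_0)

lemma game_le:
  assumes "seminorm \<nu>" "subspace S" "r \<ge> 0" "game \<nu> S r n x c" "m \<le> n"
  shows "game \<nu> S r m x c"
  using assms(5,4) by (induction rule: inc_induct) (use game_Suc_imp[OF assms(1-3)] in auto)

text \<open>Both games are played with the same answers y; as s + t = 1, y enters the combined
  position with weight 1. Hence value functions are convex.\<close>

lemma game_convex:
  assumes "seminorm \<nu>" "game \<nu> S r n x c" "game \<nu> S r n x' c'" "s \<ge> 0" "t \<ge> 0" "s + t = 1"
  shows "game \<nu> S r n (s *\<^sub>R x + t *\<^sub>R x') (s * c + t * c')"
  using assms(2,3)
proof (induction n arbitrary: x x')
  case 0
  have "\<nu> (s *\<^sub>R x + t *\<^sub>R x') \<le> s * \<nu> x + t * \<nu> x'"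
    using seminorm_add[OF assms(1), of "s *\<^sub>R x" "t *\<^sub>R x'"] assms(4,5)
    by (simp add: seminorm_scale[OF assms(1)])
  also have "\<dots> \<le> s * c + t * c'" using 0 assms(4,5) by (intro add_mono mult_left_mono) auto
  finally show ?case by simp
next
  case (Suc n)
  show ?case
    unfolding game.simps
    using Suc.prems[unfolded game.simps]
  proof eventually_elim
    case (elim y)
    show ?case
    proof
      assume "y \<in> S \<and> \<nu> y \<le> r"
      then have "game \<nu> S r n (s *\<^sub>R (x + y) + t *\<^sub>R (x' + y)) (s * c + t * c')"
        using elim Suc.IH by blast
      moreover have "s *\<^sub>R (x + y) + t *\<^sub>R (x' + y) = s *\<^sub>R x + t *\<^sub>R x' + (s + t) *\<^sub>R y"
        by (simp add: algebra_simps)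
      ultimately show "game \<nu> S r n (s *\<^sub>R x + t *\<^sub>R x' + y) (s * c + t * c')"
        using assms(6) by simp
    qed
  qed
qed

lemma game_translate:
  assumes "seminorm \<nu>" "game \<nu> S r n x c"
  shows "game \<nu> S r n (x + z) (c + \<nu> z)"
  using assms(2)
proof (induction n arbitrary: x)
  case 0
  then show ?case using seminorm_add[OF assms(1), of x z] by simp
next
  case (Suc n)
  show ?case
    unfolding game.simps using Suc.prems[unfolded game.simps]
  proof eventually_elim
    case (elim y)
    then show ?case using Suc.IH[of "x + y"] by (simp add: algebra_simps)
  qed
qed

text \<open>For R > 0, dividing by \<nu> x and setting t = 1/\<nu> x turns this into the bound
  \<epsilon> t on the smoothness modulus in the direction of \<open>x\<close>, for all t up to 1/R.
  The unnormalised form adds up along the moves of a game.\<close>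

definition flat :: "('a::real_normed_vector \<Rightarrow> real) \<Rightarrow> 'a set \<Rightarrow> real \<Rightarrow> real \<Rightarrow> bool" where
  "flat \<nu> S R \<epsilon> \<longleftrightarrow> (\<forall>x\<in>S. R \<le> \<nu> x \<longrightarrow>
    (\<forall>\<^sub>F y in finite_codim_filter. y \<in> S \<and> \<nu> y \<le> 1 \<longrightarrow> \<nu> (x + y) \<le> \<nu> x + \<epsilon>))"

lemma flat_mono: "flat \<nu> S R \<epsilon> \<Longrightarrow> R \<le> R' \<Longrightarrow> flat \<nu> S R' \<epsilon>"
  by (auto simp: flat_def)

text \<open>The quantity max (\<nu> x) (R + 1) increases by at most \<epsilon> per move: above
  \<open>R\<close> by flatness, below \<open>R\<close> because a move of length 1 cannot pass R + 1.
  With \<open>R\<close> alone in the maximum, the move that crosses the threshold would not be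
  covered.\<close>

lemma game_of_flat:
  assumes \<nu>: "seminorm \<nu>" and S: "subspace S" and "\<epsilon> \<ge> 0" and flat: "flat \<nu> S R \<epsilon>"
    and "x \<in> S" and "max (\<nu> x) (R + 1) + n * \<epsilon> \<le> c"
  shows "game \<nu> S 1 n x c"
  using assms(5,6)
proof (induction n arbitrary: x)
  case 0
  then show ?case by simp
next
  case (Suc n)
  have "\<forall>\<^sub>F y in finite_codim_filter. y \<in> S \<and> \<nu> y \<le> 1 \<longrightarrow> max (\<nu> (x + y)) (R + 1) \<le> max (\<nu> x) (R + 1) + \<epsilon>"
  proof (cases "R \<le> \<nu> x")
    case True
    show ?thesis
      using flat[unfolded flat_def, rule_format, OF Suc.prems(1) True]
      by eventually_elim (use \<open>\<epsilon> \<ge> 0\<close> in auto)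
  next
    case False
    have "max (\<nu> (x + y)) (R + 1) \<le> max (\<nu> x) (R + 1) + \<epsilon>" if "\<nu> y \<le> 1" for y
      using seminorm_add[OF \<nu>, of x y] False that \<open>\<epsilon> \<ge> 0\<close> by auto
    then show ?thesis by (intro always_eventually) blast
  qed
  then show ?case
    unfolding game.simps
  proof eventually_elim
    case (elim y)
    show ?case
    proof
      assume y: "y \<in> S \<and> \<nu> y \<le> 1"
      show "game \<nu> S 1 n (x + y) c"
      proof (rule Suc.IH)
        show "x + y \<in> S" using y Suc.prems(1) S by (simp add: subspace_add)
        show "max (\<nu> (x + y)) (R + 1) + real n * \<epsilon> \<le> c"
        proof -
          have "max (\<nu> (x + y)) (R + 1) \<le> max (\<nu> x) (R + 1) + \<epsilon>" using elim y by blast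
          moreover have "real (Suc n) * \<epsilon> = real n * \<epsilon> + \<epsilon>" by (simp add: algebra_simps)
          ultimately show ?thesis using Suc.prems(2) by linarith
        qed
      qed
    qed
  qed
qed

text \<open>The position is y + z, with y the position in the game on \<open>Y\<close> and z the
  accumulated error. At the start of a block the subspace \<Phi> demanded on \<open>Y\<close> is
  converted by \<open>decomp\<close> into conditions \<Phi>' on the moves of the block. At its end
  the block sum is replaced by a vector of \<open>Y\<close>, of norm at most m + E as the block has
  m unit moves; the difference goes into z and costs \<open>E\<close> once per block.\<close>

lemma game_three_space:
  fixes Y :: "'a::real_normed_vector set"
  assumes \<mu>: "\<And>v. norm v \<le> 1 \<Longrightarrow> \<mu> v \<le> b"
    and decomp: "\<And>\<Phi>. finite \<Phi> \<Longrightarrow> \<forall>\<phi>\<in>\<Phi>. bounded_linear (\<phi> :: 'a \<Rightarrow> real) \<Longrightarrow>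
      \<forall>\<^sub>F u in finite_codim_filter. \<mu> u \<le> B \<longrightarrow> (\<exists>y\<in>Y. (\<forall>\<phi>\<in>\<Phi>. \<phi> y = 0) \<and> norm (u - y) \<le> E)"
    and gQ: "game \<mu> UNIV b m 0 B"
    and gY: "game norm Y (m + E) n y C"
  shows "game norm UNIV 1 (n * m) (y + z) (C + norm z + n * E)"
  using gY
proof (induction n arbitrary: y z)
  case 0
  then show ?case using norm_triangle_ineq[of y z] by simp
next
  case (Suc n)
  obtain \<Phi> where \<Phi>: "finite \<Phi>" "\<forall>\<phi>\<in>\<Phi>. bounded_linear \<phi>"
    and \<Phi>Y: "\<forall>y'. (\<forall>\<phi>\<in>\<Phi>. \<phi> y' = (0::real)) \<longrightarrow> y' \<in> Y \<and> norm y' \<le> m + E \<longrightarrow> game norm Y (m + E) n (y + y') C"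
    using Suc.prems[unfolded game.simps eventually_finite_codim] by (elim exE conjE)
  obtain \<Phi>' where \<Phi>': "finite \<Phi>'" "\<forall>\<phi>\<in>\<Phi>'. bounded_linear \<phi>"
    and \<Phi>'Y: "\<forall>u. (\<forall>\<phi>\<in>\<Phi>'. \<phi> u = (0::real)) \<longrightarrow> \<mu> u \<le> B \<longrightarrow>
      (\<exists>y\<in>Y. (\<forall>\<phi>\<in>\<Phi>. \<phi> y = 0) \<and> norm (u - y) \<le> E)"
    using decomp[OF \<Phi>, unfolded eventually_finite_codim] by (elim exE conjE)
  \<comment> \<open>Play inside a block: u is the sum so far, k the number of moves left in the
    block, and the bound on \<open>norm u + k\<close> prepares the size of the answer on
    \<open>Y\<close>. All moves lie in the kernel of \<Phi>', hence so does their sum.\<close>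
  have "game norm UNIV 1 (k + n * m) (y + z + u) (C + norm z + Suc n * E)"
    if "\<forall>\<phi>\<in>\<Phi>'. \<phi> u = 0" "norm u + k \<le> m" "game \<mu> UNIV b k u B" for k u
    using that
  proof (induction k arbitrary: u)
    case 0
    obtain y' where y': "y' \<in> Y" "\<forall>\<phi>\<in>\<Phi>. \<phi> y' = 0" "norm (u - y') \<le> E"
      using \<Phi>'Y 0(1,3) by auto
    have "norm y' \<le> norm u + norm (u - y')" using norm_triangle_sub[of y' u] by (simp add: norm_minus_commute)
    then have "game norm Y (m + E) n (y + y') C" using \<Phi>Y y' 0(2) by simp
    then have "game norm UNIV 1 (n * m) (y + y' + (z + (u - y'))) (C + norm (z + (u - y')) + n * E)"
      by (rule Suc.IH)
    moreover have "norm (z + (u - y')) \<le> norm z + E" using norm_triangle_ineq[of z "u - y'"] y'(3) by simp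
    ultimately show ?case by (auto elim!: game_mono simp: algebra_simps)
  next
    case (Suc k)
    have "\<forall>\<^sub>F v in finite_codim_filter. \<forall>\<phi>\<in>\<Phi>'. \<phi> v = 0"
      using \<Phi>'(1,2) unfolding eventually_finite_codim by blast
    with Suc.prems(3)[unfolded game.simps]
    show ?case
      unfolding game.simps add_Suc
    proof eventually_elim
      case (elim v)
      show ?case
      proof
        assume v: "v \<in> UNIV \<and> norm v \<le> 1"
        have "game norm UNIV 1 (k + n * m) (y + z + (u + v)) (C + norm z + Suc n * E)"
        proof (rule Suc.IH)
          show "\<forall>\<phi>\<in>\<Phi>'. \<phi> (u + v) = 0"
          proof
            fix \<phi> assume \<phi>: "\<phi> \<in> \<Phi>'"
            then have "linear \<phi>" using \<Phi>'(2) bounded_linear.linear by blast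
            then show "\<phi> (u + v) = 0"
              using bspec[OF elim(2) \<phi>] bspec[OF Suc.prems(1) \<phi>] by (simp add: linear_add)
          qed
          show "norm (u + v) + real k \<le> m" using norm_triangle_ineq[of u v] v Suc.prems(2) by simp
          show "game \<mu> UNIV b k (u + v) B" using elim(1) v \<mu> by blast
        qed
        then show "game norm UNIV 1 (k + n * m) (y + z + u + v) (C + norm z + Suc n * E)"
          by (simp add: add.assoc)
      qed
    qed
  qed
  from this[of 0 m] show ?case using gQ \<Phi>'(2) by (auto simp: linear_0 bounded_linear.linear)
qed

text \<open>
  Averaging the value functions of the first \<open>N\<close> stages makes one more move cost only the
  \<open>N\<close>-th part of the telescoped total increase.
\<close>

definition average_ball :: "real \<Rightarrow> nat \<Rightarrow> 'a::real_normed_vector set" where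
  "average_ball \<tau> N = {x. \<exists>c. (\<forall>j<N. game norm UNIV \<tau> j x (c j)) \<and> (\<Sum>j<N. c j) \<le> N}"

context
  fixes \<tau> \<theta> :: real and N :: nat
  assumes N: "N > 0" and \<tau>: "\<tau> > 0" and \<theta>: "\<tau> * \<theta> = 1 / 2"
    and g: "game norm (UNIV :: 'a::real_normed_vector set) 1 N 0 \<theta>"
begin

lemma scaled_game: "game norm (UNIV :: 'a set) \<tau> N 0 (1 / 2)"
  by (rule game_transfer[where s = "1 / \<tau>" and \<nu> = norm and r = 1 and c = \<theta>])
    (use g \<tau> \<theta> in \<open>auto simp: field_simps\<close>)

text \<open>With \<tau> \<theta> = 1/2 the value of every stage lies between norm x and norm x +
  1/2. So the average ball lies between the balls of radii 1/2 and 1, uniformly in \<tau> and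
  \<open>N\<close>.\<close>

lemma scaled_game_le: "j \<le> N \<Longrightarrow> game norm (UNIV :: 'a set) \<tau> j x (norm x + 1 / 2)"
  using game_translate[OF seminorm_norm game_le[OF seminorm_norm subspace_UNIV _ scaled_game], of j x] \<tau>
  by (simp add: add.commute)

lemma cball_subset_average_ball: "cball 0 (1 / 2) \<subseteq> (average_ball \<tau> N :: 'a set)"
proof
  fix x :: 'a assume "x \<in> cball 0 (1 / 2)"
  then have "game norm UNIV \<tau> j x 1" if "j < N" for j
    using scaled_game_le[of j x] that by (auto elim!: game_mono)
  then show "x \<in> average_ball \<tau> N" unfolding average_ball_def by (intro CollectI exI[of _ "\<lambda>_. 1"]) simp
qed

lemma average_ball_subset_cball: "(average_ball \<tau> N :: 'a set) \<subseteq> cball 0 1"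
proof
  fix x :: 'a assume "x \<in> average_ball \<tau> N"
  then obtain c where c: "\<And>j. j < N \<Longrightarrow> game norm UNIV \<tau> j x (c j)" "(\<Sum>j<N. c j) \<le> N"
    unfolding average_ball_def by blast
  have "norm x \<le> c j" if "j < N" for j
    using game_le[OF seminorm_norm subspace_UNIV _ c(1)[OF that], of 0] \<tau> by simp
  then have "(\<Sum>j<N. norm x) \<le> (\<Sum>j<N. c j)" by (intro sum_mono) simp
  then have "real N * norm x \<le> real N * 1" using c(2) by simp
  then show "x \<in> cball 0 1" using N by (simp del: mult_1_right)
qed

lemma uminus_average_ball: "x \<in> average_ball \<tau> N \<Longrightarrow> - x \<in> (average_ball \<tau> N :: 'a set)"
proof -
  have "game norm UNIV \<tau> j (- x) c" if "game norm UNIV \<tau> j x c" for j c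
    by (rule game_transfer[where s = "- 1" and \<nu> = norm]) (use that in auto)
  then show "x \<in> average_ball \<tau> N \<Longrightarrow> - x \<in> average_ball \<tau> N" unfolding average_ball_def by blast
qed

lemma convex_average_ball: "convex (average_ball \<tau> N :: 'a set)"
proof (rule convexI)
  fix x y :: 'a and s t :: real
  assume x: "x \<in> average_ball \<tau> N" and y: "y \<in> average_ball \<tau> N" and st: "0 \<le> s" "0 \<le> t" "s + t = 1"
  obtain c where c: "\<And>j. j < N \<Longrightarrow> game norm UNIV \<tau> j x (c j)" "(\<Sum>j<N. c j) \<le> N"
    using x unfolding average_ball_def by blast
  obtain c' where c': "\<And>j. j < N \<Longrightarrow> game norm UNIV \<tau> j y (c' j)" "(\<Sum>j<N. c' j) \<le> N"
    using y unfolding average_ball_def by blast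
  have "(\<Sum>j<N. s * c j + t * c' j) = s * (\<Sum>j<N. c j) + t * (\<Sum>j<N. c' j)"
    by (simp add: sum.distrib sum_distrib_left)
  also have "\<dots> \<le> s * N + t * N" using c(2) c'(2) st by (intro add_mono mult_left_mono) auto
  also have "\<dots> = N" using st by (simp flip: distrib_right)
  finally show "s *\<^sub>R x + t *\<^sub>R y \<in> average_ball \<tau> N"
    unfolding average_ball_def using game_convex[OF seminorm_norm c(1) c'(1) st]
    by (intro CollectI exI[of _ "\<lambda>j. s * c j + t * c' j"]) simp
qed

text \<open>After the answer y, j moves from x + y cost no more than j + 1 moves from x. The sum of
  the values is thus shifted by one index: the term at 0, at least norm x, leaves, and the one at
  \<open>N\<close>, at most norm x + 1/2, enters. The sum grows by at most 1/2, and rescaling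
  restores it.\<close>

lemma average_ball_add:
  assumes x: "x \<in> (average_ball \<tau> N :: 'a set)"
  shows "\<forall>\<^sub>F y in finite_codim_filter. norm y \<le> \<tau> \<longrightarrow> (1 / (1 + 1 / N)) *\<^sub>R (x + y) \<in> average_ball \<tau> N"
proof -
  obtain c where c: "\<And>j. j < N \<Longrightarrow> game norm UNIV \<tau> j x (c j)" "(\<Sum>j<N. c j) \<le> N"
    using x unfolding average_ball_def by blast
  define c' where "c' = c(N := norm x + 1 / 2)"
  have c': "game norm UNIV \<tau> j x (c' j)" if "j \<le> N" for j
    using that c(1)[of j] scaled_game_le[of N x] by (auto simp: c'_def)
  have "\<forall>\<^sub>F y in finite_codim_filter. \<forall>j\<in>{..<N}. norm y \<le> \<tau> \<longrightarrow> game norm UNIV \<tau> j (x + y) (c' (Suc j))"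
    using c'[of "Suc _"] by (intro eventually_ball_finite) auto
  then show ?thesis
  proof eventually_elim
    case (elim y)
    show ?case
    proof
      assume y: "norm y \<le> \<tau>"
      \<comment> \<open>The origin has values at most 1/2, so mixing it in with weight 1 - s brings
        the sum from N + 1/2 down to N: s solves s (N + 1/2) + (1 - s) N / 2 = N.\<close>
      define s where "s = 1 / (1 + 1 / real N)"
      have "1 + 1 / real N > 0" using N by (simp add: add_pos_nonneg)
      then have s: "0 \<le> s" "s \<le> 1" "s * (1 + 1 / real N) = 1" by (auto simp: s_def)
      have "(\<Sum>j<N. c' (Suc j)) = (\<Sum>j<N. c j) - c 0 + norm x + 1 / 2"
        using N sum.lessThan_Suc_shift[of c' N] by (simp add: c'_def)
      moreover have "norm x \<le> c 0" using c(1)[OF N] by simp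
      ultimately have sum: "(\<Sum>j<N. c' (Suc j)) \<le> N + 1 / 2" using c(2) by linarith
      have "game norm UNIV \<tau> j (s *\<^sub>R (x + y) + (1 - s) *\<^sub>R 0) (s * c' (Suc j) + (1 - s) * (1 / 2))"
        if "j < N" for j
        using elim y that scaled_game_le[of j 0] s by (intro game_convex[OF seminorm_norm]) auto
      then have "game norm UNIV \<tau> j (s *\<^sub>R (x + y)) (s * c' (Suc j) + (1 - s) * (1 / 2))" if "j < N" for j
        using that by simp
      moreover have "(\<Sum>j<N. s * c' (Suc j) + (1 - s) * (1 / 2)) \<le> N"
      proof -
        have "(\<Sum>j<N. s * c' (Suc j) + (1 - s) * (1 / 2)) = s * (\<Sum>j<N. c' (Suc j)) + N * ((1 - s) / 2)"
          by (simp add: sum.distrib sum_distrib_left)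
        also have "\<dots> \<le> s * (N + 1 / 2) + N * ((1 - s) / 2)"
          using sum s by (intro add_mono mult_left_mono) auto
        also have "\<dots> = N * (s * (1 + 1 / N) + 1) / 2" using N by (simp add: field_simps)
        also have "\<dots> = N" using s(3) by simp
        finally show ?thesis .
      qed
      ultimately show "(1 / (1 + 1 / N)) *\<^sub>R (x + y) \<in> average_ball \<tau> N"
        unfolding average_ball_def s_def[symmetric]
        by (intro CollectI exI[of _ "\<lambda>j. s * c' (Suc j) + (1 - s) * (1 / 2)"]) simp
    qed
  qed
qed

end

section \<open>Minkowski functionals of symmetric convex sets between two balls\<close>

definition gauge_of :: "'b::real_vector set \<Rightarrow> 'b \<Rightarrow> real" where
  "gauge_of U x = Inf {l. l > 0 \<and> (1 / l) *\<^sub>R x \<in> U}"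

context
  fixes U :: "'a::real_normed_vector set" and \<rho> M :: real
  assumes U: "convex U" and sym: "\<forall>x\<in>U. - x \<in> U"
    and \<rho>: "\<rho> > 0" and in_U: "cball 0 \<rho> \<subseteq> U" and M: "M > 0" and U_in: "U \<subseteq> cball 0 M"
begin

lemma gauge_of_le: "l > 0 \<Longrightarrow> (1 / l) *\<^sub>R x \<in> U \<Longrightarrow> gauge_of U x \<le> l"
  unfolding gauge_of_def by (rule cInf_lower) (auto intro!: bdd_belowI[where m = 0])

lemma gauge_of_nonempty: "{l. l > 0 \<and> (1 / l) *\<^sub>R x \<in> U} \<noteq> {}"
proof -
  have "norm ((1 / (norm x / \<rho> + 1)) *\<^sub>R x) \<le> \<rho>"
    using \<rho> by (simp add: field_simps add_pos_nonneg)
  then have "(1 / (norm x / \<rho> + 1)) *\<^sub>R x \<in> U" using in_U by auto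
  moreover have "norm x / \<rho> + 1 > 0" using \<rho> by (simp add: add_nonneg_pos)
  ultimately show ?thesis by blast
qed

lemma gauge_of_less:
  assumes "gauge_of U x < l"
  shows "l > 0 \<and> (1 / l) *\<^sub>R x \<in> U"
proof -
  obtain k where k: "k > 0" "(1 / k) *\<^sub>R x \<in> U" "k < l"
    using cInf_lessD[OF gauge_of_nonempty, of x l] assms unfolding gauge_of_def by auto
  have "(k / l) *\<^sub>R ((1 / k) *\<^sub>R x) + (1 - k / l) *\<^sub>R 0 \<in> U"
    using k in_U \<rho> by (intro convexD[OF U]) (auto simp: field_simps)
  then show ?thesis using k by auto
qed

lemma gauge_of_upper: "gauge_of U x \<le> norm x / \<rho>"
proof (cases "x = 0")
  case True
  have "0 \<in> cball (0::'a) \<rho>" using \<rho> by simp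
  then have "0 \<in> U" using in_U by blast
  then have "gauge_of U 0 \<le> 0 + e" if "e > 0" for e
    using gauge_of_le[OF that, of 0] by simp
  then have "gauge_of U 0 \<le> 0" by (rule field_le_epsilon)
  then show ?thesis using True by simp
next
  case False
  have "norm ((1 / (norm x / \<rho>)) *\<^sub>R x) \<le> \<rho>" using \<rho> False by simp
  then have "(1 / (norm x / \<rho>)) *\<^sub>R x \<in> U" using in_U by (meson mem_cball_0 subsetD)
  then show ?thesis using False \<rho> by (intro gauge_of_le) auto
qed

lemma gauge_of_lower: "norm x / M \<le> gauge_of U x"
  unfolding gauge_of_def
proof (rule cInf_greatest[OF gauge_of_nonempty])
  fix l assume "l \<in> {l. l > 0 \<and> (1 / l) *\<^sub>R x \<in> U}"
  then have l: "l > 0" "norm ((1 / l) *\<^sub>R x) \<le> M" using U_in by auto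
  then show "norm x / M \<le> l" using M by (simp add: field_simps)
qed

lemma seminorm_gauge_of: "seminorm (gauge_of U)"
proof (rule seminormI)
  fix x y
  have "gauge_of U (x + y) \<le> l + k" if "gauge_of U x < l" "gauge_of U y < k" for l k
  proof -
    note l = gauge_of_less[OF that(1)] and k = gauge_of_less[OF that(2)]
    have "(l / (l + k)) *\<^sub>R ((1 / l) *\<^sub>R x) + (k / (l + k)) *\<^sub>R ((1 / k) *\<^sub>R y) \<in> U"
      using l k by (intro convexD[OF U]) (auto simp flip: add_divide_distrib)
    then have "(1 / (l + k)) *\<^sub>R (x + y) \<in> U" using l k by (simp add: scaleR_add_right)
    then show ?thesis using l k by (intro gauge_of_le) auto
  qed
  from this[of "gauge_of U x + e / 2" "gauge_of U y + e / 2" for e]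
  have "gauge_of U (x + y) \<le> gauge_of U x + gauge_of U y + e" if "e > 0" for e
    using that by (simp add: algebra_simps)
  then show "gauge_of U (x + y) \<le> gauge_of U x + gauge_of U y" by (rule field_le_epsilon)
next
  show "gauge_of U (c *\<^sub>R x) \<le> \<bar>c\<bar> * gauge_of U x" if "c \<noteq> 0" for c x
  proof -
    have "gauge_of U (c *\<^sub>R x) / \<bar>c\<bar> \<le> l" if "gauge_of U x < l" for l
    proof -
      have l: "l > 0" "(1 / l) *\<^sub>R x \<in> U" using gauge_of_less[OF that] by auto
      have "(1 / (\<bar>c\<bar> * l)) *\<^sub>R (c *\<^sub>R x) \<in> U"
        using l bspec[OF sym l(2)] \<open>c \<noteq> 0\<close> by (cases "c > 0") auto
      then have "gauge_of U (c *\<^sub>R x) \<le> \<bar>c\<bar> * l" using l \<open>c \<noteq> 0\<close> by (intro gauge_of_le) auto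
      then show ?thesis using \<open>c \<noteq> 0\<close> by (simp add: field_simps)
    qed
    then have "gauge_of U (c *\<^sub>R x) / \<bar>c\<bar> \<le> gauge_of U x" by (rule dense_ge)
    then show ?thesis using that by (simp add: field_simps)
  qed
  show "gauge_of U 0 \<le> 0" using gauge_of_upper[of 0] by simp
qed

end

section \<open>Weighted sums of unit balls\<close>

definition combination_ball :: "(nat \<Rightarrow> real) \<Rightarrow> (nat \<Rightarrow> 'b::real_vector set) \<Rightarrow> 'b set" where
  "combination_ball a D = {\<Sum>k<m. a k *\<^sub>R x k | x m. \<forall>k. x k \<in> D k}"

context
  fixes a :: "nat \<Rightarrow> real" and D :: "nat \<Rightarrow> 'a::real_normed_vector set"
  assumes a_pos: "\<And>k. a k > 0" and a_sum: "summable a"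
    and D_convex: "\<And>k. convex (D k)" and D_sym: "\<And>k. \<forall>x\<in>D k. - x \<in> D k"
    and in_D: "\<And>k. cball 0 (1 / 2) \<subseteq> D k" and D_in: "\<And>k. D k \<subseteq> cball 0 1"
begin

lemma zero_in_D: "0 \<in> D k"
  using in_D[of k] by auto

text \<open>Padding with zeros gives two elements the same length and makes a prescribed index
  available as a summand.\<close>

lemma combination_ball_pad:
  assumes "u \<in> combination_ball a D"
  obtains x m where "\<And>k. x k \<in> D k" "m \<ge> m0" "u = (\<Sum>k<m. a k *\<^sub>R x k)" "\<And>k. k \<ge> m \<Longrightarrow> x k = 0"
proof -
  obtain x m where x: "\<And>k. x k \<in> D k" "u = (\<Sum>k<m. a k *\<^sub>R x k)"
    using assms unfolding combination_ball_def by blast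
  define x' where "x' k = (if k < m then x k else 0)" for k
  have "u = (\<Sum>k<max m m0. a k *\<^sub>R x' k)"
    unfolding x(2) by (rule sum.mono_neutral_cong_left) (auto simp: x'_def)
  then show ?thesis using x(1) zero_in_D by (intro that[of x' "max m m0"]) (auto simp: x'_def)
qed

lemma convex_combination_ball: "convex (combination_ball a D)"
proof (rule convexI)
  fix u v and s t :: real
  assume u: "u \<in> combination_ball a D" and v: "v \<in> combination_ball a D" and st: "0 \<le> s" "0 \<le> t" "s + t = 1"
  obtain x m where x: "\<And>k. x k \<in> D k" "u = (\<Sum>k<m. a k *\<^sub>R x k)" "\<And>k. k \<ge> m \<Longrightarrow> x k = 0"
    using combination_ball_pad[OF u, of 0] by metis
  obtain y n where y: "\<And>k. y k \<in> D k" "n \<ge> m" "v = (\<Sum>k<n. a k *\<^sub>R y k)"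
    using combination_ball_pad[OF v, of m] by metis
  have "u = (\<Sum>k<n. a k *\<^sub>R x k)"
    unfolding x(2) using y(2) x(3) by (intro sum.mono_neutral_cong_left) auto
  then have "s *\<^sub>R u + t *\<^sub>R v = (\<Sum>k<n. a k *\<^sub>R (s *\<^sub>R x k + t *\<^sub>R y k))"
    unfolding y(3) by (simp add: scaleR_sum_right scaleR_add_right sum.distrib mult.commute)
  moreover have "s *\<^sub>R x k + t *\<^sub>R y k \<in> D k" for k
    using x(1) y(1) st by (intro convexD[OF D_convex]) auto
  ultimately show "s *\<^sub>R u + t *\<^sub>R v \<in> combination_ball a D"
    unfolding combination_ball_def by (intro CollectI exI[of _ "\<lambda>k. s *\<^sub>R x k + t *\<^sub>R y k"] exI[of _ n]) auto
qed

lemma uminus_combination_ball: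
  assumes "u \<in> combination_ball a D"
  shows "- u \<in> combination_ball a D"
proof -
  obtain x m where "\<And>k. x k \<in> D k" "u = (\<Sum>k<m. a k *\<^sub>R x k)"
    using combination_ball_pad[OF assms, of 0] by metis
  then show ?thesis
    unfolding combination_ball_def using D_sym
    by (intro CollectI exI[of _ "\<lambda>k. - x k"] exI[of _ m]) (auto simp: sum_negf)
qed

lemma cball_subset_combination_ball: "cball 0 (a 0 / 2) \<subseteq> combination_ball a D"
proof
  fix u :: 'a assume "u \<in> cball 0 (a 0 / 2)"
  then have "(1 / a 0) *\<^sub>R u \<in> D 0"
    using in_D[of 0] a_pos[of 0] by (intro subsetD[OF in_D]) (simp add: field_simps)
  then show "u \<in> combination_ball a D"
    unfolding combination_ball_def using zero_in_D a_pos[of 0]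
    by (intro CollectI exI[of _ "\<lambda>k. if k = 0 then (1 / a 0) *\<^sub>R u else 0"] exI[of _ "1"]) auto
qed

lemma combination_ball_subset_cball: "combination_ball a D \<subseteq> cball 0 (suminf a)"
proof
  fix u assume "u \<in> combination_ball a D"
  then obtain x m where x: "\<And>k. x k \<in> D k" "u = (\<Sum>k<m. a k *\<^sub>R x k)"
    using combination_ball_pad[of u 0] by metis
  have "norm u \<le> (\<Sum>k<m. norm (a k *\<^sub>R x k))" unfolding x(2) by (rule norm_sum)
  also have "\<dots> \<le> (\<Sum>k<m. a k)"
  proof (rule sum_mono)
    fix k
    have "norm (x k) \<le> 1" using x(1)[of k] D_in[of k] by auto
    then show "norm (a k *\<^sub>R x k) \<le> a k" using a_pos[of k] by (simp add: mult_left_le)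
  qed
  also have "\<dots> \<le> suminf a" using a_sum a_pos by (intro sum_le_suminf) (auto intro: less_imp_le)
  finally show "u \<in> cball 0 (suminf a)" by simp
qed

text \<open>The \<open>k\<close>-th summand alone absorbs the perturbation \<open>y\<close>.\<close>

lemma combination_ball_add:
  assumes u: "u \<in> combination_ball a D" and s: "0 \<le> s" "s \<le> 1"
    and D_add: "\<And>x. x \<in> D k \<Longrightarrow> \<forall>\<^sub>F y in finite_codim_filter. norm y \<le> \<tau> \<longrightarrow> s *\<^sub>R (x + y) \<in> D k"
  shows "\<forall>\<^sub>F y in finite_codim_filter. norm y \<le> a k * \<tau> \<longrightarrow> s *\<^sub>R (u + y) \<in> combination_ball a D"
proof -
  obtain x m where x: "\<And>k. x k \<in> D k" "m \<ge> Suc k" "u = (\<Sum>k<m. a k *\<^sub>R x k)"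
    using combination_ball_pad[OF u, of "Suc k"] by metis
  show ?thesis
    using eventually_finite_codim_scale[OF D_add[OF x(1)], of "1 / a k"]
  proof eventually_elim
    case (elim y)
    show ?case
    proof
      assume "norm y \<le> a k * \<tau>"
      then have d: "s *\<^sub>R (x k + (1 / a k) *\<^sub>R y) \<in> D k"
        using elim a_pos[of k] by (simp add: field_simps)
      \<comment> \<open>The factor s has to be applied to every summand. The others stay in their
        sets, which are convex and contain 0.\<close>
      define x' where "x' = (\<lambda>j. s *\<^sub>R x j)(k := s *\<^sub>R (x k + (1 / a k) *\<^sub>R y))"
      have x'D: "x' j \<in> D j" for j
        using convexD[OF D_convex x(1) zero_in_D, of s "1 - s" j] s d by (auto simp: x'_def)
      have "(\<Sum>j<m. a j *\<^sub>R x' j) = (\<Sum>j<m. a j *\<^sub>R s *\<^sub>R x j + (if j = k then s *\<^sub>R y else 0))"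
        using a_pos[of k] by (intro sum.cong) (auto simp: x'_def scaleR_add_right)
      also have "\<dots> = s *\<^sub>R (u + y)"
        using x(2,3) by (simp add: sum.distrib scaleR_add_right scaleR_sum_right mult.commute)
      finally show "s *\<^sub>R (u + y) \<in> combination_ball a D"
        unfolding combination_ball_def using x'D by (intro CollectI exI[of _ x'] exI[of _ m]) auto
    qed
  qed
qed

end

text \<open>With \<epsilon> = 1/L, about R L moves raise the level by about R, which is already the
  threshold: it is the largest number of moves, up to a factor, that keeps the bound a multiple of
  R. The constants \<alpha> and \<beta> turn the game for \<nu> into one for the norm and unit moves
  into moves of \<mu>-size \<beta>.\<close>

lemma game_three_space_of_flat:
  fixes Y :: "'a::real_normed_vector set"
  assumes Y: "subspace Y" and L: "L \<ge> 1" and R: "R \<ge> 1" and R': "R' \<ge> 1"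
    and \<nu>: "seminorm \<nu>" and \<nu>_le: "\<And>y. y \<in> Y \<Longrightarrow> \<nu> y \<le> \<beta> * norm y" and \<nu>_ge: "\<And>y. y \<in> Y \<Longrightarrow> \<alpha> * norm y \<le> \<nu> y"
    and \<mu>: "seminorm \<mu>" and \<mu>_le: "\<And>u. \<mu> u \<le> \<beta> * norm u" and \<mu>_ge: "\<And>u. \<alpha> * infdist u Y \<le> \<mu> u"
    and \<alpha>: "\<alpha> > 0" and \<beta>: "\<beta> > 0"
    and flatY: "flat \<nu> Y R (1 / L)" and flatQ: "flat \<mu> UNIV R' (1 / L)"
  defines "C \<equiv> 8 * \<beta> / \<alpha> * (1 + 16 * \<beta> / \<alpha>) + 32 * \<beta> / \<alpha>"
  obtains N :: nat where "real N \<ge> R * R' * L\<^sup>2" "game norm (UNIV :: 'a set) 1 N 0 (C * R * R' * L)"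
proof -
  define n where "n = nat \<lceil>R * L\<rceil>"
  define m where "m = nat \<lceil>R' * L\<rceil>"
  have RL: "R * L \<ge> 1" "R' * L \<ge> 1" using R R' L mult_mono[of 1 _ 1 L] by fastforce+
  have n: "R * L \<le> n" "n \<le> R * L + 1" and m: "R' * L \<le> m" "m \<le> R' * L + 1"
    unfolding n_def m_def using RL by linarith+
  \<comment> \<open>The starting level r + 1, and at most r + 1/L for up to r L + 1 moves, add up to
    at most 2 r + 2, hence to at most 4 r.\<close>
  have aux: "max 0 (r + 1) + k * (1 / L) \<le> 4 * r" if "k \<le> r * L + 1" "r \<ge> 1" for k r
  proof -
    have "k * (1 / L) \<le> (r * L + 1) / L" using that L by (simp add: divide_right_mono)
    also have "\<dots> = r + 1 / L" using L by (simp add: field_simps)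
    also have "\<dots> \<le> r + 1" using L by simp
    finally show ?thesis using that by simp
  qed
  have gY: "game \<nu> Y 1 n 0 (4 * R)"
    by (rule game_of_flat[OF \<nu> Y _ flatY]) (use L aux[OF n(2) R] seminorm_zero[OF \<nu>] subspace_0[OF Y] in auto)
  have gQ: "game \<mu> UNIV 1 m 0 (4 * R')"
    by (rule game_of_flat[OF \<mu> subspace_UNIV _ flatQ]) (use L aux[OF m(2) R'] seminorm_zero[OF \<mu>] in auto)
  have gQ': "game \<mu> UNIV \<beta> m 0 (\<beta> * (4 * R'))"
    by (rule game_transfer[where s = "1 / \<beta>" and \<nu> = \<mu> and r = 1 and c = "4 * R'"])
      (use gQ \<beta> in \<open>auto simp: seminorm_scale[OF \<mu>] field_simps\<close>)
  \<comment> \<open>A block sum has distance at most 4 \<beta> R' / \<alpha> from \<open>Y\<close>,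
    and passing to the kernel costs a factor 3. The value 16 instead of 12 supplies the strict
    inequality for the distance.\<close>
  define E where "E = 16 * \<beta> * R' / \<alpha>"
  have E: "E > 0" unfolding E_def using \<alpha> \<beta> R' by simp
  have mE: "m + E > 0" using E by (simp add: add_nonneg_pos)
  define A where "A = 4 * R * \<beta> * (m + E) / \<alpha>"
  have gY': "game norm Y (m + E) n 0 A"
  proof (rule game_transfer[where s = "1 / (\<beta> * (m + E))" and \<nu> = \<nu> and r = 1 and c = "4 * R"])
    fix y assume y: "y \<in> Y"
    have *: "\<nu> ((1 / (\<beta> * (m + E))) *\<^sub>R y) = \<nu> y / (\<beta> * (m + E))"
      using \<beta> mE by (simp add: seminorm_scale[OF \<nu>] abs_mult)
    show "\<nu> ((1 / (\<beta> * (m + E))) *\<^sub>R y) \<le> 1" if "norm y \<le> m + E"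
      unfolding * using order_trans[OF \<nu>_le[OF y] mult_left_mono[OF that, of \<beta>]] \<beta> mE
      by (simp add: divide_le_eq)
    show "norm y \<le> A" if "\<nu> ((1 / (\<beta> * (m + E))) *\<^sub>R y) \<le> 4 * R"
    proof -
      have "\<nu> y \<le> 4 * R * (\<beta> * (m + E))"
        using that \<beta> mE unfolding * by (simp add: divide_le_eq)
      then have "\<alpha> * norm y \<le> 4 * R * (\<beta> * (m + E))" using \<nu>_ge[OF y] by linarith
      then show ?thesis unfolding A_def using \<alpha> by (simp add: pos_le_divide_eq mult_ac)
    qed
  qed (use gY Y \<beta> mE subspace_0[OF Y] in auto)
  have "game norm (UNIV :: 'a set) 1 (n * m) (0 + 0) (A + norm (0::'a) + n * E)"
  proof (rule game_three_space[OF _ _ gQ' gY'])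
    show "\<mu> v \<le> \<beta>" if "norm v \<le> 1" for v
      using order_trans[OF \<mu>_le mult_left_mono[OF that, of \<beta>]] \<beta> by simp
    fix \<Phi> :: "('a \<Rightarrow> real) set" assume "finite \<Phi>" "\<forall>\<phi>\<in>\<Phi>. bounded_linear \<phi>"
    then have "\<forall>\<^sub>F u in finite_codim_filter. \<forall>a. infdist u Y < a \<longrightarrow>
        (\<exists>y\<in>Y. (\<forall>\<phi>\<in>\<Phi>. \<phi> y = 0) \<and> norm (u - y) \<le> 3 * a)"
      using eventually_near_subspace_kernel[OF Y] by blast
    then show "\<forall>\<^sub>F u in finite_codim_filter. \<mu> u \<le> \<beta> * (4 * R') \<longrightarrow>
        (\<exists>y\<in>Y. (\<forall>\<phi>\<in>\<Phi>. \<phi> y = 0) \<and> norm (u - y) \<le> E)"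
    proof eventually_elim
      case (elim u)
      show ?case
      proof
        assume "\<mu> u \<le> \<beta> * (4 * R')"
        then have "\<alpha> * infdist u Y \<le> \<beta> * (4 * R')" using \<mu>_ge[of u] by linarith
        then have "infdist u Y \<le> \<beta> * (4 * R') / \<alpha>" using \<alpha> by (simp add: pos_le_divide_eq mult.commute)
        also have "\<dots> < E / 3" unfolding E_def using \<alpha> \<beta> R' by (simp add: field_simps)
        finally show "\<exists>y\<in>Y. (\<forall>\<phi>\<in>\<Phi>. \<phi> y = 0) \<and> norm (u - y) \<le> E" using elim by fastforce
      qed
    qed
  qed
  moreover have "A + norm (0::'a) + n * E \<le> C * R * R' * L"
  proof -
    define q where "q = \<beta> / \<alpha>"
    have q: "q > 0" unfolding q_def using \<alpha> \<beta> by simp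
    have R'L: "R' \<le> R' * L" using R' L by simp
    have A_eq: "A = 4 * R * q * (m + 16 * q * R')" and E_eq: "E = 16 * q * R'"
      by (simp_all add: A_def E_def q_def)
    have "m + 16 * q * R' \<le> 2 * (R' * L) + 16 * q * (R' * L)"
      using m(2) RL(2) R'L q by (intro add_mono mult_left_mono) auto
    then have "A \<le> 4 * R * q * (2 * (R' * L) + 16 * q * (R' * L))"
      unfolding A_eq using R q by (intro mult_left_mono) auto
    moreover have "n * E \<le> (2 * (R * L)) * (16 * q * R')"
      unfolding E_eq using n(2) RL(1) q R' by (intro mult_right_mono) auto
    moreover have "4 * R * q * (2 * (R' * L) + 16 * q * (R' * L)) + (2 * (R * L)) * (16 * q * R')
        \<le> C * R * R' * L"
    proof -
      have "C = 8 * q * (1 + 16 * q) + 32 * q" by (simp add: C_def q_def)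
      then have "C * R * R' * L - (4 * R * q * (2 * (R' * L) + 16 * q * (R' * L)) + (2 * (R * L)) * (16 * q * R'))
          = 64 * q * q * (R * R' * L)"
        by (simp add: algebra_simps)
      moreover have "0 \<le> 64 * q * q * (R * R' * L)" using q R R' L by simp
      ultimately show ?thesis by linarith
    qed
    ultimately show ?thesis by simp
  qed
  ultimately have "game norm (UNIV :: 'a set) 1 (n * m) 0 (C * R * R' * L)" by (auto elim: game_mono)
  moreover have "real (n * m) \<ge> R * R' * L\<^sup>2"
    using mult_mono[OF n(1) m(1)] RL by (simp add: power2_eq_square mult_ac)
  ultimately show ?thesis using that by blast
qed

text \<open>At scale k the average ball tolerates moves of length \<tau> at a relative cost 1/N, and
  1/N is at most a multiple of \<tau> / L k. The combined body is comparable to the unit ball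
  because \<open>a\<close> is summable; in it the scale k survives with the same cost and with its
  length multiplied by \<open>a k\<close>.\<close>

theorem three_space_renorming:
  fixes Y :: "'a::real_normed_vector set" and a L R R' :: "nat \<Rightarrow> real"
  assumes Y: "subspace Y" and L: "\<And>k. L k \<ge> 1" and R: "\<And>k. R k \<ge> 1" and R': "\<And>k. R' k \<ge> 1"
    and \<nu>: "seminorm \<nu>" and \<nu>_le: "\<And>y. y \<in> Y \<Longrightarrow> \<nu> y \<le> \<beta> * norm y" and \<nu>_ge: "\<And>y. y \<in> Y \<Longrightarrow> \<alpha> * norm y \<le> \<nu> y"
    and \<mu>: "seminorm \<mu>" and \<mu>_le: "\<And>u. \<mu> u \<le> \<beta> * norm u" and \<mu>_ge: "\<And>u. \<alpha> * infdist u Y \<le> \<mu> u"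
    and \<alpha>: "\<alpha> > 0" and \<beta>: "\<beta> > 0"
    and flatY: "\<And>k. flat \<nu> Y (R k) (1 / L k)" and flatQ: "\<And>k. flat \<mu> UNIV (R' k) (1 / L k)"
    and a_pos: "\<And>k. a k > 0" and a_sum: "summable a"
  obtains n :: "'a \<Rightarrow> real" and C A B where "seminorm n" "C > 0" "A > 0" "B > 0"
    "\<forall>x. A * norm x \<le> n x \<and> n x \<le> B * norm x"
    "\<forall>k x e. n x \<le> 1 \<longrightarrow> e > 0 \<longrightarrow> (\<forall>\<^sub>F y in finite_codim_filter.
      norm y \<le> a k / (C * (R k * R' k * L k)) \<longrightarrow> n (x + y) \<le> 1 + 1 / (R k * R' k * (L k)\<^sup>2) + e)"
proof -
  define C where "C = 8 * \<beta> / \<alpha> * (1 + 16 * \<beta> / \<alpha>) + 32 * \<beta> / \<alpha>"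
  have C: "C > 0" unfolding C_def using \<alpha> \<beta> by (intro add_pos_pos mult_pos_pos divide_pos_pos) auto
  have "\<exists>N::nat. real N \<ge> R k * R' k * (L k)\<^sup>2 \<and> game norm (UNIV :: 'a set) 1 N 0 (C * R k * R' k * L k)" for k
    using game_three_space_of_flat[OF Y L R R' \<nu> \<nu>_le \<nu>_ge \<mu> \<mu>_le \<mu>_ge \<alpha> \<beta> flatY flatQ, of k]
    unfolding C_def by metis
  then obtain N :: "nat \<Rightarrow> nat" where N: "\<And>k. real (N k) \<ge> R k * R' k * (L k)\<^sup>2"
    and g: "\<And>k. game norm (UNIV :: 'a set) 1 (N k) 0 (C * R k * R' k * L k)"
    by metis
  define \<tau> where "\<tau> k = 1 / (2 * C * (R k * R' k * L k))" for k
  have pos: "R k * R' k * L k > 0" "R k * R' k * (L k)\<^sup>2 > 0" for k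
    using R[of k] R'[of k] L[of k] by (auto intro!: mult_pos_pos)
  have N0: "N k > 0" for k using N[of k] pos(2)[of k] by (intro gr0I) simp
  have \<tau>: "\<tau> k > 0" "\<tau> k * (C * R k * R' k * L k) = 1 / 2" for k
    using pos(1)[of k] C unfolding \<tau>_def by (auto simp: field_simps)
  define D where "D k = (average_ball (\<tau> k) (N k) :: 'a set)" for k
  note D_facts = cball_subset_average_ball[OF N0 \<tau> g] average_ball_subset_cball[OF N0 \<tau> g]
    uminus_average_ball[OF N0 \<tau> g] convex_average_ball[OF N0 \<tau> g]
  have D: "\<And>k. convex (D k)" "\<And>k. \<forall>x\<in>D k. - x \<in> D k"
    "\<And>k. cball 0 (1 / 2) \<subseteq> D k" "\<And>k. D k \<subseteq> cball 0 1"
    unfolding D_def using D_facts by blast+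
  have D_add: "\<forall>\<^sub>F y in finite_codim_filter. norm y \<le> \<tau> k \<longrightarrow> (1 / (1 + 1 / N k)) *\<^sub>R (x + y) \<in> D k"
    if "x \<in> D k" for k x
    using average_ball_add[OF N0 \<tau> g] that unfolding D_def by blast
  note U = convex_combination_ball[where D = D, OF a_pos a_sum D] uminus_combination_ball[where D = D, OF a_pos a_sum D]
    cball_subset_combination_ball[where D = D, OF a_pos a_sum D] combination_ball_subset_cball[where D = D, OF a_pos a_sum D]
  define U where "U = combination_ball a D"
  have suma: "suminf a > 0" using a_pos a_sum by (intro suminf_pos) auto
  have a0: "a 0 / 2 > 0" using a_pos[of 0] by simp
  define n where "n = gauge_of U"
  have UU: "convex U" "\<forall>x\<in>U. - x \<in> U" "a 0 / 2 > 0" "cball 0 (a 0 / 2) \<subseteq> U"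
    "suminf a > 0" "U \<subseteq> cball 0 (suminf a)"
    unfolding U_def using U suma a0 by blast+
  have sn: "seminorm n" unfolding n_def by (rule seminorm_gauge_of[OF UU])
  show ?thesis
  proof (rule that[of n "2 * C" "1 / suminf a" "2 / a 0"])
    show "seminorm n" by (rule sn)
    show "2 * C > 0" "1 / suminf a > 0" "2 / a 0 > 0" using C suma a_pos[of 0] by auto
    show "\<forall>x. 1 / suminf a * norm x \<le> n x \<and> n x \<le> 2 / a 0 * norm x"
      unfolding n_def using gauge_of_lower[OF UU] gauge_of_upper[OF UU] by (simp add: mult.commute)
    show "\<forall>k x e. n x \<le> 1 \<longrightarrow> e > 0 \<longrightarrow> (\<forall>\<^sub>F y in finite_codim_filter.
        norm y \<le> a k / (2 * C * (R k * R' k * L k)) \<longrightarrow> n (x + y) \<le> 1 + 1 / (R k * R' k * (L k)\<^sup>2) + e)"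
    proof (intro allI impI)
      fix k x and e :: real
      assume x: "n x \<le> 1" and e: "e > 0"
      \<comment> \<open>A gauge of at most 1 does not yet put \<open>x\<close> into
        \<open>U\<close>, a gauge below 1 does. The slack \<open>e\<close> in the conclusion pays
        for this contraction.\<close>
      define x' where "x' = (1 / (1 + e)) *\<^sub>R x"
      have "n x' < 1" unfolding x'_def using x e by (simp add: seminorm_scale[OF sn])
      then have "x' \<in> U" unfolding n_def using gauge_of_less[OF UU, of x' 1] by simp
      define s where "s = 1 / (1 + 1 / real (N k))"
      have s: "0 \<le> s" "s \<le> 1" "s > 0" "1 / s = 1 + 1 / N k" using N0[of k] unfolding s_def by (auto simp: add_nonneg_pos)
      have "\<forall>\<^sub>F y in finite_codim_filter. norm y \<le> a k * \<tau> k \<longrightarrow> s *\<^sub>R (x' + y) \<in> U"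
        unfolding U_def by (rule combination_ball_add[where D = D, OF a_pos a_sum D])
          (use \<open>x' \<in> U\<close> s D_add in \<open>auto simp: U_def s_def\<close>)
      then show "\<forall>\<^sub>F y in finite_codim_filter. norm y \<le> a k / (2 * C * (R k * R' k * L k)) \<longrightarrow>
          n (x + y) \<le> 1 + 1 / (R k * R' k * (L k)\<^sup>2) + e"
      proof eventually_elim
        case (elim y)
        show ?case
        proof
          assume "norm y \<le> a k / (2 * C * (R k * R' k * L k))"
          then have "s *\<^sub>R (x' + y) \<in> U" using elim by (simp add: \<tau>_def)
          then have "n (x' + y) \<le> 1 / s"
            unfolding n_def using s(3) by (intro gauge_of_le[OF UU]) simp_all
          also have "\<dots> \<le> 1 + 1 / (R k * R' k * (L k)\<^sup>2)"
            unfolding s(4) using N[of k] pos(2)[of k] by (simp add: frac_le)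
          finally have "n (x' + y) \<le> 1 + 1 / (R k * R' k * (L k)\<^sup>2)" .
          moreover have "n (x + y) \<le> n (x' + y) + n (x - x')"
            using seminorm_add[OF sn, of "x' + y" "x - x'"] by (simp add: add.commute)
          moreover have "n (x - x') \<le> e"
          proof -
            have "x - x' = (e / (1 + e)) *\<^sub>R x"
            proof -
              have "x - x' = (1 - 1 / (1 + e)) *\<^sub>R x" unfolding x'_def by (simp add: scaleR_left_diff_distrib)
              also have "1 - 1 / (1 + e) = e / (1 + e)" using e by (simp add: field_simps)
              finally show ?thesis .
            qed
            then have "n (x - x') = (e / (1 + e)) * n x" using e by (simp add: seminorm_scale[OF sn])
            also have "\<dots> \<le> (e / (1 + e)) * 1" using x e by (intro mult_left_mono) auto
            also have "\<dots> \<le> e" using e by (simp add: field_simps)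
            finally show ?thesis .
          qed
          ultimately show "n (x + y) \<le> 1 + 1 / (R k * R' k * (L k)\<^sup>2) + e" by linarith
        qed
      qed
    qed
  qed
qed

section \<open>Presentations of spaces by subspaces of a normed type\<close>

text \<open>
  Cosets, extensional functionals and elements of \<open>Y\<close> are all parametrised linearly by a subspace of a
  vector space type, where the library applies. The map \<open>\<pi>\<close> need not be injective.
\<close>

locale linear_presentation =
  fixes Z :: "'v nspace" and S :: "'b::real_vector set" and \<pi> :: "'b \<Rightarrow> 'v"
  assumes S: "subspace S" and onto: "\<pi> ` S = vcarrier Z"
    and pi_add: "\<And>x y. x \<in> S \<Longrightarrow> y \<in> S \<Longrightarrow> \<pi> (x + y) = vadd Z (\<pi> x) (\<pi> y)"
    and pi_scale: "\<And>c x. x \<in> S \<Longrightarrow> \<pi> (c *\<^sub>R x) = vscale Z c (\<pi> x)"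
begin

lemma in_carrier: "x \<in> S \<Longrightarrow> \<pi> x \<in> vcarrier Z"
  using onto by blast

lemma pi_diff: "x \<in> S \<Longrightarrow> y \<in> S \<Longrightarrow> \<pi> (x - y) = vadd Z (\<pi> x) (vscale Z (- 1) (\<pi> y))"
  using pi_add[of x "- 1 *\<^sub>R y"] pi_scale[of y "- 1"] subspace_scale[OF S, of y "- 1"] by simp

lemma pi_diff_eq: "x \<in> S \<Longrightarrow> y \<in> S \<Longrightarrow> \<pi> x = \<pi> y \<Longrightarrow> \<pi> (x - y) = \<pi> 0"
  using pi_diff[of x y] pi_diff[of y y] by simp

definition preimage :: "'v set \<Rightarrow> 'b set" where
  "preimage W = {x \<in> S. \<pi> x \<in> W}"

lemma preimage_subset: "preimage W \<subseteq> S"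
  by (auto simp: preimage_def)

lemma image_preimage: "linear_subspace Z W \<Longrightarrow> \<pi> ` preimage W = W"
proof -
  assume "linear_subspace Z W"
  then have "W \<subseteq> \<pi> ` S" by (simp add: linear_subspace_def onto)
  then show ?thesis unfolding preimage_def by auto
qed

lemma linear_subspace_zero: "linear_subspace Z W \<Longrightarrow> \<pi> 0 \<in> W"
proof -
  assume W: "linear_subspace Z W"
  then obtain w where "w \<in> W" by (auto simp: linear_subspace_def)
  then obtain x where "x \<in> S" "\<pi> x \<in> W" using image_preimage[OF W] by (auto simp: preimage_def)
  then show ?thesis using W pi_scale[of x 0] by (auto simp: linear_subspace_def)
qed

lemma subspace_preimage:
  assumes W: "linear_subspace Z W"
  shows "subspace (preimage W)"
proof -
  have "\<pi> 0 \<in> W" by (rule linear_subspace_zero[OF W])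
  moreover have "\<pi> (x + y) \<in> W" if "x \<in> S" "y \<in> S" "\<pi> x \<in> W" "\<pi> y \<in> W" for x y
    using that W pi_add by (simp add: linear_subspace_def)
  moreover have "\<pi> (c *\<^sub>R x) \<in> W" if "x \<in> S" "\<pi> x \<in> W" for c x
    using that W pi_scale by (simp add: linear_subspace_def)
  ultimately show ?thesis
    using S unfolding preimage_def subspace_def by simp
qed

lemma linear_subspace_image:
  assumes "subspace H" "H \<subseteq> S"
  shows "linear_subspace Z (\<pi> ` H)"
proof -
  have "vadd Z (\<pi> x) (\<pi> y) \<in> \<pi> ` H" if "x \<in> H" "y \<in> H" for x y
    using that assms pi_add[of x y] subspace_add[OF assms(1), of x y] by (metis image_eqI subsetD)
  moreover have "vscale Z c (\<pi> x) \<in> \<pi> ` H" if "x \<in> H" for c x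
    using that assms pi_scale[of x c] subspace_scale[OF assms(1), of x c] by (metis image_eqI subsetD)
  moreover have "\<pi> ` H \<noteq> {}" using subspace_0[OF assms(1)] by blast
  ultimately show ?thesis
    using assms(2) onto unfolding linear_subspace_def by blast
qed

text \<open>The set joined to \<open>G\<close> is the kernel of \<pi>, as \<pi> 0 is the zero of
  \<open>Z\<close>; with a map that may fail to be injective, generators have to span only modulo
  this kernel.\<close>

lemma finite_dim_iff:
  "finite_dim Z \<longleftrightarrow> (\<exists>G. finite G \<and> G \<subseteq> S \<and> S \<subseteq> span ({x \<in> S. \<pi> x = \<pi> 0} \<union> G))"
proof
  assume "finite_dim Z"
  then obtain B where B: "finite B" "B \<subseteq> vcarrier Z" "linear_subspace Z hull B = vcarrier Z"
    unfolding finite_dim_def by blast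
  obtain G where G: "G \<subseteq> S" "finite G" "B = \<pi> ` G"
    using finite_subset_image[of B \<pi> S] B(1,2) onto by metis
  define H where "H = span ({x \<in> S. \<pi> x = \<pi> 0} \<union> G)"
  have HS: "H \<subseteq> S" unfolding H_def using G(1) S by (intro span_minimal) auto
  have "linear_subspace Z (\<pi> ` H)" using HS by (intro linear_subspace_image) (simp_all add: H_def)
  moreover have "B \<subseteq> \<pi> ` H" unfolding G(3) H_def using span_superset by fast
  ultimately have carrier: "vcarrier Z \<subseteq> \<pi> ` H"
    using hull_minimal[of B "\<pi> ` H" "linear_subspace Z"] B(3) by simp
  have "s \<in> H" if "s \<in> S" for s
  proof -
    obtain h where h: "h \<in> H" "\<pi> s = \<pi> h" using carrier in_carrier[OF \<open>s \<in> S\<close>] by blast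
    then have "s - h \<in> {x \<in> S. \<pi> x = \<pi> 0}"
      using that HS subspace_diff[OF S] pi_diff_eq by auto
    then have "s - h \<in> H" unfolding H_def by (intro span_base) simp
    then have "(s - h) + h \<in> H" using h(1) unfolding H_def by (rule span_add)
    then show ?thesis by simp
  qed
  then show "\<exists>G. finite G \<and> G \<subseteq> S \<and> S \<subseteq> span ({x \<in> S. \<pi> x = \<pi> 0} \<union> G)"
    using G by (auto simp: H_def)
next
  assume "\<exists>G. finite G \<and> G \<subseteq> S \<and> S \<subseteq> span ({x \<in> S. \<pi> x = \<pi> 0} \<union> G)"
  then obtain G where G: "finite G" "G \<subseteq> S" "S \<subseteq> span ({x \<in> S. \<pi> x = \<pi> 0} \<union> G)" by blast
  have "linear_subspace Z hull (\<pi> ` G) \<subseteq> vcarrier Z"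
    using linear_subspace_image[OF S order_refl] onto G(2) by (intro hull_minimal) auto
  moreover have "vcarrier Z \<subseteq> T" if "linear_subspace Z T" "\<pi> ` G \<subseteq> T" for T
  proof -
    have "{x \<in> S. \<pi> x = \<pi> 0} \<union> G \<subseteq> preimage T"
      using linear_subspace_zero[OF that(1)] that(2) G(2) by (auto simp: preimage_def)
    then have "S \<subseteq> preimage T" using G(3) span_minimal[OF _ subspace_preimage[OF that(1)]] by blast
    then show ?thesis unfolding onto[symmetric] by (auto simp: preimage_def)
  qed
  then have "vcarrier Z \<subseteq> linear_subspace Z hull (\<pi> ` G)" unfolding hull_def by blast
  ultimately show "finite_dim Z"
    unfolding finite_dim_def using G(1,2) in_carrier by (intro exI[of _ "\<pi> ` G"]) auto
qed

lemma coset_eq: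
  assumes "linear_subspace Z W" "x \<in> S"
  shows "vadd Z (\<pi> x) ` W = \<pi> ` (+) x ` preimage W"
proof -
  have "vadd Z (\<pi> x) ` W = vadd Z (\<pi> x) ` \<pi> ` preimage W" using image_preimage[OF assms(1)] by simp
  also have "\<dots> = \<pi> ` (+) x ` preimage W"
    unfolding image_image using assms(2) pi_add by (intro image_cong) (auto simp: preimage_def)
  finally show ?thesis .
qed

text \<open>The quotient is presented by the same \<open>S\<close>, with the preimage of
  \<open>W\<close> as the new kernel. So codimension, in a space, a quotient or a dual, is computed
  by spans in a vector space type.\<close>

lemma quotient_presentation:
  assumes W: "linear_subspace Z W"
  shows "linear_presentation (quotient_space Z W) S (\<lambda>x. vadd Z (\<pi> x) ` W)"
proof
  note P = subspace_preimage[OF W]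
  show "subspace S" by (rule S)
  show "(\<lambda>x. vadd Z (\<pi> x) ` W) ` S = vcarrier (quotient_space Z W)"
    unfolding quotient_space_def using onto by (auto simp: image_image simp flip: onto)
  fix x assume x: "x \<in> S"
  note cx = coset_eq[OF W x]
  show "vadd Z (\<pi> (x + y)) ` W = vadd (quotient_space Z W) (vadd Z (\<pi> x) ` W) (vadd Z (\<pi> y) ` W)"
    if y: "y \<in> S" for y
  proof -
    note cy = coset_eq[OF W y]
    have *: "vadd Z (\<pi> (x + v)) (\<pi> (y + w)) = \<pi> (x + y + (v + w))"
      if "v \<in> preimage W" "w \<in> preimage W" for v w
    proof -
      have "x + v \<in> S" "y + w \<in> S" using that x y subspace_add[OF S] preimage_subset by blast+
      then show ?thesis by (simp add: algebra_simps flip: pi_add)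
    qed
    show ?thesis
      unfolding quotient_space_def coset_eq[OF W subspace_add[OF S x y]] cx cy nspace.simps
    proof safe
      fix w assume "w \<in> preimage W"
      then have "\<pi> (x + y + w) = vadd Z (\<pi> (x + w)) (\<pi> (y + 0))"
        using *[of w 0] subspace_0[OF P] by simp
      then show "\<exists>a b. \<pi> (x + y + w) = vadd Z a b \<and> a \<in> \<pi> ` (+) x ` preimage W \<and> b \<in> \<pi> ` (+) y ` preimage W"
        using \<open>w \<in> preimage W\<close> subspace_0[OF P] by blast
    next
      fix v w assume "v \<in> preimage W" "w \<in> preimage W"
      then show "vadd Z (\<pi> (x + v)) (\<pi> (y + w)) \<in> \<pi> ` (+) (x + y) ` preimage W"
        using * subspace_add[OF P] by simp
    qed
  qed
  show "vadd Z (\<pi> (c *\<^sub>R x)) ` W = vscale (quotient_space Z W) c (vadd Z (\<pi> x) ` W)" for c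
  proof -
    have *: "vadd Z (vscale Z c (\<pi> (x + v))) (\<pi> w) = \<pi> (c *\<^sub>R x + (c *\<^sub>R v + w))"
      if "v \<in> preimage W" "w \<in> preimage W" for v w
    proof -
      have "x + v \<in> S" "w \<in> S" using that x subspace_add[OF S] preimage_subset by blast+
      moreover from this have "c *\<^sub>R (x + v) \<in> S" using subspace_scale[OF S] by blast
      ultimately show ?thesis by (simp add: algebra_simps flip: pi_add pi_scale)
    qed
    show ?thesis
      unfolding quotient_space_def coset_eq[OF W subspace_scale[OF S x]] cx nspace.simps
    proof safe
      fix w assume w: "w \<in> preimage W"
      then have "\<pi> (c *\<^sub>R x + w) = vadd Z (vscale Z c (\<pi> (x + 0))) (\<pi> w)"
        using *[of 0 w] subspace_0[OF P] by simp
      moreover have "\<pi> w \<in> W" using w by (simp add: preimage_def)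
      ultimately show "\<exists>a w'. \<pi> (c *\<^sub>R x + w) = vadd Z (vscale Z c a) w' \<and> a \<in> \<pi> ` (+) x ` preimage W \<and> w' \<in> W"
        using subspace_0[OF P] by blast
    next
      fix v w assume v: "v \<in> preimage W" and "w \<in> W"
      then obtain u where u: "w = \<pi> u" "u \<in> preimage W" using image_preimage[OF W] by blast
      then show "vadd Z (vscale Z c (\<pi> (x + v))) w \<in> \<pi> ` (+) (c *\<^sub>R x) ` preimage W"
        using *[OF v u(2)] subspace_add[OF P subspace_scale[OF P v, of c] u(2)] by simp
    qed
  qed
qed

lemma finite_codim_iff:
  assumes W: "linear_subspace Z W"
  shows "finite_codim Z W \<longleftrightarrow> (\<exists>G. finite G \<and> G \<subseteq> S \<and> S \<subseteq> span (preimage W \<union> G))"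
proof -
  interpret Q: linear_presentation "quotient_space Z W" S "\<lambda>x. vadd Z (\<pi> x) ` W"
    by (rule quotient_presentation[OF W])
  note P = subspace_preimage[OF W]
  have 0: "vadd Z (\<pi> 0) ` W = W" using coset_eq[OF W subspace_0[OF S]] image_preimage[OF W] by simp
  have "(vadd Z (\<pi> x) ` W = W) \<longleftrightarrow> \<pi> x \<in> W" if x: "x \<in> S" for x
  proof
    assume "vadd Z (\<pi> x) ` W = W"
    moreover have "\<pi> (x + 0) \<in> vadd Z (\<pi> x) ` W"
      unfolding coset_eq[OF W x] using subspace_0[OF P] by blast
    ultimately show "\<pi> x \<in> W" by simp
  next
    assume "\<pi> x \<in> W"
    then have "x \<in> preimage W" using x by (simp add: preimage_def)
    then have "(+) x ` preimage W = preimage W"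
      using subspace_add[OF P] subspace_diff[OF P] by (auto simp: image_iff) (metis add_diff_cancel_left' add.commute diff_add_cancel)
    then show "vadd Z (\<pi> x) ` W = W" unfolding coset_eq[OF W x] using image_preimage[OF W] by simp
  qed
  then have "{x \<in> S. vadd Z (\<pi> x) ` W = vadd Z (\<pi> 0) ` W} = preimage W"
    unfolding 0 preimage_def by blast
  then show ?thesis unfolding finite_codim_def using W Q.finite_dim_iff by simp
qed

end

text \<open>\<nu> is defined on the whole type, but only its values on \<open>S\<close> belong to
  \<open>Z\<close>. The bound \<open>\<nu>_le\<close> makes linear functionals dominated by \<nu>
  bounded on the type, so their kernels there count for \<open>finite_codim_filter\<close>.\<close>

locale normed_presentation = linear_presentation Z S \<pi>
  for Z :: "'v nspace" and S :: "'a::real_normed_vector set" and \<pi> :: "'a \<Rightarrow> 'v" +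
  fixes \<nu> :: "'a \<Rightarrow> real" and K :: real
  assumes \<nu>: "seminorm \<nu>" and \<nu>_le: "\<And>x. \<nu> x \<le> K * norm x" and vnorm_pi: "\<And>x. x \<in> S \<Longrightarrow> vnorm Z (\<pi> x) = \<nu> x"
begin

lemma pi_eq_imp: "x \<in> S \<Longrightarrow> y \<in> S \<Longrightarrow> \<pi> x = \<pi> y \<Longrightarrow> \<nu> (x - y) = 0"
  using vnorm_pi[of "x - y"] vnorm_pi[of 0] pi_diff_eq[of x y] subspace_diff[OF S, of x y]
    subspace_0[OF S] seminorm_zero[OF \<nu>] by simp

text \<open>Functionals on \<open>Z\<close> are represented by bounded functionals on the whole
  type, which form a vector space type, so that the dual is again linearly presented. The bound on
  \<open>S\<close> makes them constant on the fibres of \<pi>; those that agree on \<open>S\<close>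
  represent the same functional.\<close>

definition dual_domain :: "('a \<Rightarrow>\<^sub>L real) set" where
  "dual_domain = {\<phi> :: 'a \<Rightarrow>\<^sub>L real. \<exists>C. \<forall>x\<in>S. \<bar>\<phi> x\<bar> \<le> C * \<nu> x}"

definition dual_map :: "('a \<Rightarrow>\<^sub>L real) \<Rightarrow> 'v \<Rightarrow> real" where
  "dual_map \<phi> = (\<lambda>z\<in>vcarrier Z. \<phi> (inv_into S \<pi> z))"

definition dual_norm :: "('a \<Rightarrow>\<^sub>L real) \<Rightarrow> real" where
  "dual_norm \<phi> = (SUP x\<in>{x \<in> S. \<nu> x \<le> 1}. \<bar>\<phi> x\<bar>)"

lemma subspace_dual_domain: "subspace dual_domain"
  unfolding subspace_def
proof (intro conjI ballI allI)
  show "0 \<in> dual_domain" unfolding dual_domain_def by (auto intro!: exI[of _ 0])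
  fix \<phi> assume "\<phi> \<in> dual_domain"
  then obtain C where C: "\<And>x. x \<in> S \<Longrightarrow> \<bar>\<phi> x\<bar> \<le> C * \<nu> x" unfolding dual_domain_def by blast
  have "\<bar>(c *\<^sub>R \<phi>) x\<bar> \<le> (\<bar>c\<bar> * C) * \<nu> x" if "x \<in> S" for c x
    using mult_left_mono[OF C[OF that], of "\<bar>c\<bar>"] by (simp add: blinfun.scaleR_left abs_mult mult.assoc)
  then show "c *\<^sub>R \<phi> \<in> dual_domain" for c unfolding dual_domain_def by blast
  fix \<psi> assume "\<psi> \<in> dual_domain"
  then obtain D where D: "\<And>x. x \<in> S \<Longrightarrow> \<bar>\<psi> x\<bar> \<le> D * \<nu> x" unfolding dual_domain_def by blast
  have "\<bar>(\<phi> + \<psi>) x\<bar> \<le> (C + D) * \<nu> x" if "x \<in> S" for x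
    using C[OF that] D[OF that] by (simp add: blinfun.add_left algebra_simps)
  then show "\<phi> + \<psi> \<in> dual_domain" unfolding dual_domain_def by blast
qed

lemma dual_map_pi:
  assumes "\<phi> \<in> dual_domain" "x \<in> S"
  shows "dual_map \<phi> (\<pi> x) = \<phi> x"
proof -
  let ?y = "inv_into S \<pi> (\<pi> x)"
  have y: "?y \<in> S" "\<pi> ?y = \<pi> x" using assms(2) by (auto intro: inv_into_into f_inv_into_f)
  obtain C where "\<And>x. x \<in> S \<Longrightarrow> \<bar>\<phi> x\<bar> \<le> C * \<nu> x" using assms(1) unfolding dual_domain_def by blast
  then have "\<bar>\<phi> (?y - x)\<bar> \<le> 0"
    using pi_eq_imp[OF y(1) assms(2) y(2)] subspace_diff[OF S y(1) assms(2)] by fastforce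
  then show ?thesis using in_carrier[OF assms(2)] by (simp add: dual_map_def blinfun.diff_right)
qed

lemma dual_map_outside: "z \<notin> vcarrier Z \<Longrightarrow> dual_map \<phi> z = undefined"
  by (simp add: dual_map_def)

lemma dual_map_eqI:
  assumes "\<phi> \<in> dual_domain" "f \<in> extensional (vcarrier Z)" "\<And>x. x \<in> S \<Longrightarrow> f (\<pi> x) = \<phi> x"
  shows "dual_map \<phi> = f"
proof
  fix z
  show "dual_map \<phi> z = f z"
  proof (cases "z \<in> vcarrier Z")
    case True
    then obtain x where "x \<in> S" "z = \<pi> x" using onto by blast
    then show ?thesis using dual_map_pi[OF assms(1)] assms(3) by simp
  next
    case False
    then show ?thesis using assms(2) by (simp add: dual_map_outside extensional_def)
  qed
qed

lemma vnorm_dual_map: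
  assumes "\<phi> \<in> dual_domain"
  shows "vnorm (dual_space Z) (dual_map \<phi>) = dual_norm \<phi>"
proof -
  have "{z \<in> vcarrier Z. vnorm Z z \<le> 1} = \<pi> ` {x \<in> S. \<nu> x \<le> 1}"
    using vnorm_pi by (auto simp flip: onto)
  then show ?thesis
    unfolding dual_space_def dual_norm_def nspace.simps
    using dual_map_pi[OF assms] by (simp add: image_image)
qed

lemma dual_map_in_carrier:
  assumes "\<phi> \<in> dual_domain"
  shows "dual_map \<phi> \<in> vcarrier (dual_space Z)"
proof -
  note \<phi> = dual_map_pi[OF assms]
  obtain C where "\<And>x. x \<in> S \<Longrightarrow> \<bar>\<phi> x\<bar> \<le> C * \<nu> x" using assms unfolding dual_domain_def by blast
  then have "\<forall>z\<in>vcarrier Z. \<bar>dual_map \<phi> z\<bar> \<le> C * vnorm Z z"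
    unfolding onto[symmetric] using \<phi> vnorm_pi by auto
  moreover have "\<forall>x\<in>vcarrier Z. \<forall>y\<in>vcarrier Z. dual_map \<phi> (vadd Z x y) = dual_map \<phi> x + dual_map \<phi> y"
    unfolding onto[symmetric]
    using \<phi> subspace_add[OF S] by (auto simp flip: pi_add simp: blinfun.add_right)
  moreover have "\<forall>c. \<forall>x\<in>vcarrier Z. dual_map \<phi> (vscale Z c x) = c * dual_map \<phi> x"
    unfolding onto[symmetric]
    using \<phi> subspace_scale[OF S] by (auto simp flip: pi_scale simp: blinfun.scaleR_right)
  moreover have "dual_map \<phi> \<in> extensional (vcarrier Z)" by (simp add: dual_map_def)
  ultimately show ?thesis unfolding dual_space_def nspace.simps by blast
qed

text \<open>Hahn--Banach extends the composition of \<open>f\<close> with \<pi> from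
  \<open>S\<close> under a multiple of \<nu>. The absolute value of \<open>C\<close> appears because
  the dual carrier does not ask its constant to be nonnegative.\<close>

lemma dual_map_onto:
  assumes "f \<in> vcarrier (dual_space Z)"
  obtains \<phi> where "\<phi> \<in> dual_domain" "dual_map \<phi> = f"
proof -
  from assms have f: "f \<in> extensional (vcarrier Z)"
    "x \<in> vcarrier Z \<Longrightarrow> y \<in> vcarrier Z \<Longrightarrow> f (vadd Z x y) = f x + f y"
    "x \<in> vcarrier Z \<Longrightarrow> f (vscale Z c x) = c * f x" for c x y
    by (simp_all add: dual_space_def)
  from assms obtain C where C: "\<forall>x\<in>vcarrier Z. \<bar>f x\<bar> \<le> C * vnorm Z x"
    by (auto simp: dual_space_def)
  define p where "p x = \<bar>C\<bar> * \<nu> x" for x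
  have sp: "seminorm p"
    unfolding p_def seminorm_def
  proof (intro conjI allI)
    show "\<bar>C\<bar> * \<nu> (x + y) \<le> \<bar>C\<bar> * \<nu> x + \<bar>C\<bar> * \<nu> y" for x y
      using mult_left_mono[OF seminorm_add[OF \<nu>, of x y] abs_ge_zero, of C] by (simp add: distrib_left)
  qed (simp add: seminorm_scale[OF \<nu>])
  have "f (\<pi> x) \<le> p x" if "x \<in> S" for x
  proof -
    have "f (\<pi> x) \<le> C * \<nu> x" using bspec[OF C in_carrier[OF that]] vnorm_pi[OF that] by simp
    also have "\<dots> \<le> \<bar>C\<bar> * \<nu> x" using seminorm_nonneg[OF \<nu>, of x] by (intro mult_right_mono) auto
    finally show ?thesis by (simp add: p_def)
  qed
  then obtain g where g: "linear g" "\<And>x. x \<in> S \<Longrightarrow> g x = f (\<pi> x)" "\<And>x. g x \<le> p x"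
    using Hahn_Banach[OF seminorm_imp_sublinear[OF sp] S, of "\<lambda>x. f (\<pi> x)"]
      f(2,3) in_carrier pi_add pi_scale by auto
  have "p x \<le> (\<bar>C\<bar> * K) * norm x" for x
    unfolding p_def using mult_left_mono[OF \<nu>_le[of x], of "\<bar>C\<bar>"] by (simp add: mult.assoc)
  then have bl: "bounded_linear g" using bounded_linear_le_seminorm[OF sp g(1,3)] by blast
  have dd: "Blinfun g \<in> dual_domain"
    unfolding dual_domain_def using linear_le_seminorm_abs[OF sp g(1,3)]
    by (auto simp: bounded_linear_Blinfun_apply[OF bl] p_def intro!: exI[of _ "\<bar>C\<bar>"])
  moreover have "dual_map (Blinfun g) = f"
    using g(2) by (intro dual_map_eqI dd f(1)) (simp add: bounded_linear_Blinfun_apply[OF bl])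
  ultimately show ?thesis using that by blast
qed

sublocale dual: linear_presentation "dual_space Z" dual_domain dual_map
proof
  show "subspace dual_domain" by (rule subspace_dual_domain)
  show "dual_map ` dual_domain = vcarrier (dual_space Z)"
    using dual_map_in_carrier dual_map_onto by (metis (no_types, opaque_lifting) image_iff subsetI subset_antisym)
  show "dual_map (\<phi> + \<psi>) = vadd (dual_space Z) (dual_map \<phi>) (dual_map \<psi>)"
    if "\<phi> \<in> dual_domain" "\<psi> \<in> dual_domain" for \<phi> \<psi>
    using that dual_map_pi in_carrier
    by (intro dual_map_eqI subspace_add[OF subspace_dual_domain])
      (auto simp: dual_space_def blinfun.add_left)
  show "dual_map (c *\<^sub>R \<phi>) = vscale (dual_space Z) c (dual_map \<phi>)" if "\<phi> \<in> dual_domain" for c \<phi>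
    using that dual_map_pi in_carrier
    by (intro dual_map_eqI subspace_scale[OF subspace_dual_domain])
      (auto simp: dual_space_def blinfun.scaleR_left)
qed

lemma dual_norm_bdd: "\<phi> \<in> dual_domain \<Longrightarrow> bdd_above ((\<lambda>x. \<bar>\<phi> x\<bar>) ` {x \<in> S. \<nu> x \<le> 1})"
proof -
  assume "\<phi> \<in> dual_domain"
  then obtain C where C: "\<And>x. x \<in> S \<Longrightarrow> \<bar>\<phi> x\<bar> \<le> C * \<nu> x" unfolding dual_domain_def by blast
  have "\<bar>\<phi> x\<bar> \<le> \<bar>C\<bar>" if "x \<in> S" "\<nu> x \<le> 1" for x
  proof -
    have "\<bar>\<phi> x\<bar> \<le> \<bar>C\<bar> * \<nu> x"
      using C[OF that(1)] mult_right_mono[of C "\<bar>C\<bar>" "\<nu> x"] seminorm_nonneg[OF \<nu>, of x] by linarith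
    also have "\<dots> \<le> \<bar>C\<bar> * 1" using that by (intro mult_left_mono) auto
    finally show ?thesis by simp
  qed
  then show ?thesis by (auto intro!: bdd_aboveI2)
qed

lemma dual_norm_nonneg: "\<phi> \<in> dual_domain \<Longrightarrow> 0 \<le> dual_norm \<phi>"
  unfolding dual_norm_def
  using cSUP_upper[of 0 "{x \<in> S. \<nu> x \<le> 1}" "\<lambda>x. \<bar>\<phi> x\<bar>"] dual_norm_bdd subspace_0[OF S] seminorm_zero[OF \<nu>]
  by fastforce

lemma dual_norm_le_iff:
  assumes "\<phi> \<in> dual_domain" "C \<ge> 0"
  shows "dual_norm \<phi> \<le> C \<longleftrightarrow> (\<forall>x\<in>S. \<bar>\<phi> x\<bar> \<le> C * \<nu> x)"
proof
  assume le: "dual_norm \<phi> \<le> C"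
  show "\<forall>x\<in>S. \<bar>\<phi> x\<bar> \<le> C * \<nu> x"
  proof
    fix x assume x: "x \<in> S"
    \<comment> \<open>Normalising by some c above \<nu> x also covers \<nu> x = 0, which is possible
      for a seminorm.\<close>
    have "\<bar>\<phi> x\<bar> \<le> C * c" if "c > \<nu> x" for c
    proof -
      have c: "c > 0" using that seminorm_nonneg[OF \<nu>, of x] by linarith
      then have "\<nu> ((1 / c) *\<^sub>R x) \<le> 1" using that by (simp add: seminorm_scale[OF \<nu>])
      then have "\<bar>\<phi> ((1 / c) *\<^sub>R x)\<bar> \<le> dual_norm \<phi>"
        unfolding dual_norm_def using x subspace_scale[OF S]
        by (intro cSUP_upper dual_norm_bdd[OF assms(1)]) auto
      then have "\<bar>\<phi> x\<bar> \<le> dual_norm \<phi> * c"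
        using c by (simp add: blinfun.scaleR_right abs_mult divide_le_eq)
      also have "\<dots> \<le> C * c" using le c by (intro mult_right_mono) auto
      finally show ?thesis .
    qed
    then have "\<bar>\<phi> x\<bar> \<le> C * \<nu> x + e" if "e > 0" for e
    proof -
      have "\<bar>\<phi> x\<bar> \<le> C * (\<nu> x + e / (C + 1))"
        using that assms(2) \<open>\<And>c. c > \<nu> x \<Longrightarrow> \<bar>\<phi> x\<bar> \<le> C * c\<close>[of "\<nu> x + e / (C + 1)"] by simp
      also have "\<dots> \<le> C * \<nu> x + e" using that assms(2) by (simp add: field_simps)
      finally show ?thesis .
    qed
    then show "\<bar>\<phi> x\<bar> \<le> C * \<nu> x" by (rule field_le_epsilon)
  qed
next
  assume le: "\<forall>x\<in>S. \<bar>\<phi> x\<bar> \<le> C * \<nu> x"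
  have ne: "{x \<in> S. \<nu> x \<le> 1} \<noteq> {}" using subspace_0[OF S] seminorm_zero[OF \<nu>] by fastforce
  have "\<bar>\<phi> x\<bar> \<le> C" if "x \<in> S" "\<nu> x \<le> 1" for x
    using bspec[OF le that(1)] mult_left_mono[OF that(2) assms(2)] by simp
  then show "dual_norm \<phi> \<le> C" unfolding dual_norm_def by (intro cSUP_least[OF ne]) auto
qed

lemma less_dual_normE:
  assumes "\<phi> \<in> dual_domain" "c < dual_norm \<phi>"
  obtains x where "x \<in> S" "\<nu> x \<le> 1" "c < \<bar>\<phi> x\<bar>"
proof -
  have "{x \<in> S. \<nu> x \<le> 1} \<noteq> {}" using subspace_0[OF S] seminorm_zero[OF \<nu>] by fastforce
  then show ?thesis
    using assms(2) less_cSUP_iff[OF _ dual_norm_bdd[OF assms(1)]] that unfolding dual_norm_def by blast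
qed

lemma dual_norm_bound: "\<phi> \<in> dual_domain \<Longrightarrow> x \<in> S \<Longrightarrow> \<bar>\<phi> x\<bar> \<le> dual_norm \<phi> * \<nu> x"
  using dual_norm_le_iff[of \<phi> "dual_norm \<phi>"] dual_norm_nonneg by simp

lemma dual_norm_add:
  assumes "\<phi> \<in> dual_domain" "\<psi> \<in> dual_domain"
  shows "dual_norm (\<phi> + \<psi>) \<le> dual_norm \<phi> + dual_norm \<psi>"
proof -
  have "\<forall>x\<in>S. \<bar>(\<phi> + \<psi>) x\<bar> \<le> (dual_norm \<phi> + dual_norm \<psi>) * \<nu> x"
  proof
    fix x assume "x \<in> S"
    then show "\<bar>(\<phi> + \<psi>) x\<bar> \<le> (dual_norm \<phi> + dual_norm \<psi>) * \<nu> x"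
      using dual_norm_bound[OF assms(1), of x] dual_norm_bound[OF assms(2), of x]
      by (simp add: blinfun.add_left distrib_right)
  qed
  then show ?thesis
    using assms dual_norm_nonneg dual_norm_le_iff[OF subspace_add[OF subspace_dual_domain assms]] by simp
qed

lemma dual_norm_scale:
  assumes "\<phi> \<in> dual_domain"
  shows "dual_norm (c *\<^sub>R \<phi>) = \<bar>c\<bar> * dual_norm \<phi>"
proof -
  have le: "dual_norm (c *\<^sub>R \<phi>) \<le> \<bar>c\<bar> * dual_norm \<phi>" if "\<phi> \<in> dual_domain" for c \<phi>
    using that dual_norm_nonneg[OF that] dual_norm_bound[OF that] subspace_scale[OF subspace_dual_domain that]
    by (subst dual_norm_le_iff) (auto simp: blinfun.scaleR_left abs_mult mult.assoc intro!: mult_left_mono)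
  show ?thesis
  proof (cases "c = 0")
    case True
    then show ?thesis using le[OF assms, of 0] dual_norm_nonneg[OF subspace_scale[OF subspace_dual_domain assms, of 0]] by simp
  next
    case False
    have "dual_norm \<phi> \<le> \<bar>1 / c\<bar> * dual_norm (c *\<^sub>R \<phi>)"
      using le[OF subspace_scale[OF subspace_dual_domain assms, of c], of "1 / c"] False by simp
    then have "\<bar>c\<bar> * dual_norm \<phi> \<le> dual_norm (c *\<^sub>R \<phi>)" using False by (simp add: field_simps)
    then show ?thesis using le[OF assms, of c] by simp
  qed
qed

text \<open>\<open>finite_kernel_projection\<close> with the roles exchanged: the vectors are
  functionals, the functionals are evaluations at points of \<open>S\<close>. All members of
  \<open>V\<close> are interpolated on \<open>F\<close> from their values at the \<open>z i\<close>
  by members \<open>h i\<close> of \<open>V\<close> itself.\<close>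

lemma evaluation_projection:
  assumes F: "finite F" "F \<subseteq> S" and V: "subspace V"
  obtains n :: nat and h :: "nat \<Rightarrow> 'a \<Rightarrow>\<^sub>L real" and z
  where "\<forall>i<n. h i \<in> V \<and> z i \<in> S" "\<forall>\<phi>\<in>V. \<forall>x\<in>F. \<phi> x = (\<Sum>i<n. \<phi> (z i) * h i x)"
proof -
  define ev where "ev = (\<lambda>x \<phi>. blinfun_apply \<phi> x :: real) ` S"
  have lin: "linear e" if "e \<in> ev" for e
    using that unfolding ev_def by (auto intro!: linearI simp: blinfun.add_left blinfun.scaleR_left)
  have comb: "(\<lambda>\<phi>. f \<phi> - c * g \<phi>) \<in> ev" if fg: "f \<in> ev" "g \<in> ev" for f g c
  proof -
    obtain x y where "x \<in> S" "y \<in> S" "f = (\<lambda>\<phi>. \<phi> x)" "g = (\<lambda>\<phi>. \<phi> y)" using fg unfolding ev_def by blast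
    then show ?thesis
      unfolding ev_def using subspace_diff[OF S _ subspace_scale[OF S]]
      by (intro image_eqI[of _ _ "x - c *\<^sub>R y"]) (auto simp: blinfun.diff_right blinfun.scaleR_right)
  qed
  have "finite ((\<lambda>x \<phi>. blinfun_apply \<phi> x :: real) ` F)" using F(1) by simp
  then obtain n :: nat and h e where
    he: "\<forall>i<n. h i \<in> V \<and> e i \<in> ev \<and> (\<forall>v\<in>V. (\<forall>\<phi>\<in>(\<lambda>x \<phi>. blinfun_apply \<phi> x) ` F. \<phi> v = 0) \<longrightarrow> e i v = 0)"
    and P0: "\<forall>v\<in>V. \<forall>\<phi>\<in>(\<lambda>x \<phi>. blinfun_apply \<phi> x) ` F. \<phi> (v - (\<Sum>i<n. e i v *\<^sub>R h i)) = 0"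
    by (rule finite_kernel_projection[OF _ V _ lin comb]) (use F(2) in \<open>auto simp: ev_def\<close>)
  then have "\<forall>i<n. \<exists>z\<in>S. e i = (\<lambda>\<phi>. \<phi> z)" by (auto simp: ev_def)
  then obtain z where z: "\<And>i. i < n \<Longrightarrow> z i \<in> S \<and> e i = (\<lambda>\<phi>. \<phi> (z i))" by metis
  have "\<phi> x = (\<Sum>i<n. \<phi> (z i) * h i x)" if "\<phi> \<in> V" "x \<in> F" for \<phi> x
  proof -
    have "\<phi> x = (\<Sum>i<n. e i \<phi> * h i x)"
      using bspec[OF bspec[OF P0 that(1)] imageI[OF that(2)]]
      by (simp add: blinfun.diff_left blinfun.sum_left blinfun.scaleR_left)
    then show ?thesis using z by simp
  qed
  then show ?thesis using he z by (intro that[of n h z]) blast+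
qed

end

section \<open>From moduli to flatness\<close>

context normed_presentation
begin

section \<open>Closed subspaces as kernels, and flatness from uniform smoothness\<close>

definition norm_dist :: "'v \<Rightarrow> 'v \<Rightarrow> real" where
  "norm_dist x y = (if x \<in> vcarrier Z \<and> y \<in> vcarrier Z then vnorm Z (vadd Z x (vscale Z (-1) y)) else 0)"

lemma norm_topology_eq: "norm_topology Z = Metric_space.mtopology (vcarrier Z) norm_dist"
  by (simp add: norm_topology_def norm_dist_def[abs_def])

lemma norm_dist_pi: "a \<in> S \<Longrightarrow> b \<in> S \<Longrightarrow> norm_dist (\<pi> a) (\<pi> b) = \<nu> (a - b)"
  using in_carrier vnorm_pi[of "a - b"] subspace_diff[OF S] pi_diff by (simp add: norm_dist_def)

lemma Metric_space_norm_dist: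
  assumes definite: "\<forall>x\<in>S. \<nu> x = 0 \<longrightarrow> \<pi> x = \<pi> 0"
  shows "Metric_space (vcarrier Z) norm_dist"
proof
  have ex: "\<exists>a\<in>S. z = \<pi> a" if "z \<in> vcarrier Z" for z using that onto by blast
  show "0 \<le> norm_dist x y" for x y
  proof (cases "x \<in> vcarrier Z \<and> y \<in> vcarrier Z")
    case True
    then obtain a b where "a \<in> S" "b \<in> S" "x = \<pi> a" "y = \<pi> b" using ex by blast
    then show ?thesis using norm_dist_pi[of a b] seminorm_nonneg[OF \<nu>] by simp
  qed (auto simp: norm_dist_def)
  show "norm_dist x y = norm_dist y x" for x y
  proof (cases "x \<in> vcarrier Z \<and> y \<in> vcarrier Z")
    case True
    then obtain a b where "a \<in> S" "b \<in> S" "x = \<pi> a" "y = \<pi> b" using ex by blast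
    then show ?thesis
      using norm_dist_pi[of a b] norm_dist_pi[of b a] seminorm_minus[OF \<nu>, of "a - b"] by simp
  qed (auto simp: norm_dist_def)
  show "norm_dist x y = 0 \<longleftrightarrow> x = y" if xy: "x \<in> vcarrier Z" "y \<in> vcarrier Z" for x y
  proof -
    obtain a b where ab: "a \<in> S" "b \<in> S" "x = \<pi> a" "y = \<pi> b" using ex[OF xy(1)] ex[OF xy(2)] by blast
    have "\<pi> a = \<pi> b" if "\<nu> (a - b) = 0"
    proof -
      have "\<pi> (a - b) = \<pi> 0" using definite subspace_diff[OF S ab(1,2)] that by blast
      then have "\<pi> ((a - b) + b) = \<pi> (0 + b)"
        using pi_add[OF subspace_diff[OF S ab(1,2)] ab(2)] pi_add[OF subspace_0[OF S] ab(2)] by simp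
      then show ?thesis by simp
    qed
    then show ?thesis using norm_dist_pi[OF ab(1,2)] ab(3,4) pi_eq_imp[OF ab(1,2)] by auto
  qed
  show "norm_dist x z \<le> norm_dist x y + norm_dist y z"
    if xyz: "x \<in> vcarrier Z" "y \<in> vcarrier Z" "z \<in> vcarrier Z" for x y z
  proof -
    obtain a b c where "a \<in> S" "b \<in> S" "c \<in> S" "x = \<pi> a" "y = \<pi> b" "z = \<pi> c"
      using ex[OF xyz(1)] ex[OF xyz(2)] ex[OF xyz(3)] by blast
    then show ?thesis
      using norm_dist_pi[of a b] norm_dist_pi[of b c] norm_dist_pi[of a c] seminorm_add[OF \<nu>, of "a - b" "b - c"]
      by simp
  qed
qed

text \<open>A point off a closed \<open>W\<close> has positive \<nu>-distance from it. A functional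
  attaining the distance seminorm at that point vanishes on the preimage of \<open>W\<close> and is
  bounded on the type; by finite codimension finitely many of these suffice.\<close>

lemma eventually_in_closed_finite_codim:
  assumes definite: "\<forall>x\<in>S. \<nu> x = 0 \<longrightarrow> \<pi> x = \<pi> 0"
    and W: "finite_codim Z W" "closedin (norm_topology Z) W"
  shows "\<forall>\<^sub>F y in finite_codim_filter. y \<in> S \<longrightarrow> \<pi> y \<in> W"
proof -
  interpret M: Metric_space "vcarrier Z" norm_dist by (rule Metric_space_norm_dist[OF definite])
  have lW: "linear_subspace Z W" using W(1) by (simp add: finite_codim_def)
  let ?E = "preimage W"
  note sE = subspace_preimage[OF lW]
  define q where "q = quotient_seminorm \<nu> ?E"
  have sq: "seminorm q" unfolding q_def by (rule seminorm_quotient[OF \<nu> sE])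
  have q_le: "q x \<le> K * norm x" for x
    using quotient_seminorm_le_self[OF \<nu> sE, of x] \<nu>_le[of x] by (simp add: q_def)
  have sep: "\<exists>e\<in>{e. bounded_linear e}. (\<forall>x\<in>?E. e x = 0) \<and> e f \<noteq> (0::real)" if f: "f \<in> S" "f \<notin> ?E" for f
  proof -
    have "\<pi> f \<in> vcarrier Z - W" using f in_carrier by (auto simp: preimage_def)
    then obtain r where r: "r > 0" "disjnt W (M.mball (\<pi> f) r)"
      using W(2) unfolding norm_topology_eq M.closedin_metric by blast
    have "r \<le> \<nu> (f - w)" if "w \<in> ?E" for w
    proof -
      have w: "w \<in> S" "\<pi> w \<in> W" using that by (auto simp: preimage_def)
      then have "\<not> norm_dist (\<pi> f) (\<pi> w) < r"
        using r(2) f(1) in_carrier unfolding disjnt_def M.mball_def by blast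
      then show ?thesis using norm_dist_pi[OF f(1) w(1)] by linarith
    qed
    then have "q f \<ge> r" unfolding q_def by (rule quotient_seminorm_greatest[OF \<nu> sE])
    moreover obtain g where g: "linear g" "\<And>z. g z \<le> q z" "g f = q f"
      using Hahn_Banach_supporting[OF seminorm_imp_sublinear[OF sq], of f] by blast
    moreover have "g x = 0" if "x \<in> ?E" for x
      using linear_le_seminorm_abs[OF sq g(1,2), of x] quotient_seminorm_eq_0[OF \<nu> sE that] by (simp add: q_def)
    ultimately show ?thesis using r(1) bounded_linear_le_seminorm[OF sq g(1,2) q_le] by auto
  qed
  obtain G where "finite G" "S \<subseteq> span (?E \<union> G)" using W(1) finite_codim_iff[OF lW] by blast
  then obtain \<Phi> where \<Phi>: "finite \<Phi>" "\<Phi> \<subseteq> {e. bounded_linear e}" "\<And>f. f \<in> S \<Longrightarrow> \<forall>e\<in>\<Phi>. e f = (0::real) \<Longrightarrow> f \<in> ?E"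
    using finite_separating_family[OF _ preimage_subset _ sE S _ sep] by (metis bounded_linear.linear mem_Collect_eq)
  then show ?thesis
    unfolding eventually_finite_codim by (intro exI[of _ \<Phi>]) (auto simp: preimage_def)
qed

text \<open>A single t with modulus below t/L suffices, with threshold 1/t: at a vector of norm at
  least 1/t a unit move has relative size at most t, and by convexity the slope bound found at t
  holds for all smaller sizes.\<close>

lemma aus_imp_flat:
  assumes definite: "\<forall>x\<in>S. \<nu> x = 0 \<longrightarrow> \<pi> x = \<pi> 0"
    and aus: "asymptotically_uniformly_smooth Z" and L: "L > 0"
  shows "\<exists>R\<ge>1. flat \<nu> S R (1 / L)"
proof -
  have "\<forall>\<^sub>F t in at_right 0. aus_modulus Z t / ennreal t < ennreal (1 / L)"
    using aus L unfolding asymptotically_uniformly_smooth_def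
    by (intro order_tendstoD(2)) (auto simp: ennreal_zero_less_divide)
  moreover have "\<forall>\<^sub>F t in at_right 0. t \<in> {0<..<1::real}" by (rule eventually_at_right_field[THEN iffD2]) (auto intro: exI[of _ 1])
  ultimately obtain t where t: "aus_modulus Z t / ennreal t < ennreal (1 / L)" "0 < t" "t < 1"
    by (metis (mono_tags, lifting) eventually_conj eventually_happens' greaterThanLessThan_iff trivial_limit_at_right_real)
  then have t': "aus_modulus Z t < ennreal (t / L)"
    using L by (subst (asm) divide_less_ennreal) (auto simp: mult.commute simp flip: ennreal_mult)
  have sphere: "\<forall>\<^sub>F y in finite_codim_filter. y \<in> S \<and> \<nu> y = 1 \<longrightarrow> \<nu> (x + t *\<^sub>R y) \<le> 1 + t / L"
    if x: "x \<in> S" "\<nu> x = 1" for x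
  proof -
    have "\<pi> x \<in> unit_sphere Z (vcarrier Z)" using x in_carrier vnorm_pi by (simp add: unit_sphere_def)
    then have "(INF W\<in>{W. finite_codim Z W \<and> closedin (norm_topology Z) W}.
        SUP y\<in>unit_sphere Z W. ennreal (vnorm Z (vadd Z (\<pi> x) (vscale Z t y)) - 1)) < ennreal (t / L)"
      using t' unfolding aus_modulus_def by (meson SUP_upper order_le_less_trans)
    then obtain W where W: "finite_codim Z W" "closedin (norm_topology Z) W"
      "(SUP y\<in>unit_sphere Z W. ennreal (vnorm Z (vadd Z (\<pi> x) (vscale Z t y)) - 1)) < ennreal (t / L)"
      unfolding INF_less_iff by blast
    show ?thesis
      using eventually_in_closed_finite_codim[OF definite W(1,2)]
    proof eventually_elim
      case (elim y)
      show ?case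
      proof
        assume y: "y \<in> S \<and> \<nu> y = 1"
        then have "\<pi> y \<in> unit_sphere Z W" using elim vnorm_pi by (simp add: unit_sphere_def)
        then have "ennreal (vnorm Z (vadd Z (\<pi> x) (vscale Z t (\<pi> y))) - 1) < ennreal (t / L)"
          using W(3) by (meson SUP_upper order_le_less_trans)
        moreover have "vnorm Z (vadd Z (\<pi> x) (vscale Z t (\<pi> y))) = \<nu> (x + t *\<^sub>R y)"
          using x y vnorm_pi[of "x + t *\<^sub>R y"] subspace_add[OF S, of x "t *\<^sub>R y"] subspace_scale[OF S, of y t]
          by (simp flip: pi_add pi_scale)
        ultimately have "ennreal (\<nu> (x + t *\<^sub>R y) - 1) < ennreal (t / L)" by simp
        then show "\<nu> (x + t *\<^sub>R y) \<le> 1 + t / L"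
          using divide_pos_pos[OF t(2) L] by (cases "\<nu> (x + t *\<^sub>R y) \<ge> 1") (auto simp: ennreal_less_iff)
      qed
    qed
  qed
  show ?thesis
    unfolding flat_def
  proof (intro exI[of _ "1 / t"] conjI ballI impI)
    show "1 \<le> 1 / t" using t by simp
    fix x assume x: "x \<in> S" "1 / t \<le> \<nu> x"
    define r where "r = \<nu> x"
    have r: "r > 0" "1 \<le> r * t" using x(2) t by (auto simp: r_def field_simps intro: less_le_trans[of 0 "1 / t"])
    define x' where "x' = (1 / r) *\<^sub>R x"
    have x': "x' \<in> S" "\<nu> x' = 1" "x = r *\<^sub>R x'"
      using x(1) r(1) subspace_scale[OF S] by (auto simp: x'_def seminorm_scale[OF \<nu>] r_def)
    \<comment> \<open>The modulus speaks of unit vectors, flatness of all vectors of norm at most 1.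
      A kernel contains all multiples of y, so one subspace serves for every c.\<close>
    have "\<forall>\<^sub>F y in finite_codim_filter. \<forall>c. c *\<^sub>R y \<in> S \<and> \<nu> (c *\<^sub>R y) = 1 \<longrightarrow> \<nu> (x' + t *\<^sub>R c *\<^sub>R y) \<le> 1 + t / L"
    proof -
      obtain \<Phi> where \<Phi>: "finite \<Phi>" "\<forall>\<phi>\<in>\<Phi>. bounded_linear \<phi>"
        and \<Phi>0: "\<forall>y. (\<forall>\<phi>\<in>\<Phi>. \<phi> y = (0::real)) \<longrightarrow> y \<in> S \<and> \<nu> y = 1 \<longrightarrow> \<nu> (x' + t *\<^sub>R y) \<le> 1 + t / L"
        using sphere[OF x'(1,2), unfolded eventually_finite_codim] by (elim exE conjE)
      have "\<forall>\<phi>\<in>\<Phi>. \<phi> (c *\<^sub>R y) = 0" if "\<forall>\<phi>\<in>\<Phi>. \<phi> y = 0" for c y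
      proof
        fix \<phi> assume "\<phi> \<in> \<Phi>"
        then have "linear \<phi>" "\<phi> y = 0" using \<Phi>(2) that bounded_linear.linear by blast+
        then show "\<phi> (c *\<^sub>R y) = 0" by (simp add: linear_scale)
      qed
      then show ?thesis unfolding eventually_finite_codim using \<Phi> \<Phi>0 by (intro exI[of _ \<Phi>]) blast
    qed
    then show "\<forall>\<^sub>F y in finite_codim_filter. y \<in> S \<and> \<nu> y \<le> 1 \<longrightarrow> \<nu> (x + y) \<le> \<nu> x + 1 / L"
    proof eventually_elim
      case (elim y)
      show ?case
      proof
        assume y: "y \<in> S \<and> \<nu> y \<le> 1"
        define s where "s = \<nu> y"
        have s: "0 \<le> s" "s \<le> 1" using y seminorm_nonneg[OF \<nu>] by (auto simp: s_def)
        show "\<nu> (x + y) \<le> \<nu> x + 1 / L"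
        proof (cases "s = 0")
          case True
          then have "\<nu> (x + y) \<le> \<nu> x" using seminorm_add[OF \<nu>, of x y] by (simp add: s_def)
          moreover have "1 / L > 0" using L by simp
          ultimately show ?thesis by linarith
        next
          case False
          then have s0: "s > 0" using s by simp
          \<comment> \<open>k places x + y on the segment from x to r times the test point of size
            t; it is at most 1 because s \<le> 1 \<le> r t.\<close>
          define k where "k = s / (r * t)"
          have k: "0 \<le> k" "k \<le> 1" unfolding k_def using s r by (auto simp: divide_le_eq)
          have bound: "\<nu> (x' + t *\<^sub>R (1 / s) *\<^sub>R y) \<le> 1 + t / L"
            using elim y s0 subspace_scale[OF S, of y "1 / s"] by (auto simp: seminorm_scale[OF \<nu>] s_def)
          have "x + y = r *\<^sub>R ((1 - k) *\<^sub>R x' + k *\<^sub>R (x' + t *\<^sub>R (1 / s) *\<^sub>R y))"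
          proof -
            have "r * (k * (t * (1 / s))) = 1" unfolding k_def using r s0 t(2) by (simp add: field_simps)
            moreover have "r *\<^sub>R ((1 - k) *\<^sub>R x' + k *\<^sub>R (x' + t *\<^sub>R (1 / s) *\<^sub>R y))
                = r *\<^sub>R x' + (r * (k * (t * (1 / s)))) *\<^sub>R y"
              by (simp add: algebra_simps)
            ultimately show ?thesis using x'(3) by (simp only: scaleR_one)
          qed
          then have "\<nu> (x + y) = r * \<nu> ((1 - k) *\<^sub>R x' + k *\<^sub>R (x' + t *\<^sub>R (1 / s) *\<^sub>R y))"
            using r(1) by (simp only: seminorm_scale[OF \<nu>] abs_of_pos)
          also have "\<dots> \<le> r * ((1 - k) * 1 + k * (1 + t / L))"
          proof (rule mult_left_mono)
            have "\<nu> ((1 - k) *\<^sub>R x' + k *\<^sub>R (x' + t *\<^sub>R (1 / s) *\<^sub>R y))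
                \<le> (1 - k) * \<nu> x' + k * \<nu> (x' + t *\<^sub>R (1 / s) *\<^sub>R y)"
              using seminorm_add[OF \<nu>, of "(1 - k) *\<^sub>R x'" "k *\<^sub>R (x' + t *\<^sub>R (1 / s) *\<^sub>R y)"] k
              by (simp only: seminorm_scale[OF \<nu>] abs_of_nonneg diff_ge_0_iff_ge)
            also have "\<dots> \<le> (1 - k) * 1 + k * (1 + t / L)"
              using bound k x'(2) by (intro add_mono mult_left_mono) auto
            finally show "\<nu> ((1 - k) *\<^sub>R x' + k *\<^sub>R (x' + t *\<^sub>R (1 / s) *\<^sub>R y)) \<le> (1 - k) * 1 + k * (1 + t / L)" .
          qed (use r in simp)
          also have "\<dots> = r + s / L" unfolding k_def using r t(2) L by (simp add: field_simps)
          also have "\<dots> \<le> \<nu> x + 1 / L" using s L by (simp add: r_def divide_right_mono)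
          finally show ?thesis .
        qed
      qed
    qed
  qed
qed

text \<open>A bipolar argument. Around a functional f off \<open>E\<close>, a basic weak*
  neighbourhood missing \<open>E\<close> constrains values at finitely many points \<open>F\<close>
  only. Interpolating f on \<open>F\<close> by members of \<open>E\<close> must therefore fail at
  some x0, and the failure yields a point of \<open>S\<close> killed by \<open>E\<close> but not by
  f. Evaluations at such points separate, and finitely many of them cut out
  \<open>E\<close>.\<close>

lemma weak_star_closed_contains_annihilator:
  assumes E: "finite_codim (dual_space Z) E" "closedin (weak_star_topology Z) E"
  obtains F where "finite F" "F \<subseteq> S"
    "\<And>\<phi>. \<phi> \<in> dual_domain \<Longrightarrow> (\<forall>x\<in>F. \<phi> x = 0) \<Longrightarrow> dual_map \<phi> \<in> E"
proof -
  have lE: "linear_subspace (dual_space Z) E" using E(1) by (simp add: finite_codim_def)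
  let ?E = "dual.preimage E"
  note sE = dual.subspace_preimage[OF lE]
  define ev where "ev = (\<lambda>x \<phi>. blinfun_apply \<phi> x :: real) ` S"
  have lin_ev: "linear e" if "e \<in> ev" for e
    using that unfolding ev_def by (auto intro!: linearI simp: blinfun.add_left blinfun.scaleR_left)
  have sep: "\<exists>e\<in>ev. (\<forall>\<phi>\<in>?E. e \<phi> = 0) \<and> e f \<noteq> 0" if f: "f \<in> dual_domain" "f \<notin> ?E" for f
  proof -
    have top: "topspace (weak_star_topology Z) = vcarrier (dual_space Z)"
      unfolding weak_star_topology_def by (auto simp: dual_space_def PiE_iff extensional_def)
    have "openin (weak_star_topology Z) (vcarrier (dual_space Z) - E)"
      using E(2) top by (metis closedin_def)
    then obtain U where U: "openin (product_topology (\<lambda>_. euclidean) (vcarrier Z)) U"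
      "vcarrier (dual_space Z) - E = U \<inter> vcarrier (dual_space Z)"
      unfolding weak_star_topology_def openin_subtopology by blast
    have "dual_map f \<in> vcarrier (dual_space Z) - E"
      using f dual_map_in_carrier[OF f(1)] by (simp add: dual.preimage_def)
    then have "dual_map f \<in> U" using U(2) by blast
    from bspec[OF iffD1[OF openin_product_topology_alt U(1)] this] obtain V where V: "finite {z \<in> vcarrier Z. V z \<noteq> UNIV}" "dual_map f \<in> Pi\<^sub>E (vcarrier Z) V"
      "Pi\<^sub>E (vcarrier Z) V \<subseteq> U"
      unfolding topspace_euclidean by (elim exE conjE)
    have "{z \<in> vcarrier Z. V z \<noteq> UNIV} \<subseteq> \<pi> ` S" unfolding onto by (rule Collect_subset)
    from finite_subset_image[OF V(1) this]
    obtain F where F: "F \<subseteq> S" "finite F" "{z \<in> vcarrier Z. V z \<noteq> UNIV} = \<pi> ` F"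
      by (elim exE conjE)
    have agree: "g \<notin> ?E" if g: "g \<in> dual_domain" "\<And>x. x \<in> F \<Longrightarrow> g x = f x" for g
    proof -
      have "dual_map g z \<in> V z" if z: "z \<in> vcarrier Z" for z
      proof (cases "V z = UNIV")
        case False
        then obtain x where x: "x \<in> F" "z = \<pi> x" using F(3) z by blast
        then have "dual_map g z = dual_map f z"
          using dual_map_pi[OF g(1)] dual_map_pi[OF f(1)] g(2) F(1) by auto
        then show ?thesis using V(2) that by auto
      qed simp
      then have "dual_map g \<in> Pi\<^sub>E (vcarrier Z) V" by (auto simp: PiE_iff dual_map_def)
      then have "dual_map g \<in> U \<inter> vcarrier (dual_space Z)" using V(3) dual_map_in_carrier[OF g(1)] by blast
      then show ?thesis using U(2) by (auto simp: dual.preimage_def)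
    qed
    obtain n :: nat and h and z where hz: "\<forall>i<n. h i \<in> ?E \<and> z i \<in> S"
      and P0: "\<forall>\<phi>\<in>?E. \<forall>x\<in>F. \<phi> x = (\<Sum>i<n. \<phi> (z i) * h i x)"
      by (rule evaluation_projection[OF F(2,1) sE]) blast
    have "(\<Sum>i<n. f (z i) *\<^sub>R h i) \<in> ?E" using hz by (intro subspace_sum subspace_scale sE) auto
    then obtain x0 where x0: "x0 \<in> F" "(\<Sum>i<n. f (z i) *\<^sub>R h i) x0 \<noteq> f x0"
      using agree[of "\<Sum>i<n. f (z i) *\<^sub>R h i"] subsetD[OF dual.preimage_subset] by blast
    \<comment> \<open>Evaluation at x1 is the interpolation error at x0: zero for members of
      \<open>E\<close>, nonzero for f.\<close>
    define x1 where "x1 = x0 - (\<Sum>i<n. h i x0 *\<^sub>R z i)"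
    have x1: "\<phi> x1 = \<phi> x0 - (\<Sum>i<n. \<phi> (z i) * h i x0)" for \<phi> :: "'a \<Rightarrow>\<^sub>L real"
      by (simp add: x1_def blinfun.diff_right blinfun.sum_right blinfun.scaleR_right mult.commute)
    have "x1 \<in> S"
      unfolding x1_def using hz x0(1) F(1) by (intro subspace_diff subspace_sum subspace_scale S) auto
    moreover have "f x1 \<noteq> 0" using x0(2) by (simp add: x1 blinfun.sum_left blinfun.scaleR_left)
    moreover have "\<forall>\<phi>\<in>?E. \<phi> x1 = 0" unfolding x1 using P0 x0(1) by simp
    ultimately show ?thesis unfolding ev_def by (intro bexI[of _ "\<lambda>\<phi>. blinfun_apply \<phi> x1"]) auto
  qed
  obtain G where "finite G" "dual_domain \<subseteq> span (?E \<union> G)" using E(1) dual.finite_codim_iff[OF lE] by blast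
  then obtain \<E>' where \<E>': "finite \<E>'" "\<E>' \<subseteq> ev" "\<And>f. f \<in> dual_domain \<Longrightarrow> (\<forall>e\<in>\<E>'. e f = 0) \<Longrightarrow> f \<in> ?E"
    using finite_separating_family[OF _ dual.preimage_subset _ sE subspace_dual_domain lin_ev sep] by metis
  obtain F where "F \<subseteq> S" "finite F" "\<E>' = (\<lambda>x \<phi>. blinfun_apply \<phi> x) ` F"
    using finite_subset_image[OF \<E>'(1) \<E>'(2)[unfolded ev_def]] by metis
  then show ?thesis using \<E>'(3) by (intro that[of F]) (auto simp: dual.preimage_def)
qed

lemma weak_star_auc_power_witness:
  assumes auc: "weak_star_auc_power Z c p" and "c > 0" and f: "f \<in> dual_domain" "dual_norm f = 1" and t: "0 < t" "t \<le> 1"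
  obtains F where "finite F" "F \<subseteq> S"
    "\<And>g. g \<in> dual_domain \<Longrightarrow> dual_norm g = 1 \<Longrightarrow> (\<forall>x\<in>F. g x = 0) \<Longrightarrow>
      1 + c / 2 * t powr p \<le> dual_norm (f + t *\<^sub>R g)"
proof -
  let ?D = "dual_space Z"
  have "dual_map f \<in> unit_sphere ?D (vcarrier ?D)"
    using f dual_map_in_carrier vnorm_dual_map by (simp add: unit_sphere_def)
  then have "weak_star_auc_modulus Z t \<le> (SUP E\<in>{E. finite_codim ?D E \<and> closedin (weak_star_topology Z) E}.
      INF g\<in>unit_sphere ?D E. ereal (vnorm ?D (vadd ?D (dual_map f) (vscale ?D t g)) - 1))"
    unfolding weak_star_auc_modulus_def Let_def by (rule INF_lower)
  \<comment> \<open>Halving c gives the strict inequality needed to pick an \<open>E\<close> below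
    the supremum.\<close>
  moreover have "ereal (c / 2 * t powr p) < ereal (c * t powr p)" using t \<open>c > 0\<close> by simp
  moreover have "ereal (c * t powr p) \<le> weak_star_auc_modulus Z t"
    using auc t by (simp add: weak_star_auc_power_def)
  ultimately have "ereal (c / 2 * t powr p) < (SUP E\<in>{E. finite_codim ?D E \<and> closedin (weak_star_topology Z) E}.
      INF g\<in>unit_sphere ?D E. ereal (vnorm ?D (vadd ?D (dual_map f) (vscale ?D t g)) - 1))"
    by order
  then obtain E where E: "finite_codim ?D E" "closedin (weak_star_topology Z) E"
    "ereal (c / 2 * t powr p) < (INF g\<in>unit_sphere ?D E. ereal (vnorm ?D (vadd ?D (dual_map f) (vscale ?D t g)) - 1))"
    unfolding less_SUP_iff by blast
  obtain F where F: "finite F" "F \<subseteq> S" "\<And>\<phi>. \<phi> \<in> dual_domain \<Longrightarrow> (\<forall>x\<in>F. \<phi> x = 0) \<Longrightarrow> dual_map \<phi> \<in> E"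
    using weak_star_closed_contains_annihilator[OF E(1,2)] by blast
  show ?thesis
  proof (rule that[OF F(1,2)])
    fix g assume g: "g \<in> dual_domain" "dual_norm g = 1" "\<forall>x\<in>F. g x = 0"
    then have "dual_map g \<in> unit_sphere ?D E" using F(3) vnorm_dual_map by (simp add: unit_sphere_def)
    then have "ereal (c / 2 * t powr p) < ereal (vnorm ?D (vadd ?D (dual_map f) (vscale ?D t (dual_map g))) - 1)"
      using E(3) by (meson INF_lower order_less_le_trans)
    moreover have "vnorm ?D (vadd ?D (dual_map f) (vscale ?D t (dual_map g))) = dual_norm (f + t *\<^sub>R g)"
      using f g subspace_scale[OF subspace_dual_domain, of g t] subspace_add[OF subspace_dual_domain, of f "t *\<^sub>R g"]
      by (simp add: vnorm_dual_map flip: dual.pi_add dual.pi_scale)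
    ultimately show "1 + c / 2 * t powr p \<le> dual_norm (f + t *\<^sub>R g)" by simp
  qed
qed

end

text \<open>Banach--Alaoglu in the product topology: the set is closed in the product of the compact
  intervals from -\<nu> z to \<nu> z.\<close>

lemma compact_linear_below_seminorm:
  fixes \<nu> :: "'b::real_vector \<Rightarrow> real"
  assumes \<nu>: "seminorm \<nu>"
  shows "compact {\<phi>. linear \<phi> \<and> (\<forall>z. \<phi> z \<le> \<nu> z)}" (is "compact ?B")
proof -
  have cont: "continuous_on UNIV (\<lambda>\<phi>::'b \<Rightarrow> real. \<phi> z)" for z
    by (rule continuous_on_product_coordinates)
  have "compactin (product_topology (\<lambda>_. euclidean) UNIV) (PiE UNIV (\<lambda>z. {- \<nu> z..\<nu> z}))"
    unfolding compactin_PiE by simp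
  then have "compact (PiE UNIV (\<lambda>z. {- \<nu> z..\<nu> z}))"
    by (simp add: euclidean_product_topology)
  moreover have "closed {\<phi>::'b \<Rightarrow> real. (\<forall>a b. \<phi> (a + b) = \<phi> a + \<phi> b) \<and> (\<forall>c a. \<phi> (c *\<^sub>R a) = c * \<phi> a)}"
    by (intro closed_Collect_conj closed_Collect_all closed_Collect_eq continuous_intros cont)
  ultimately have "compact (PiE UNIV (\<lambda>z. {- \<nu> z..\<nu> z}) \<inter>
      {\<phi>::'b \<Rightarrow> real. (\<forall>a b. \<phi> (a + b) = \<phi> a + \<phi> b) \<and> (\<forall>c a. \<phi> (c *\<^sub>R a) = c * \<phi> a)})"
    by (rule compact_Int_closed)
  also have "(PiE UNIV (\<lambda>z. {- \<nu> z..\<nu> z}) \<inter>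
      {\<phi>::'b \<Rightarrow> real. (\<forall>a b. \<phi> (a + b) = \<phi> a + \<phi> b) \<and> (\<forall>c a. \<phi> (c *\<^sub>R a) = c * \<phi> a)}) = ?B"
  proof -
    have "- \<nu> z \<le> \<phi> z" if "linear \<phi>" "\<forall>z. \<phi> z \<le> \<nu> z" for \<phi> :: "'b \<Rightarrow> real" and z
      using linear_le_seminorm_abs[OF \<nu> that(1), of z] that(2) by (simp add: abs_le_iff)
    then show ?thesis by (auto simp: linear_iff PiE_iff)
  qed
  finally show ?thesis .
qed

context normed_presentation
begin

lemma Blinfun_in_dual_domain:
  assumes "linear \<phi>" "\<And>z. \<phi> z \<le> \<nu> z"
  shows "Blinfun \<phi> \<in> dual_domain" "blinfun_apply (Blinfun \<phi>) = \<phi>" "dual_norm (Blinfun \<phi>) \<le> 1"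
proof -
  have bl: "bounded_linear \<phi>" by (rule bounded_linear_le_seminorm[OF \<nu> assms \<nu>_le])
  show eq: "blinfun_apply (Blinfun \<phi>) = \<phi>" by (rule bounded_linear_Blinfun_apply[OF bl])
  have abs: "\<bar>\<phi> x\<bar> \<le> 1 * \<nu> x" for x using linear_le_seminorm_abs[OF \<nu> assms] by simp
  show D: "Blinfun \<phi> \<in> dual_domain" unfolding dual_domain_def using abs by (auto simp: eq intro!: exI[of _ 1])
  show "dual_norm (Blinfun \<phi>) \<le> 1" using abs by (subst dual_norm_le_iff[OF D]) (auto simp: eq)
qed

text \<open>
  The modulus controls \<open>g\<close> of one fixed size \<open>t\<close>, with a subspace depending on \<open>t\<close>; convexity along the ray
  from \<open>f\<close> passes to all larger \<open>g\<close> in the same subspace.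
\<close>

lemma dual_norm_ge_of_annihilating:
  assumes f: "f \<in> dual_domain" "dual_norm f = m" "0 < m" "m \<le> 1"
    and g: "g \<in> dual_domain" "t < dual_norm g" and t: "0 < t"
    and step: "1 + d \<le> dual_norm ((1 / m) *\<^sub>R f + t *\<^sub>R (1 / dual_norm g) *\<^sub>R g)"
  shows "m + d / t * dual_norm g \<le> dual_norm (f + g)"
proof -
  define s where "s = dual_norm g"
  \<comment> \<open>With this k the point f/m + t g/s equals (1 - k) f/m + k (f + g)/m, so the bound
    at size t passes to f + g by the triangle inequality.\<close>
  define k where "k = t * m / s"
  have s: "0 < s" "t < s" using g t by (auto simp: s_def)
  have "t * m \<le> s" using mult_left_le[of m t] f t s by linarith
  then have k: "0 < k" "k \<le> 1" using f t s by (auto simp: k_def)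
  have sf: "(1 / m) *\<^sub>R f \<in> dual_domain" using subspace_scale[OF subspace_dual_domain f(1)] .
  have sfg: "f + g \<in> dual_domain" using subspace_add[OF subspace_dual_domain f(1) g(1)] .
  have "k / m = t / s" using f s by (simp add: k_def)
  moreover have "(1 - k) / m + k / m = 1 / m" by (simp add: add_divide_distrib[symmetric])
  ultimately have "(1 / m) *\<^sub>R f + t *\<^sub>R (1 / s) *\<^sub>R g = (1 - k) *\<^sub>R (1 / m) *\<^sub>R f + (k / m) *\<^sub>R (f + g)"
    by (simp add: scaleR_add_right algebra_simps flip: scaleR_add_left)
  then have "1 + d \<le> dual_norm ((1 - k) *\<^sub>R (1 / m) *\<^sub>R f + (k / m) *\<^sub>R (f + g))"
    using step by (simp add: s_def)
  also have "\<dots> \<le> dual_norm ((1 - k) *\<^sub>R (1 / m) *\<^sub>R f) + dual_norm ((k / m) *\<^sub>R (f + g))"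
    by (intro dual_norm_add subspace_scale[OF subspace_dual_domain] sf sfg)
  also have "\<dots> = (1 - k) + k / m * dual_norm (f + g)"
    using k f sfg sf by (simp only: dual_norm_scale[OF sf] dual_norm_scale[OF sfg] dual_norm_scale[OF f(1)]) simp
  finally have "k + d \<le> k / m * dual_norm (f + g)" by simp
  then have "m / k * (k + d) \<le> m / k * (k / m * dual_norm (f + g))"
    using k f by (intro mult_left_mono) auto
  then show ?thesis using k f s t by (simp add: k_def s_def field_simps)
qed

text \<open>Let \<psi> attain \<nu> at x + y and be weak* close to some \<phi> with \<phi> y = 0.
  Their difference is a small part plus a part of norm \<tau> that annihilates the points
  \<open>F\<close> given by the modulus. The latter gains at most \<tau> on y. But \<psi> has norm
  at most 1, so if \<tau> exceeds \<epsilon> the modulus forces the norm of \<phi> below 1 by about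
  (c/2) \<epsilon>^(p-1) \<tau>, and \<phi> x below \<nu> x by \<nu> x times this. Above the
  threshold the loss outweighs the gain. Compactness of the dual ball leaves finitely many \<phi>,
  whose common kernel is the subspace sought.\<close>

theorem weak_star_auc_power_imp_flat:
  assumes auc: "weak_star_auc_power Z c p" and c: "c > 0" and L: "L \<ge> 1"
  shows "flat \<nu> S (2 / c * (2 * L) powr (p - 1) + 2) (1 / L)"
  unfolding flat_def
proof (intro ballI impI)
  fix x assume x: "x \<in> S" "2 / c * (2 * L) powr (p - 1) + 2 \<le> \<nu> x"
  define R where "R = \<nu> x"
  define \<epsilon> where "\<epsilon> = 1 / (2 * L)"
  \<comment> \<open>The small part g2 may change the values at x, of norm \<open>R\<close>, and at
    y, of norm at most 1, by \<epsilon> in total.\<close>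
  define \<sigma> where "\<sigma> = \<epsilon> / (R + 1)"
  define B where "B = {\<phi>. linear \<phi> \<and> (\<forall>z. \<phi> z \<le> \<nu> z)}"
  have Rpow: "2 / c * (2 * L) powr (p - 1) + 2 \<le> R" using x(2) by (simp add: R_def)
  moreover have "0 \<le> 2 / c * (2 * L) powr (p - 1)" using c by simp
  ultimately have R: "2 \<le> R" by linarith
  have \<epsilon>: "0 < \<epsilon>" "\<epsilon> \<le> 1" "2 * \<epsilon> = 1 / L" using L by (auto simp: \<epsilon>_def)
  have \<sigma>: "0 < \<sigma>" "\<sigma> * (R + 1) = \<epsilon>" using \<epsilon> R by (auto simp: \<sigma>_def)
  have near_linear: "\<exists>F s. finite F \<and> s > 0 \<and> (\<forall>\<psi>\<in>B. (\<forall>z\<in>F. \<bar>\<psi> z - \<phi> z\<bar> < s) \<longrightarrow>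
      (\<forall>y\<in>S. \<nu> y \<le> 1 \<longrightarrow> \<phi> y = 0 \<longrightarrow> \<psi> (x + y) \<le> R + 2 * \<epsilon>))" if "\<phi> \<in> B" for \<phi>
  \<comment> \<open>Here \<phi> may vanish on \<open>S\<close> and cannot be normalised, but \<psi>
    (x + y) is at most 2. The summand 2 of the threshold makes this at most
    \<open>R\<close>.\<close>
  proof (cases "\<phi> x \<le> 0")
    case True
    have "\<psi> (x + y) \<le> R + 2 * \<epsilon>" if "\<psi> \<in> B" "\<bar>\<psi> x - \<phi> x\<bar> < 1" "\<nu> y \<le> 1" for \<psi> y
    proof -
      have "linear \<psi>" "\<psi> y \<le> \<nu> y" using that(1) by (auto simp: B_def)
      then have "\<psi> (x + y) \<le> \<psi> x + 1" using that(3) by (simp add: linear_add)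
      then show ?thesis using that(2) True R \<epsilon> by linarith
    qed
    then show ?thesis by (intro exI[of _ "{x}"] exI[of _ 1]) auto
  next
    case False
    have \<phi>: "linear \<phi>" "\<And>z. \<phi> z \<le> \<nu> z" using \<open>\<phi> \<in> B\<close> by (auto simp: B_def)
    define f where "f = Blinfun \<phi>"
    define m where "m = dual_norm f"
    have f: "f \<in> dual_domain" "blinfun_apply f = \<phi>" "m \<le> 1"
      unfolding f_def m_def using Blinfun_in_dual_domain[OF \<phi>] by blast+
    have \<phi>x: "\<phi> x \<le> m * R" using dual_norm_bound[OF f(1) x(1)] f(2) by (simp add: m_def R_def)
    then have "0 < m * R" using False by linarith
    then have m: "0 < m" using R by (simp add: zero_less_mult_iff)
    have f1: "(1 / m) *\<^sub>R f \<in> dual_domain" "dual_norm ((1 / m) *\<^sub>R f) = 1"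
      using subspace_scale[OF subspace_dual_domain f(1)] m by (auto simp: dual_norm_scale[OF f(1)] m_def)
    obtain F where F: "finite F" "F \<subseteq> S"
      "\<And>g. g \<in> dual_domain \<Longrightarrow> dual_norm g = 1 \<Longrightarrow> (\<forall>x\<in>F. g x = 0) \<Longrightarrow>
        1 + c / 2 * \<epsilon> powr p \<le> dual_norm ((1 / m) *\<^sub>R f + \<epsilon> *\<^sub>R g)"
      using weak_star_auc_power_witness[OF auc c f1 \<epsilon>(1,2)] by metis
    \<comment> \<open>\<open>x\<close> joins \<open>F\<close> so that g1 vanishes at x too, and only
      the small part is seen there.\<close>
    obtain n :: nat and h z where hz: "\<forall>i<n. h i \<in> dual_domain \<and> z i \<in> S"
      and P0: "\<forall>\<phi>\<in>dual_domain. \<forall>w\<in>insert x F. \<phi> w = (\<Sum>i<n. \<phi> (z i) * h i w)"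
      by (rule evaluation_projection[of "insert x F", OF _ _ subspace_dual_domain]) (use F(1,2) x(1) in auto)
    define H where "H = (\<Sum>i<n. dual_norm (h i)) + 1"
    have hn: "0 \<le> dual_norm (h i)" if "i < n" for i using hz that dual_norm_nonneg by blast
    have H: "H > 0" unfolding H_def using hn by (intro add_nonneg_pos sum_nonneg) auto
    have "\<psi> (x + y) \<le> R + 2 * \<epsilon>"
      if \<psi>B: "\<psi> \<in> B" and near: "\<forall>w\<in>z ` {..<n}. \<bar>\<psi> w - \<phi> w\<bar> < \<sigma> / H"
        and y: "y \<in> S" "\<nu> y \<le> 1" "\<phi> y = 0" for \<psi> y
    proof -
      have \<psi>: "linear \<psi>" "\<And>z. \<psi> z \<le> \<nu> z" using \<psi>B by (auto simp: B_def)
      define q where "q = Blinfun \<psi>"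
      have q: "q \<in> dual_domain" "blinfun_apply q = \<psi>" "dual_norm q \<le> 1"
        unfolding q_def using Blinfun_in_dual_domain[OF \<psi>] by blast+
      define g where "g = q - f"
      have g: "g \<in> dual_domain" unfolding g_def using subspace_diff[OF subspace_dual_domain q(1) f(1)] .
      \<comment> \<open>The interpolant of g on \<open>insert x F\<close>. It is small because near
        \<phi> the values of g at the \<open>z i\<close> are at most \<sigma> / H, with
        \<open>H\<close> exceeding the total norm of the \<open>h i\<close>.\<close>
      define g2 where "g2 = (\<Sum>i<n. g (z i) *\<^sub>R h i)"
      define g1 where "g1 = g - g2"
      have g2: "g2 \<in> dual_domain"
        unfolding g2_def using hz by (intro subspace_sum subspace_scale subspace_dual_domain) auto
      have g1: "g1 \<in> dual_domain" unfolding g1_def using subspace_diff[OF subspace_dual_domain g g2] .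
      have g10: "g1 w = 0" if "w \<in> insert x F" for w using bspec[OF bspec[OF P0 g] that] by (simp add: g1_def g2_def blinfun.diff_left blinfun.sum_left blinfun.scaleR_left)
      have gz: "\<bar>g (z i)\<bar> \<le> \<sigma> / H" if "i < n" for i
        using near that q(2) f(2) by (auto simp: g_def blinfun.diff_left intro: less_imp_le)
      have "\<bar>g2 w\<bar> \<le> \<sigma> * \<nu> w" if w: "w \<in> S" for w
      proof -
        have "\<bar>g2 w\<bar> \<le> (\<Sum>i<n. \<bar>g (z i) * h i w\<bar>)"
          unfolding g2_def by (simp add: blinfun.sum_left blinfun.scaleR_left sum_abs)
        also have "\<dots> \<le> (\<Sum>i<n. \<sigma> / H * (dual_norm (h i) * \<nu> w))"
        proof (rule sum_mono)
          fix i assume "i \<in> {..<n}"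
          then have i: "i < n" by simp
          have "\<bar>h i w\<bar> \<le> dual_norm (h i) * \<nu> w" using hz i w dual_norm_bound by blast
          then show "\<bar>g (z i) * h i w\<bar> \<le> \<sigma> / H * (dual_norm (h i) * \<nu> w)"
            unfolding abs_mult using gz[OF i] \<sigma>(1) H by (intro mult_mono) auto
        qed
        also have "\<dots> = \<sigma> / H * ((H - 1) * \<nu> w)" by (simp add: H_def sum_distrib_left sum_distrib_right)
        also have "\<dots> \<le> \<sigma> / H * (H * \<nu> w)"
          using \<sigma>(1) H seminorm_nonneg[OF \<nu>, of w] by (intro mult_left_mono mult_right_mono) auto
        also have "\<dots> = \<sigma> * \<nu> w" using H by simp
        finally show ?thesis .
      qed
      then have g2_le: "dual_norm g2 \<le> \<sigma>" and g2_bound: "\<And>w. w \<in> S \<Longrightarrow> \<bar>g2 w\<bar> \<le> \<sigma> * \<nu> w"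
        using dual_norm_le_iff[OF g2, of \<sigma>] \<sigma>(1) by auto
      define \<tau> where "\<tau> = dual_norm g1"
      have split: "\<psi> (x + y) = \<phi> x + g2 x + g1 y + g2 y"
      proof -
        have "\<psi> w = \<phi> w + g1 w + g2 w" for w
          using q(2) f(2) by (simp add: g1_def g_def blinfun.diff_left)
        then show ?thesis using linear_add[OF \<psi>(1), of x y] g10[of x] y(3) by simp
      qed
      have "g2 x \<le> \<sigma> * R" using g2_bound[OF x(1)] by (simp add: R_def)
      moreover have "g1 y \<le> \<tau>"
        using dual_norm_bound[OF g1 y(1)] mult_left_mono[OF y(2) dual_norm_nonneg[OF g1]] by (simp add: \<tau>_def)
      moreover have "g2 y \<le> \<sigma> * 1"
        using order_trans[OF g2_bound[OF y(1)] mult_left_mono[OF y(2), of \<sigma>]] \<sigma>(1) by simp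
      ultimately have main: "\<psi> (x + y) \<le> \<phi> x + \<tau> + \<epsilon>"
        using split \<sigma>(2) by (simp add: algebra_simps)
      show ?thesis
      proof (cases "\<tau> \<le> \<epsilon>")
        case True
        have "m * R \<le> R" using f(3) R by (simp add: mult_left_le_one_le m less_imp_le)
        then show ?thesis using main \<phi>x True by linarith
      next
        case False
        then have \<tau>: "\<epsilon> < \<tau>" "0 < \<tau>" using \<epsilon> by auto
        have "1 + c / 2 * \<epsilon> powr p \<le> dual_norm ((1 / m) *\<^sub>R f + \<epsilon> *\<^sub>R (1 / dual_norm g1) *\<^sub>R g1)"
        proof (rule F(3))
          show "(1 / dual_norm g1) *\<^sub>R g1 \<in> dual_domain" by (rule subspace_scale[OF subspace_dual_domain g1])
          show "dual_norm ((1 / dual_norm g1) *\<^sub>R g1) = 1"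
            using \<tau> by (simp add: dual_norm_scale[OF g1] \<tau>_def)
          show "\<forall>w\<in>F. ((1 / dual_norm g1) *\<^sub>R g1) w = 0" using g10 by (simp add: blinfun.scaleR_left)
        qed
        then have "m + (c / 2 * \<epsilon> powr p) / \<epsilon> * \<tau> \<le> dual_norm (f + g1)"
          unfolding \<tau>_def
          by (rule dual_norm_ge_of_annihilating[OF f(1) m_def[symmetric] m f(3) g1 \<tau>(1)[unfolded \<tau>_def] \<epsilon>(1)])
        also have "f + g1 = q + - 1 *\<^sub>R g2" by (simp add: g1_def g_def)
        also have "dual_norm (q + - 1 *\<^sub>R g2) \<le> dual_norm q + dual_norm (- 1 *\<^sub>R g2)"
          by (intro dual_norm_add q(1) subspace_scale[OF subspace_dual_domain g2])
        also have "\<dots> \<le> 1 + \<sigma>" using q(3) g2_le dual_norm_scale[OF g2, of "- 1"] by (simp only: abs_minus_cancel abs_one mult_1_left add_mono)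
        finally have m_le: "m \<le> 1 + \<sigma> - (c / 2 * \<epsilon> powr p) / \<epsilon> * \<tau>" by simp
        \<comment> \<open>Origin of the threshold: R (c/2) \<epsilon>^(p-1) reaches 1 at R = (2/c)
          (2 L)^(p-1), as \<epsilon> = 1/(2 L).\<close>
        have "1 \<le> R * ((c / 2 * \<epsilon> powr p) / \<epsilon>)"
        proof -
          have "(c / 2 * \<epsilon> powr p) / \<epsilon> = c / 2 * \<epsilon> powr (p - 1)"
            using \<epsilon>(1) by (simp add: powr_diff)
          also have "\<epsilon> powr (p - 1) = 1 / (2 * L) powr (p - 1)"
            using L by (simp add: \<epsilon>_def powr_divide)
          finally have eq: "(c / 2 * \<epsilon> powr p) / \<epsilon> = c / 2 * (1 / (2 * L) powr (p - 1))" .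
          have "(2 * L) powr (p - 1) > 0" using L by simp
          then have "1 = (2 / c * (2 * L) powr (p - 1)) * (c / 2 * (1 / (2 * L) powr (p - 1)))"
            using c by simp
          also have "\<dots> \<le> R * (c / 2 * (1 / (2 * L) powr (p - 1)))"
            using Rpow c by (intro mult_right_mono) auto
          finally show ?thesis unfolding eq .
        qed
        from mult_right_mono[OF this, of \<tau>]
        have "\<tau> \<le> R * ((c / 2 * \<epsilon> powr p) / \<epsilon>) * \<tau>" using \<tau>(2) by simp
        moreover have "m * R \<le> (1 + \<sigma> - (c / 2 * \<epsilon> powr p) / \<epsilon> * \<tau>) * R"
          using m_le R by (intro mult_right_mono) auto
        ultimately have "m * R \<le> R + \<sigma> * R - \<tau>" by (simp add: algebra_simps)
        moreover have "\<sigma> * R \<le> \<epsilon>" using \<sigma> by (simp add: algebra_simps)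
        ultimately show ?thesis using main \<phi>x by linarith
      qed
    qed
    then show ?thesis using \<sigma>(1) H by (intro exI[of _ "z ` {..<n}"] exI[of _ "\<sigma> / H"]) auto
  qed
  then obtain F s where Fs: "\<And>\<phi>. \<phi> \<in> B \<Longrightarrow> finite (F \<phi>)" "\<And>\<phi>. \<phi> \<in> B \<Longrightarrow> s \<phi> > 0"
    "\<And>\<phi> \<psi> y. \<phi> \<in> B \<Longrightarrow> \<psi> \<in> B \<Longrightarrow> (\<forall>z\<in>F \<phi>. \<bar>\<psi> z - \<phi> z\<bar> < s \<phi>) \<Longrightarrow> y \<in> S \<Longrightarrow> \<nu> y \<le> 1 \<Longrightarrow> \<phi> y = 0 \<Longrightarrow>
      \<psi> (x + y) \<le> R + 2 * \<epsilon>"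
    by metis
  define O' where "O' \<phi> = {\<psi>. \<forall>z\<in>F \<phi>. \<bar>\<psi> z - \<phi> z\<bar> < s \<phi>}" for \<phi>
  have cont: "continuous_on UNIV (\<lambda>\<phi>::'a \<Rightarrow> real. \<phi> z)" for z
    by (rule continuous_on_product_coordinates)
  have "open (O' \<phi>)" if "\<phi> \<in> B" for \<phi>
  proof -
    have "O' \<phi> = (\<Inter>z\<in>F \<phi>. {\<psi>. \<bar>\<psi> z - \<phi> z\<bar> < s \<phi>})" by (auto simp: O'_def)
    moreover have "open {\<psi>::'a \<Rightarrow> real. \<bar>\<psi> z - \<phi> z\<bar> < s \<phi>}" for z
      by (intro open_Collect_less continuous_intros cont)
    ultimately show ?thesis using Fs(1)[OF that] by (auto intro: open_INT)
  qed
  moreover have "B \<subseteq> (\<Union>\<phi>\<in>B. O' \<phi>)" using Fs(2) by (force simp: O'_def)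
  moreover have "compact B" unfolding B_def by (rule compact_linear_below_seminorm[OF \<nu>])
  ultimately obtain T where T: "T \<subseteq> B" "finite T" "B \<subseteq> (\<Union>\<phi>\<in>T. O' \<phi>)"
    using compactE_image[of B B O'] by metis
  have "\<forall>\<phi>\<in>T. bounded_linear \<phi>"
    using T(1) bounded_linear_le_seminorm[OF \<nu> _ _ \<nu>_le] by (auto simp: B_def)
  moreover have "\<nu> (x + y) \<le> \<nu> x + 1 / L" if y: "\<forall>\<phi>\<in>T. \<phi> y = 0" "y \<in> S" "\<nu> y \<le> 1" for y
  proof -
    obtain \<psi> where \<psi>: "linear \<psi>" "\<And>z. \<psi> z \<le> \<nu> z" "\<psi> (x + y) = \<nu> (x + y)"
      using Hahn_Banach_supporting[OF seminorm_imp_sublinear[OF \<nu>], of "x + y"] by blast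
    then have "\<psi> \<in> B" by (simp add: B_def)
    then obtain \<phi> where \<phi>: "\<phi> \<in> T" "\<psi> \<in> O' \<phi>" using T(3) by blast
    have "\<psi> (x + y) \<le> R + 2 * \<epsilon>"
      using Fs(3)[of \<phi> \<psi> y] \<phi> T(1) \<open>\<psi> \<in> B\<close> y by (auto simp: O'_def)
    then show ?thesis using \<psi>(3) \<epsilon>(3) by (simp add: R_def)
  qed
  ultimately show "\<forall>\<^sub>F y in finite_codim_filter. y \<in> S \<and> \<nu> y \<le> 1 \<longrightarrow> \<nu> (x + y) \<le> \<nu> x + 1 / L"
    unfolding eventually_finite_codim using T(2) by (intro exI[of _ T]) blast
qed

end

section \<open>From flatness to moduli\<close>

context normed_presentation
begin

lemma annihilator_finite_codim_closed:
  assumes F: "finite F" "F \<subseteq> S"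
  defines "E \<equiv> dual_map ` {\<phi> \<in> dual_domain. \<forall>x\<in>F. \<phi> x = 0}"
  shows "finite_codim (dual_space Z) E" "closedin (weak_star_topology Z) E"
proof -
  define A where "A = {\<phi> \<in> dual_domain. \<forall>x\<in>F. blinfun_apply \<phi> x = 0}"
  have E: "E = dual_map ` A" by (simp add: E_def A_def)
  have sA: "subspace A" "A \<subseteq> dual_domain"
    unfolding A_def using subspace_dual_domain
    by (auto simp: subspace_def blinfun.add_left blinfun.scaleR_left)
  have lE: "linear_subspace (dual_space Z) E" unfolding E by (rule dual.linear_subspace_image[OF sA])
  obtain m :: nat and h z where hz: "\<forall>i<m. h i \<in> dual_domain \<and> z i \<in> S"
    and P0: "\<forall>\<phi>\<in>dual_domain. \<forall>x\<in>F. \<phi> x = (\<Sum>i<m. \<phi> (z i) * h i x)"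
    by (rule evaluation_projection[OF F subspace_dual_domain]) blast
  have "v \<in> span (dual.preimage E \<union> h ` {..<m})" if v: "v \<in> dual_domain" for v
  proof -
    define s where "s = (\<Sum>i<m. v (z i) *\<^sub>R h i)"
    have "s \<in> dual_domain" unfolding s_def using hz by (intro subspace_sum subspace_scale subspace_dual_domain) auto
    then have vs: "v - s \<in> dual_domain" using v subspace_diff[OF subspace_dual_domain] by blast
    then have "v - s \<in> A" using P0 v
      by (simp add: A_def s_def blinfun.diff_left blinfun.sum_left blinfun.scaleR_left)
    then have "v - s \<in> dual.preimage E" using vs by (auto simp: dual.preimage_def E)
    then have "v - s \<in> span (dual.preimage E \<union> h ` {..<m})" by (intro span_base) simp
    moreover have "s \<in> span (dual.preimage E \<union> h ` {..<m})"
      unfolding s_def by (intro span_sum span_scale span_base) auto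
    ultimately have "(v - s) + s \<in> span (dual.preimage E \<union> h ` {..<m})" by (rule span_add)
    then show ?thesis by simp
  qed
  then show "finite_codim (dual_space Z) E"
    unfolding dual.finite_codim_iff[OF lE] using hz by (intro exI[of _ "h ` {..<m}"]) auto
  let ?T = "weak_star_topology Z"
  have top: "topspace ?T = vcarrier (dual_space Z)"
    unfolding weak_star_topology_def by (auto simp: dual_space_def PiE_iff extensional_def)
  have "closedin ?T {f \<in> topspace ?T. f (\<pi> x) \<in> {0}}" if "x \<in> S" for x
  proof (rule closedin_continuous_map_preimage)
    show "continuous_map ?T euclideanreal (\<lambda>f. f (\<pi> x))"
      unfolding weak_star_topology_def using in_carrier[OF that]
      by (intro continuous_map_from_subtopology continuous_map_product_projection)
  qed simp
  \<comment> \<open>Inserting 0 keeps the intersection inside the space when \<open>F\<close> is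
    empty; it adds no condition, as functionals vanish at \<pi> 0.\<close>
  then have "closedin ?T (\<Inter>x\<in>insert 0 F. {f \<in> topspace ?T. f (\<pi> x) \<in> {0}})"
    using F(2) subspace_0[OF S] by (intro closedin_INT) auto
  also have "(\<Inter>x\<in>insert 0 F. {f \<in> topspace ?T. f (\<pi> x) \<in> {0}}) = E"
  proof (intro set_eqI iffI)
    fix f assume f: "f \<in> (\<Inter>x\<in>insert 0 F. {f \<in> topspace ?T. f (\<pi> x) \<in> {0}})"
    then obtain \<phi> where \<phi>: "\<phi> \<in> dual_domain" "dual_map \<phi> = f" using dual_map_onto top by auto
    then have "\<phi> x = 0" if "x \<in> F" for x using f that dual_map_pi[OF \<phi>(1), of x] F(2) by auto
    then show "f \<in> E" using \<phi> by (auto simp: E A_def)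
  next
    fix f assume "f \<in> E"
    then obtain \<phi> where \<phi>: "\<phi> \<in> dual_domain" "\<forall>x\<in>F. \<phi> x = 0" "f = dual_map \<phi>" by (auto simp: E A_def)
    have "dual_map \<phi> (\<pi> x) = 0" if "x \<in> insert 0 F" for x
      using that dual_map_pi[OF \<phi>(1), of x] F(2) subspace_0[OF S] \<phi>(2) by auto
    then show "f \<in> (\<Inter>x\<in>insert 0 F. {f \<in> topspace ?T. f (\<pi> x) \<in> {0}})"
      using dual_map_in_carrier[OF \<phi>(1)] \<phi>(3) top by auto
  qed
  finally show "closedin ?T E" .
qed

end

locale equivalent_seminorm =
  fixes n :: "'a::real_normed_vector \<Rightarrow> real" and A B :: real
  assumes n: "seminorm n" and n_ge: "\<And>x. A * norm x \<le> n x" and n_le: "\<And>x. n x \<le> B * norm x"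
    and A: "A > 0"
begin

sublocale normed_presentation "renorm (type_space :: 'a nspace) n" UNIV "\<lambda>x. x" n B
  by unfold_locales (auto simp: renorm_def type_space_def n n_le)

lemma kernel_finite_codim_closed:
  assumes \<Phi>: "finite \<Phi>" "\<forall>\<phi>\<in>\<Phi>. bounded_linear (\<phi> :: 'a \<Rightarrow> real)"
  defines "W \<equiv> {x. \<forall>\<phi>\<in>\<Phi>. \<phi> x = 0}"
  shows "finite_codim (renorm type_space n) W" "closedin (norm_topology (renorm type_space n)) W"
proof -
  have \<Phi>lin: "linear \<phi>" if "\<phi> \<in> \<Phi>" for \<phi> using \<Phi>(2) that bounded_linear.linear by blast
  have sW: "subspace W"
    unfolding W_def subspace_def using \<Phi>lin linear_0 linear_add linear_scale by fastforce
  then have lW: "linear_subspace (renorm type_space n) W"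
    using linear_subspace_image[of W] by simp
  have pW: "preimage W = W" by (simp add: preimage_def)
  obtain m :: nat and y and e :: "nat \<Rightarrow> 'a \<Rightarrow> real" where
    P0: "\<forall>v\<in>UNIV. \<forall>\<phi>\<in>\<Phi>. \<phi> (v - (\<Sum>i<m. e i v *\<^sub>R y i)) = 0"
    using finite_kernel_projection_bounded[OF \<Phi>(1) subspace_UNIV] \<Phi>(2) by metis
  have "v \<in> span (W \<union> y ` {..<m})" for v
  proof -
    define s where "s = (\<Sum>i<m. e i v *\<^sub>R y i)"
    have "v - s \<in> W" using P0 by (simp add: W_def s_def)
    then have "v - s \<in> span (W \<union> y ` {..<m})" by (intro span_base) simp
    moreover have "s \<in> span (W \<union> y ` {..<m})" unfolding s_def by (intro span_sum span_scale span_base) auto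
    ultimately have "(v - s) + s \<in> span (W \<union> y ` {..<m})" by (rule span_add)
    then show ?thesis by simp
  qed
  then show "finite_codim (renorm type_space n) W"
    unfolding finite_codim_iff[OF lW] pW by (intro exI[of _ "y ` {..<m}"]) auto
  have def: "\<forall>x\<in>UNIV. n x = 0 \<longrightarrow> x = 0"
    using n_ge A by (metis mult_le_0_iff norm_le_zero_iff not_less)
  have car: "vcarrier (renorm (type_space :: 'a nspace) n) = UNIV" by (simp add: renorm_def type_space_def)
  interpret M: Metric_space UNIV norm_dist
    using Metric_space_norm_dist[OF def] unfolding car .
  show "closedin (norm_topology (renorm type_space n)) W"
    unfolding norm_topology_eq car M.closedin_metric
  proof (intro conjI allI impI)
    fix x assume "x \<in> UNIV - W"
    then obtain \<phi> where \<phi>: "\<phi> \<in> \<Phi>" "\<phi> x \<noteq> 0" by (auto simp: W_def)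
    then have bl: "bounded_linear \<phi>" using \<Phi>(2) by blast
    define b where "b = onorm \<phi> + 1"
    have b: "b > 0" unfolding b_def using onorm_pos_le[OF bl] by linarith
    have "\<bar>\<phi> x\<bar> * A / b \<le> n (x - w)" if w: "w \<in> W" for w
    proof -
      have "\<phi> x = \<phi> (x - w)" using w \<phi>(1) \<Phi>lin[OF \<phi>(1)] by (simp add: W_def linear_diff)
      then have "\<bar>\<phi> x\<bar> \<le> onorm \<phi> * norm (x - w)" using onorm[OF bl, of "x - w"] by simp
      also have "\<dots> \<le> b * norm (x - w)" by (intro mult_right_mono) (auto simp: b_def)
      finally have "\<bar>\<phi> x\<bar> * A \<le> b * (A * norm (x - w))" using A by (simp add: mult_ac)
      also have "\<dots> \<le> b * n (x - w)" using n_ge[of "x - w"] b by (intro mult_left_mono) auto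
      finally show ?thesis using b by (simp add: divide_le_eq mult.commute)
    qed
    then have "disjnt W (M.mball x (\<bar>\<phi> x\<bar> * A / b))"
      using norm_dist_pi by (force simp: disjnt_iff)
    moreover have "\<bar>\<phi> x\<bar> * A / b > 0" using \<phi>(2) A b by simp
    ultimately show "\<exists>r>0. disjnt W (M.mball x r)" by blast
  qed simp
qed

text \<open>By convexity along rays, a bound at length \<open>t k\<close> gives the same slope for
  all shorter vectors, so one k with a small quotient controls an interval of s. The slack e is
  taken equal to \<open>\<eta> k\<close>.\<close>

lemma aus_of_scales:
  fixes t \<eta> :: "nat \<Rightarrow> real"
  assumes t: "\<And>k. t k > 0" and \<eta>: "\<And>k. \<eta> k > 0" and lim: "(\<lambda>k. \<eta> k / t k) \<longlonglongrightarrow> 0"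
    and scale: "\<And>k x e. n x \<le> 1 \<Longrightarrow> e > 0 \<Longrightarrow>
      \<forall>\<^sub>F y in finite_codim_filter. norm y \<le> t k \<longrightarrow> n (x + y) \<le> 1 + \<eta> k + e"
  shows "asymptotically_uniformly_smooth (renorm (type_space :: 'a nspace) n)"
  unfolding asymptotically_uniformly_smooth_def
proof (rule order_tendstoI)
  let ?Z = "renorm (type_space :: 'a nspace) n"
  fix a :: ennreal assume "a > 0"
  then obtain \<epsilon> where \<epsilon>: "\<epsilon> > 0" "ennreal \<epsilon> < a"
    by (metis dense ennreal_cases ennreal_less_zero_iff not_less_iff_gr_or_eq order_less_trans top.not_eq_extremum infinity_ennreal_def)
  have "\<forall>\<^sub>F k in sequentially. \<eta> k / t k < \<epsilon> * A / 2"
    using order_tendstoD(2)[OF lim, of "\<epsilon> * A / 2"] \<epsilon>(1) A by simp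
  then obtain k where k: "\<eta> k / t k < \<epsilon> * A / 2" by (auto simp: eventually_sequentially)
  have bound: "aus_modulus ?Z s \<le> ennreal (\<epsilon> * s)" if s: "0 < s" "s < t k * A" for s
    unfolding aus_modulus_def
  proof (rule SUP_least)
    fix x assume "x \<in> unit_sphere ?Z (vcarrier ?Z)"
    then have nx: "n x = 1" by (simp add: unit_sphere_def renorm_def)
    obtain \<Phi> where \<Phi>: "finite \<Phi>" "\<forall>\<phi>\<in>\<Phi>. bounded_linear \<phi>"
      and \<Phi>0: "\<forall>y. (\<forall>\<phi>\<in>\<Phi>. \<phi> y = (0::real)) \<longrightarrow> norm y \<le> t k \<longrightarrow> n (x + y) \<le> 1 + \<eta> k + \<eta> k"
      using scale[of x "\<eta> k" k, unfolded eventually_finite_codim] nx \<eta> by auto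
    define W where "W = {x. \<forall>\<phi>\<in>\<Phi>. \<phi> x = 0}"
    have "W \<in> {W. finite_codim ?Z W \<and> closedin (norm_topology ?Z) W}"
      using kernel_finite_codim_closed[OF \<Phi>] by (simp add: W_def)
    moreover have "(SUP y\<in>unit_sphere ?Z W. ennreal (vnorm ?Z (vadd ?Z x (vscale ?Z s y)) - 1)) \<le> ennreal (\<epsilon> * s)"
    proof (rule SUP_least)
      fix y assume "y \<in> unit_sphere ?Z W"
      then have y: "y \<in> W" "n y = 1" by (auto simp: unit_sphere_def renorm_def)
      \<comment> \<open>\<open>A\<close> converts lengths: n y = 1 gives norm y at most 1/A, so
        \<open>t k * A\<close> is an admissible multiple.\<close>
      define y0 where "y0 = (t k * A) *\<^sub>R y"
      have "norm y0 \<le> t k" using n_ge[of y] y(2) t[of k] A by (simp add: y0_def abs_mult mult_left_le mult.assoc)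
      moreover have "\<forall>\<phi>\<in>\<Phi>. \<phi> y0 = 0"
      proof
        fix \<phi> assume "\<phi> \<in> \<Phi>"
        then show "\<phi> y0 = 0" using \<Phi>(2) y(1) by (simp add: y0_def W_def bounded_linear.linear linear_scale)
      qed
      ultimately have ny0: "n (x + y0) \<le> 1 + 2 * \<eta> k" using \<Phi>0 by auto
      define l where "l = s / (t k * A)"
      have l: "0 \<le> l" "l \<le> 1" using s t[of k] A by (auto simp: l_def)
      have "l * (t k * A) = s" using t[of k] A by (simp add: l_def)
      then have "x + s *\<^sub>R y = (1 - l) *\<^sub>R x + l *\<^sub>R (x + y0)"
        by (simp add: y0_def algebra_simps)
      then have "n (x + s *\<^sub>R y) \<le> (1 - l) * n x + l * n (x + y0)"
        using seminorm_add[OF n, of "(1 - l) *\<^sub>R x" "l *\<^sub>R (x + y0)"] l by (simp add: seminorm_scale[OF n])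
      also have "\<dots> \<le> (1 - l) * 1 + l * (1 + 2 * \<eta> k)" using nx ny0 l by (intro add_mono mult_left_mono) auto
      also have "\<dots> = 1 + s * (2 * (\<eta> k / t k) / A)" by (simp add: l_def algebra_simps)
      also have "\<dots> \<le> 1 + s * \<epsilon>"
      proof -
        have "2 * (\<eta> k / t k) \<le> \<epsilon> * A" using k by linarith
        then have "2 * (\<eta> k / t k) / A \<le> \<epsilon>" by (simp only: pos_divide_le_eq[OF A])
        then show ?thesis using s by (intro add_left_mono mult_left_mono) auto
      qed
      finally have "n (x + s *\<^sub>R y) - 1 \<le> \<epsilon> * s" by (simp add: mult.commute)
      then show "ennreal (vnorm ?Z (vadd ?Z x (vscale ?Z s y)) - 1) \<le> ennreal (\<epsilon> * s)"
        by (simp add: renorm_def type_space_def ennreal_leI)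
    qed
    ultimately show "(INF W\<in>{W. finite_codim ?Z W \<and> closedin (norm_topology ?Z) W}.
        SUP y\<in>unit_sphere ?Z W. ennreal (vnorm ?Z (vadd ?Z x (vscale ?Z s y)) - 1)) \<le> ennreal (\<epsilon> * s)"
      by (rule INF_lower2)
  qed
  have "aus_modulus ?Z s / ennreal s < a" if s: "0 < s" "s < t k * A" for s
  proof -
    have "aus_modulus ?Z s / ennreal s \<le> ennreal (\<epsilon> * s) / ennreal s"
      using bound[OF s] by (rule divide_right_mono_ennreal)
    also have "\<dots> = ennreal \<epsilon>" using s \<epsilon>(1) by (simp add: divide_ennreal)
    finally show ?thesis using \<epsilon>(2) by order
  qed
  moreover have "t k * A > 0" using t A by simp
  ultimately show "\<forall>\<^sub>F s in at_right 0. aus_modulus ?Z s / ennreal s < a"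
    unfolding eventually_at_right_field by blast
qed simp

text \<open>Duality of the two moduli. Take x nearly norming f, and a test functional g that
  vanishes at x and on a finite set norming for the kernel belonging to x and f. Some y in that
  kernel then has g y at least a multiple of \<open>t k\<close>, so f + s g is large at x + y, while
  the norm of x + y has hardly grown.\<close>

lemma weak_star_auc_power_of_scales:
  fixes t \<eta> :: "nat \<Rightarrow> real"
  assumes t: "\<And>k. t k > 0" and \<eta>: "\<And>k. \<eta> k > 0"
    and scale: "\<And>k x e. n x \<le> 1 \<Longrightarrow> e > 0 \<Longrightarrow>
      \<forall>\<^sub>F y in finite_codim_filter. norm y \<le> t k \<longrightarrow> n (x + y) \<le> 1 + \<eta> k + e"
    and choice: "\<And>s. 0 < s \<Longrightarrow> s \<le> 1 \<Longrightarrow> \<exists>k. \<eta> k \<le> A / 48 * s * t k \<and> \<gamma> * s powr r \<le> A / 24 * s * t k"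
  shows "weak_star_auc_power (renorm (type_space :: 'a nspace) n) \<gamma> r"
  unfolding weak_star_auc_power_def
proof
  let ?Z = "renorm (type_space :: 'a nspace) n"
  let ?D = "dual_space ?Z"
  fix s :: real assume "s \<in> {0<..1}"
  then have s: "0 < s" "s \<le> 1" by auto
  obtain k where k: "\<eta> k \<le> A / 48 * s * t k" "\<gamma> * s powr r \<le> A / 24 * s * t k" using choice[OF s] by blast
  \<comment> \<open>In the factor A/6, \<open>A\<close> brings z into the unit ball of the norm, 1/2
    comes from z only half norming g, and 1/3 from passing to the kernel. The constants 48 and 24 in
    \<open>choice\<close> say that \<open>\<eta> k\<close> is at most u/8 and the claimed bound at
    most u/4.\<close>
  define u where "u = s * t k * A / 6"
  have u: "u > 0" "2 * \<eta> k \<le> u / 4" "\<gamma> * s powr r \<le> u / 4" using s t[of k] A k by (auto simp: u_def mult_ac)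
  show "ereal (\<gamma> * s powr r) \<le> weak_star_auc_modulus ?Z s"
    unfolding weak_star_auc_modulus_def Let_def
  proof (rule INF_greatest)
    fix f' assume "f' \<in> unit_sphere ?D (vcarrier ?D)"
    then obtain f where f: "f \<in> dual_domain" "dual_norm f = 1" "f' = dual_map f"
      using dual_map_onto vnorm_dual_map unfolding unit_sphere_def by (metis (mono_tags, lifting) mem_Collect_eq)
    obtain x where x: "n x \<le> 1" "1 - u / 4 \<le> f x"
    proof -
      have "1 - u / 4 < dual_norm f" using f(2) u(1) by simp
      then obtain x where "n x \<le> 1" "1 - u / 4 < \<bar>f x\<bar>" by (rule less_dual_normE[OF f(1)])
      then show ?thesis
        using that[of x] that[of "- x"] by (cases "f x \<ge> 0") (auto simp: seminorm_minus[OF n] blinfun.minus_right)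
    qed
    obtain \<Phi> where \<Phi>: "finite \<Phi>" "\<forall>\<phi>\<in>\<Phi>. bounded_linear \<phi>"
      and \<Phi>0: "\<forall>y. (\<forall>\<phi>\<in>\<Phi>. \<phi> y = (0::real)) \<longrightarrow> norm y \<le> t k \<longrightarrow> n (x + y) \<le> 1 + \<eta> k + \<eta> k"
      using scale[OF x(1) \<eta>, of k k, unfolded eventually_finite_codim] by (elim exE conjE)
    obtain F where F: "finite F" "\<And>g z. linear g \<Longrightarrow> (\<And>x. x \<in> F \<Longrightarrow> g x = (0::real)) \<Longrightarrow> norm z \<le> 1 \<Longrightarrow>
      \<exists>w. (\<forall>\<phi>\<in>insert (blinfun_apply f) \<Phi>. \<phi> w = 0) \<and> norm w \<le> 3 \<and> g w = g z"
      by (rule finite_set_norming_kernel[of "insert (blinfun_apply f) \<Phi>"])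
        (use \<Phi> in \<open>auto simp: blinfun.bounded_linear_right\<close>)
    define E where "E = dual_map ` {\<phi> \<in> dual_domain. \<forall>x\<in>insert x F. \<phi> x = 0}"
    have "E \<in> {E. finite_codim ?D E \<and> closedin (weak_star_topology ?Z) E}"
      unfolding E_def using annihilator_finite_codim_closed[of "insert x F"] F(1) by simp
    moreover have "ereal (\<gamma> * s powr r) \<le> (INF g\<in>unit_sphere ?D E. ereal (vnorm ?D (vadd ?D f' (vscale ?D s g)) - 1))"
    proof (rule INF_greatest)
      fix g' assume "g' \<in> unit_sphere ?D E"
      then obtain g where g: "g \<in> dual_domain" "g x = 0" "\<And>z. z \<in> F \<Longrightarrow> g z = 0" "g' = dual_map g" "dual_norm g = 1"
        using vnorm_dual_map unfolding unit_sphere_def E_def by auto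
      have sg: "s *\<^sub>R g \<in> dual_domain" "f + s *\<^sub>R g \<in> dual_domain"
        using subspace_scale[OF subspace_dual_domain g(1)] subspace_add[OF subspace_dual_domain f(1)] by auto
      have eq: "vnorm ?D (vadd ?D f' (vscale ?D s g')) = dual_norm (f + s *\<^sub>R g)"
        unfolding f(3) g(4) using f(1) g(1) sg by (simp add: vnorm_dual_map flip: dual.pi_add dual.pi_scale)
      have "1 / 2 < dual_norm g" using g(5) by simp
      then obtain z where z: "n z \<le> 1" "1 / 2 < \<bar>g z\<bar>" by (rule less_dual_normE[OF g(1)])
      have "norm (A *\<^sub>R z) \<le> 1" using n_ge[of z] z(1) A by simp
      then obtain w where w: "\<forall>\<phi>\<in>insert (blinfun_apply f) \<Phi>. \<phi> w = 0" "norm w \<le> 3" "g w = g (A *\<^sub>R z)"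
        using F(2)[of "blinfun_apply g" "A *\<^sub>R z"] g(3) by (auto simp: blinfun.bounded_linear_right bounded_linear.linear)
      define y where "y = (sgn (g w) * t k / 3) *\<^sub>R w"
      have ny: "norm y \<le> t k"
        unfolding y_def using w(2) t[of k] by (auto simp: abs_mult sgn_if)
      have y0: "f y = 0" "\<forall>\<phi>\<in>\<Phi>. \<phi> y = 0"
      proof -
        show "f y = 0" using w(1) by (simp add: y_def blinfun.scaleR_right)
        show "\<forall>\<phi>\<in>\<Phi>. \<phi> y = 0"
        proof
          fix \<phi> assume "\<phi> \<in> \<Phi>"
          then have "linear \<phi>" "\<phi> w = 0" using \<Phi>(2) w(1) bounded_linear.linear by blast+
          then show "\<phi> y = 0" by (simp add: y_def linear_scale)
        qed
      qed
      have "\<bar>g w\<bar> \<ge> A / 2" unfolding w(3) using z(2) A by (simp add: blinfun.scaleR_right abs_mult)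
      then have gy: "g y \<ge> t k * A / 6"
        unfolding y_def using t[of k] by (simp add: blinfun.scaleR_right sgn_mult_self_eq abs_mult mult.commute mult.left_commute abs_sgn[symmetric] flip: abs_sgn)
      have "1 - u / 4 + u \<le> (f + s *\<^sub>R g) (x + y)"
      proof -
        have "(f + s *\<^sub>R g) (x + y) = f x + s * g y"
          using y0(1) g(2) by (simp add: blinfun.add_left blinfun.scaleR_left blinfun.add_right)
        moreover have "u \<le> s * g y" using mult_left_mono[OF gy, of s] s by (simp add: u_def mult.assoc)
        ultimately show ?thesis using x(2) by linarith
      qed
      also have "\<dots> \<le> dual_norm (f + s *\<^sub>R g) * n (x + y)" using dual_norm_bound[OF sg(2), of "x + y"] by simp
      also have "\<dots> \<le> dual_norm (f + s *\<^sub>R g) * (1 + u / 4)"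
      proof (rule mult_left_mono)
        have "n (x + y) \<le> 1 + \<eta> k + \<eta> k" using \<Phi>0 y0(2) ny by blast
        then show "n (x + y) \<le> 1 + u / 4" using u(2) by simp
      qed (rule dual_norm_nonneg[OF sg(2)])
      finally have *: "1 - u / 4 + u \<le> dual_norm (f + s *\<^sub>R g) + dual_norm (f + s *\<^sub>R g) * (u / 4)"
        by (simp add: algebra_simps)
      \<comment> \<open>A dual norm of at most 2 limits the loss from the factor 1 + u/4 to u/2; of
        the excess 3 u/4 there remains u/4.\<close>
      have "dual_norm (f + s *\<^sub>R g) \<le> 2"
        using dual_norm_add[OF f(1) sg(1)] dual_norm_scale[OF g(1), of s] f(2) g(5) s by simp
      then have "dual_norm (f + s *\<^sub>R g) * (u / 4) \<le> 2 * (u / 4)" using u(1) by (intro mult_right_mono) auto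
      then have "u / 4 \<le> dual_norm (f + s *\<^sub>R g) - 1" using * by linarith
      then show "ereal (\<gamma> * s powr r) \<le> ereal (vnorm ?D (vadd ?D f' (vscale ?D s g')) - 1)"
        unfolding eq using u(3) by simp
    qed
    ultimately show "ereal (\<gamma> * s powr r) \<le> (SUP E\<in>{E. finite_codim ?D E \<and> closedin (weak_star_topology ?Z) E}.
        INF g\<in>unit_sphere ?D E. ereal (vnorm ?D (vadd ?D f' (vscale ?D s g)) - 1))"
      by (rule SUP_upper2)
  qed
qed

end

section \<open>The three-space theorem\<close>

lemma linear_presentation_renorm:
  "linear_presentation Z S \<pi> \<Longrightarrow> linear_presentation (renorm Z N) S \<pi>"
  by (simp add: linear_presentation_def renorm_def)

lemma linear_presentation_subspace:
  "subspace Y \<Longrightarrow> linear_presentation (subspace_of type_space Y) Y (\<lambda>x. x)"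
  by unfold_locales (auto simp: subspace_of_def type_space_def)

lemma linear_presentation_type_space: "linear_presentation type_space UNIV (\<lambda>x. x)"
  by unfold_locales (auto simp: type_space_def)

lemma linear_presentation_quotient:
  assumes "subspace Y"
  shows "linear_presentation (quotient_space type_space Y) UNIV (\<lambda>x. (+) x ` Y)"
proof -
  interpret linear_presentation "type_space :: 'a nspace" UNIV "\<lambda>x. x" by (rule linear_presentation_type_space)
  show ?thesis using quotient_presentation[of Y] linear_subspace_image[OF assms] by (simp add: type_space_def)
qed

lemma vnorm_quotient_coset:
  fixes Y :: "'a::real_normed_vector set"
  assumes "subspace Y"
  shows "vnorm (quotient_space type_space Y) ((+) x ` Y) = infdist x Y"
proof -
  have "(\<lambda>y. norm (x + y)) ` Y = (\<lambda>y. norm (x - y)) ` Y"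
  proof (intro set_eqI iffI)
    fix r assume "r \<in> (\<lambda>y. norm (x + y)) ` Y"
    then obtain y where "y \<in> Y" "r = norm (x + y)" by blast
    then show "r \<in> (\<lambda>y. norm (x - y)) ` Y" using subspace_neg[OF assms] by (intro image_eqI[of _ _ "- y"]) auto
  next
    fix r assume "r \<in> (\<lambda>y. norm (x - y)) ` Y"
    then obtain y where "y \<in> Y" "r = norm (x - y)" by blast
    then show "r \<in> (\<lambda>y. norm (x + y)) ` Y" using subspace_neg[OF assms] by (intro image_eqI[of _ _ "- y"]) auto
  qed
  then show ?thesis
    using subspace_0[OF assms]
    by (subst infdist_eq_quotient_seminorm) (auto simp: quotient_space_def type_space_def quotient_seminorm_def image_image)
qed

lemma coset_eq_zero_coset:
  fixes Y :: "'a::real_normed_vector set"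
  assumes "subspace Y" "closed Y" "infdist x Y = 0"
  shows "(+) x ` Y = (+) 0 ` Y"
proof -
  have "x \<in> Y" using assms subspace_0[OF assms(1)] by (metis closure_closed empty_iff in_closure_iff_infdist_zero)
  then have "y \<in> (+) x ` Y" if "y \<in> Y" for y
    using subspace_diff[OF assms(1) that, of x] by (intro image_eqI[of _ _ "y - x"]) auto
  then show ?thesis using subspace_add[OF assms(1) \<open>x \<in> Y\<close>] by auto
qed

lemma aus_three_space:
  fixes Y :: "'a::real_normed_vector set"
  assumes Y: "subspace Y" "closed Y"
    and "aus_renormable (subspace_of type_space Y)" and "aus_renormable (quotient_space type_space Y)"
  shows "aus_renormable (type_space :: 'a nspace)"
proof -
  obtain N1 where N1: "equivalent_norm (subspace_of type_space Y) N1"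
    "asymptotically_uniformly_smooth (renorm (subspace_of type_space Y) N1)"
    using assms(3) unfolding aus_renormable_def by blast
  obtain N2 where N2: "equivalent_norm (quotient_space type_space Y) N2"
    "asymptotically_uniformly_smooth (renorm (quotient_space type_space Y) N2)"
    using assms(4) unfolding aus_renormable_def by blast
  obtain a1 b1 where ab1: "a1 > 0" "b1 > 0" "\<And>y. y \<in> Y \<Longrightarrow> a1 * norm y \<le> N1 y \<and> N1 y \<le> b1 * norm y"
    using N1(1) unfolding equivalent_norm_def by (auto simp: subspace_of_def type_space_def)
  obtain \<nu> where \<nu>: "seminorm \<nu>" "\<And>x. x \<in> Y \<Longrightarrow> \<nu> x = N1 x" "\<And>x. \<nu> x \<le> b1 * norm x"
    by (rule seminorm_extension[OF Y(1), of N1 b1])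
      (use N1(1) ab1 in \<open>auto simp: equivalent_norm_def subspace_of_def type_space_def\<close>)
  interpret PY: linear_presentation "subspace_of type_space Y" Y "\<lambda>x. x"
    by (rule linear_presentation_subspace[OF Y(1)])
  interpret Y: normed_presentation "renorm (subspace_of type_space Y) N1" Y "\<lambda>x. x" \<nu> b1
    by (intro normed_presentation.intro linear_presentation_renorm PY.linear_presentation_axioms
        normed_presentation_axioms.intro \<nu>) (simp add: \<nu>(2) renorm_def)
  let ?q = "\<lambda>x. (+) x ` Y"
  let ?Q = "quotient_space type_space Y"
  interpret PQ: linear_presentation ?Q UNIV ?q
    by (rule linear_presentation_quotient[OF Y(1)])
  have car: "?q x \<in> vcarrier ?Q" for x using PQ.in_carrier by simp
  obtain a2 b2 where ab2: "a2 > 0" "b2 > 0" "\<And>A. A \<in> vcarrier ?Q \<Longrightarrow> a2 * vnorm ?Q A \<le> N2 A \<and> N2 A \<le> b2 * vnorm ?Q A"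
    using N2(1) unfolding equivalent_norm_def by blast
  define \<mu> where "\<mu> x = N2 (?q x)" for x
  have \<mu>: "seminorm \<mu>"
    unfolding seminorm_def \<mu>_def using N2(1) car PQ.pi_add PQ.pi_scale
    by (simp add: equivalent_norm_def)
  have \<mu>_bounds: "a2 * infdist x Y \<le> \<mu> x" "\<mu> x \<le> b2 * infdist x Y" for x
    using ab2(3)[OF car, of x] by (auto simp: \<mu>_def vnorm_quotient_coset[OF Y(1)])
  have inf_le: "infdist x Y \<le> norm x" for x
    using infdist_le[OF subspace_0[OF Y(1)], of x] by simp
  have \<mu>_le: "\<mu> x \<le> b2 * norm x" for x
    using order_trans[OF \<mu>_bounds(2) mult_left_mono[OF inf_le, of b2]] ab2(2) by simp
  interpret Q: normed_presentation "renorm ?Q N2" UNIV ?q \<mu> b2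
    by (intro normed_presentation.intro linear_presentation_renorm PQ.linear_presentation_axioms
        normed_presentation_axioms.intro \<mu> \<mu>_le) (simp add: \<mu>_def renorm_def)
  have defY: "\<forall>x\<in>Y. \<nu> x = 0 \<longrightarrow> x = 0"
    using ab1 \<nu>(2) by (metis mult_le_0_iff norm_le_zero_iff not_less)
  have "infdist x Y = 0" if "\<mu> x = 0" for x
  proof -
    have "a2 * infdist x Y \<le> 0" using \<mu>_bounds(1)[of x] that by simp
    then show ?thesis using ab2(1) infdist_nonneg[of x Y] by (simp add: mult_le_0_iff)
  qed
  then have defQ: "\<forall>x\<in>UNIV. \<mu> x = 0 \<longrightarrow> ?q x = ?q 0"
    using coset_eq_zero_coset[OF Y] by blast
  \<comment> \<open>At scale k the ratio of cost to length is a multiple of 1/(a k L k):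
    \<open>R\<close> and \<open>R'\<close>, of unknown growth, cancel. So \<open>a\<close> has to be
    summable with a k L k tending to infinity, as 2^-k is against 4^k.\<close>
  define L where "L k = (4::real) ^ k" for k :: nat
  have L: "L k \<ge> 1" for k by (simp add: L_def)
  have "\<exists>R\<ge>1. flat \<nu> Y R (1 / L k)" for k
    by (rule Y.aus_imp_flat[OF defY N1(2)]) (simp add: L_def)
  then obtain R where R: "\<And>k. R k \<ge> 1" "\<And>k. flat \<nu> Y (R k) (1 / L k)" by metis
  have "\<exists>R\<ge>1. flat \<mu> UNIV R (1 / L k)" for k
    by (rule Q.aus_imp_flat[OF defQ N2(2)]) (simp add: L_def)
  then obtain R' where R': "\<And>k. R' k \<ge> 1" "\<And>k. flat \<mu> UNIV (R' k) (1 / L k)" by metis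
  define \<alpha> where "\<alpha> = min a1 a2"
  define \<beta> where "\<beta> = max b1 b2"
  have \<alpha>\<beta>: "\<alpha> > 0" "\<beta> > 0" using ab1 ab2 by (auto simp: \<alpha>_def \<beta>_def)
  have up: "b1 * r \<le> \<beta> * r" "b2 * r \<le> \<beta> * r" "\<alpha> * r \<le> a1 * r" "\<alpha> * r \<le> a2 * r" if "r \<ge> 0" for r
    using that by (auto simp: \<alpha>_def \<beta>_def intro: mult_right_mono)
  have \<nu>_up: "\<nu> y \<le> \<beta> * norm y" for y using order_trans[OF \<nu>(3) up(1)] by simp
  have \<nu>_low: "\<alpha> * norm y \<le> \<nu> y" if "y \<in> Y" for y
    using order_trans[OF up(3) conjunct1[OF ab1(3)[OF that]]] \<nu>(2)[OF that] by simp
  have \<mu>_up: "\<mu> y \<le> \<beta> * norm y" for y using order_trans[OF \<mu>_le up(2)] by simp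
  have \<mu>_low: "\<alpha> * infdist y Y \<le> \<mu> y" for y
    using order_trans[OF up(4) \<mu>_bounds(1)] infdist_nonneg by blast
  define a where "a k = (1 / 2 :: real) ^ k" for k :: nat
  have a: "a k > 0" "summable a" for k by (auto simp: a_def[abs_def] intro: summable_geometric)
  obtain n :: "'a \<Rightarrow> real" and C A B where n: "seminorm n" "C > 0" "A > 0" "B > 0"
    "\<forall>x. A * norm x \<le> n x \<and> n x \<le> B * norm x"
    and scale: "\<forall>k x e. n x \<le> 1 \<longrightarrow> e > 0 \<longrightarrow> (\<forall>\<^sub>F y in finite_codim_filter.
      norm y \<le> a k / (C * (R k * R' k * L k)) \<longrightarrow> n (x + y) \<le> 1 + 1 / (R k * R' k * (L k)\<^sup>2) + e)"
    by (rule three_space_renorming[where L = L and R = R and R' = R' and a = a and \<nu> = \<nu> and \<mu> = \<mu>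
          and \<alpha> = \<alpha> and \<beta> = \<beta>, OF Y(1) L R(1) R'(1) \<nu>(1) \<nu>_up \<nu>_low \<mu> \<mu>_up \<mu>_low \<alpha>\<beta> R(2) R'(2) a]) blast
  interpret E: equivalent_seminorm n A B by unfold_locales (use n in auto)
  have pos: "R k * R' k * L k > 0" "R k * R' k * (L k)\<^sup>2 > 0" for k
    using R(1)[of k] R'(1)[of k] L[of k] by (auto intro!: mult_pos_pos)
  have "asymptotically_uniformly_smooth (renorm (type_space :: 'a nspace) n)"
  proof (rule E.aus_of_scales[where t = "\<lambda>k. a k / (C * (R k * R' k * L k))" and \<eta> = "\<lambda>k. 1 / (R k * R' k * (L k)\<^sup>2)"])
    show "a k / (C * (R k * R' k * L k)) > 0" for k using a(1)[of k] n(2) pos(1)[of k] by simp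
    show "1 / (R k * R' k * (L k)\<^sup>2) > 0" for k using pos(2)[of k] by simp
    have "1 / (R k * R' k * (L k)\<^sup>2) / (a k / (C * (R k * R' k * L k))) = C * (1 / 2) ^ k" for k
    proof -
      have "1 / (R k * R' k * (L k)\<^sup>2) / (a k / (C * (R k * R' k * L k))) = C / (a k * L k)"
        using pos(1)[of k] R(1)[of k] R'(1)[of k] L[of k] by (simp add: power2_eq_square)
      also have "a k * L k = 2 ^ k" by (simp add: a_def L_def flip: power_mult_distrib)
      finally show ?thesis by (simp add: power_divide)
    qed
    moreover have "(\<lambda>k. C * (1 / 2) ^ k) \<longlonglongrightarrow> C * 0" by (intro tendsto_intros LIMSEQ_realpow_zero) auto
    ultimately show "(\<lambda>k. 1 / (R k * R' k * (L k)\<^sup>2) / (a k / (C * (R k * R' k * L k)))) \<longlonglongrightarrow> 0"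
      by simp
  qed (use scale in blast)
  moreover have "equivalent_norm type_space n"
    unfolding equivalent_norm_def using n seminorm_add[OF n(1)] seminorm_scale[OF n(1)]
    by (auto simp: type_space_def)
  ultimately show ?thesis unfolding aus_renormable_def by blast
qed

text \<open>Write l = 2^k. The first inequality amounts to 48 C / A \<le> s l^(1-d), so the smallest
  possible l is of order s^(-1/(1-d)). The right-hand side of the second is then of order s
  l^(-(P-1+d)), that is s to the power 1 + (P-1+d)/(1-d), and d is the solution of (P-1+d)/(1-d) = P
  + \<delta> - 1.\<close>

lemma scale_choice:
  fixes P \<delta> C K A :: real
  assumes P1: "P \<ge> 1" and \<delta>: "\<delta> > 0" and C: "C > 0" and K: "K > 0" and A: "A > 0"
  defines "d \<equiv> \<delta> / (P + \<delta>)"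
  shows "\<exists>\<gamma>>0. \<forall>s. 0 < s \<longrightarrow> s \<le> 1 \<longrightarrow> (\<exists>k::nat.
    1 / (K * (2 ^ k) powr P) \<le> A / 48 * s * ((2 ^ k) powr (- d) / (C * (K * (2 ^ k) powr (P - 1)))) \<and>
    \<gamma> * s powr (P + \<delta>) \<le> A / 24 * s * ((2 ^ k) powr (- d) / (C * (K * (2 ^ k) powr (P - 1)))))"
proof -
  have P: "P > 0" using P1 by simp
  define M where "M = max 1 (48 * C / A)"
  define e where "e = P - 1 + d"
  define \<gamma> where "\<gamma> = A / (24 * C * K) * (2 powr (- e) * M powr (- (P + \<delta> - 1)))"
  have M: "M \<ge> 1" "48 * C / A \<le> M" by (auto simp: M_def)
  have d: "0 < d" "0 < 1 - d" "1 - d = P / (P + \<delta>)" using P \<delta> by (auto simp: d_def field_simps)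
  have e: "0 < e" using P1 d(1) by (simp add: e_def)
  have e_div: "e / (1 - d) = P + \<delta> - 1"
  proof -
    have "e = P - (1 - d)" by (simp add: e_def)
    then have "e / (1 - d) = P / (1 - d) - 1" using d(2) by (simp add: diff_divide_distrib)
    also have "P / (1 - d) = P + \<delta>" unfolding d(3) using P \<delta> by simp
    finally show ?thesis by simp
  qed
  show ?thesis
  proof (intro exI[of _ \<gamma>] conjI allI impI)
    show "\<gamma> > 0" using A C K M by (simp add: \<gamma>_def)
    fix s :: real assume s: "0 < s" "s \<le> 1"
    \<comment> \<open>The ideal real value of l. Rounding it up to a power of 2 at most doubles it,
      which puts 2^(-e) into \<gamma>; the maximum with 1 in \<open>M\<close> ensures x \<ge>
      1.\<close>
    define x where "x = (M / s) powr (1 / (1 - d))"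
    have Ms: "M / s \<ge> 1" using M s by (simp add: le_divide_eq)
    have x: "x \<ge> 1" unfolding x_def using Ms d(2) less_imp_le by (intro ge_one_powr_ge_zero) auto
    define k where "k = nat \<lceil>log 2 x\<rceil>"
    have logx: "log 2 x \<ge> 0" using x by simp
    have k: "log 2 x \<le> k" "k \<le> log 2 x + 1" unfolding k_def using logx by linarith+
    define l where "l = (2::real) ^ k"
    have l_powr: "l = 2 powr k" by (simp add: l_def powr_realpow)
    have "2 powr (log 2 x) \<le> l" unfolding l_powr using k(1) by (intro powr_mono) auto
    then have xl: "x \<le> l" using x by simp
    have "l \<le> 2 powr (log 2 x + 1)" unfolding l_powr using k(2) by (intro powr_mono) auto
    then have lx: "l \<le> 2 * x" using x by (simp add: powr_add)
    have l: "l \<ge> 1" using x xl by simp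
    have "M / s = x powr (1 - d)" unfolding x_def using d(2) M(1) s(1) by (simp add: powr_powr)
    also have "\<dots> \<le> l powr (1 - d)" using xl x d by (intro powr_mono2) auto
    finally have "M \<le> s * l powr (1 - d)" using s(1) by (simp add: divide_le_eq mult.commute)
    then have "48 * C / A \<le> s * l powr (1 - d)" using M(2) by linarith
    then have big: "48 * C \<le> A * s * l powr (1 - d)" using A by (simp add: divide_le_eq mult_ac)
    have lP: "l powr P = l powr (P - 1) * l" and ld: "l powr (1 - d) = l powr (- d) * l"
      using l powr_add[of l "P - 1" 1] powr_add[of l "- d" 1] by auto
    have "1 / (K * l powr P) \<le> A / 48 * s * (l powr (- d) / (C * (K * l powr (P - 1))))"
    proof -
      have "1 / (K * l powr P) = (48 * C) * (1 / (48 * C * K * l powr P))" using C by simp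
      also have "\<dots> \<le> (A * s * l powr (1 - d)) * (1 / (48 * C * K * l powr P))"
        using big C K l by (intro mult_right_mono) auto
      also have "\<dots> = A / 48 * s * (l powr (- d) / (C * (K * l powr (P - 1))))"
        unfolding lP ld using l by simp
      finally show ?thesis .
    qed
    moreover have "\<gamma> * s powr (P + \<delta>) \<le> A / 24 * s * (l powr (- d) / (C * (K * l powr (P - 1))))"
    proof -
      have "x powr (- e) = M powr (- (P + \<delta> - 1)) * s powr (P + \<delta> - 1)"
      proof -
        have "1 / (1 - d) * (- e) = - (P + \<delta> - 1)" using e_div by simp
        then have "x powr (- e) = (M / s) powr (- (P + \<delta> - 1))" unfolding x_def by (simp only: powr_powr)
        also have "\<dots> = M powr (- (P + \<delta> - 1)) * s powr (P + \<delta> - 1)"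
        proof -
          have "(M / s) powr (- b) = M powr (- b) * s powr b" for b
            using M(1) s(1) powr_divide[of M s "- b"] by (simp add: powr_minus divide_inverse[of _ "inverse _"])
          then show ?thesis .
        qed
        finally show ?thesis .
      qed
      moreover have "2 powr (- e) * x powr (- e) = (2 * x) powr (- e)" using x by (simp add: powr_mult)
      moreover have "(2 * x) powr (- e) \<le> l powr (- e)" using lx l e by (intro powr_mono2') auto
      ultimately have *: "2 powr (- e) * M powr (- (P + \<delta> - 1)) * s powr (P + \<delta> - 1) \<le> l powr (- e)"
        by (simp add: mult.assoc)
      have "\<gamma> * s powr (P + \<delta>) = A / (24 * C * K) * s * (2 powr (- e) * M powr (- (P + \<delta> - 1)) * s powr (P + \<delta> - 1))"
        using s powr_add[of s "P + \<delta> - 1" 1] by (simp add: \<gamma>_def)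
      also have "\<dots> \<le> A / (24 * C * K) * s * l powr (- e)"
        using * A C K s by (intro mult_left_mono) auto
      also have "l powr (- e) = l powr (- d) / l powr (P - 1)"
        by (simp add: e_def powr_diff[symmetric] algebra_simps)
      also have "A / (24 * C * K) * s * (l powr (- d) / l powr (P - 1)) = A / 24 * s * (l powr (- d) / (C * (K * l powr (P - 1))))"
        by simp
      finally show ?thesis .
    qed
    ultimately show "\<exists>k::nat.
      1 / (K * (2 ^ k) powr P) \<le> A / 48 * s * ((2 ^ k) powr (- d) / (C * (K * (2 ^ k) powr (P - 1)))) \<and>
      \<gamma> * s powr (P + \<delta>) \<le> A / 24 * s * ((2 ^ k) powr (- d) / (C * (K * (2 ^ k) powr (P - 1))))"
      unfolding l_def by blast
  qed
qed

lemma weak_star_auc_three_space: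
  fixes Y :: "'a::real_normed_vector set" and p q c \<delta> :: real
  assumes Y: "subspace Y" and pq: "p \<ge> 1" "q \<ge> 1" and c: "c > 0"
    and auc: "weak_star_auc_power (subspace_of type_space Y) c p" "weak_star_auc_power (quotient_space type_space Y) c q"
    and \<delta>: "\<delta> > 0"
  obtains n \<gamma> where "equivalent_norm (type_space :: 'a nspace) n" "\<gamma> > 0"
    "weak_star_auc_power (renorm type_space n) \<gamma> (p + q + \<delta>)"
proof -
  let ?q = "\<lambda>x. (+) x ` Y"
  let ?Q = "quotient_space type_space Y"
  interpret PY: linear_presentation "subspace_of type_space Y" Y "\<lambda>x. x"
    by (rule linear_presentation_subspace[OF Y])
  interpret Y: normed_presentation "subspace_of type_space Y" Y "\<lambda>x. x" norm 1
    by unfold_locales (auto simp: seminorm_norm subspace_of_def type_space_def)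
  interpret PQ: linear_presentation ?Q UNIV ?q by (rule linear_presentation_quotient[OF Y])
  have ne: "Y \<noteq> {}" using subspace_0[OF Y] by blast
  define \<mu> where "\<mu> x = infdist x Y" for x
  have \<mu>: "seminorm \<mu>"
    using seminorm_quotient[OF seminorm_norm Y] infdist_eq_quotient_seminorm[OF ne] by (simp add: \<mu>_def[abs_def])
  have \<mu>_le: "\<mu> x \<le> 1 * norm x" for x
    using infdist_le[OF subspace_0[OF Y], of x] by (simp add: \<mu>_def)
  interpret Q: normed_presentation ?Q UNIV ?q \<mu> 1
    by unfold_locales (auto simp: \<mu> \<mu>_def vnorm_quotient_coset[OF Y] intro: order_trans[OF \<mu>_le[unfolded \<mu>_def]])
  define L where "L k = (2::real) ^ k" for k :: nat
  have L: "L k \<ge> 1" for k by (simp add: L_def)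
  \<comment> \<open>Makes the flatness threshold at most K r times the pure power L^(r-1): its
    summand 2 is absorbed because L^(r-1) \<ge> 1 for r \<ge> 1.\<close>
  define K where "K r = 2 / c * 2 powr (r - 1) + 2" for r
  have K: "K r \<ge> 1" for r unfolding K_def using c by (simp add: add_increasing)
  have thr: "2 / c * (2 * L k) powr (r - 1) + 2 \<le> K r * L k powr (r - 1)" and K1: "1 \<le> K r * L k powr (r - 1)"
    if "r \<ge> 1" for k r
  proof -
    have "1 \<le> L k powr (r - 1)" using L that by (intro ge_one_powr_ge_zero) auto
    then show "2 / c * (2 * L k) powr (r - 1) + 2 \<le> K r * L k powr (r - 1)"
      using L[of k] by (simp add: K_def powr_mult distrib_right)
    show "1 \<le> K r * L k powr (r - 1)" using mult_mono[OF K \<open>1 \<le> L k powr (r - 1)\<close>, of r] K[of r] by simp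
  qed
  define d where "d = \<delta> / (p + q + \<delta>)"
  have d: "d > 0" using \<delta> pq by (simp add: d_def)
  \<comment> \<open>Summable since \<open>L\<close> grows geometrically, at the price of only the
    power d of \<open>L\<close>, which \<open>scale_choice\<close> converts into \<delta>.\<close>
  define a where "a k = L k powr (- d)" for k
  have a_eq: "a k = (2 powr (- d)) ^ k" for k
    by (simp add: a_def L_def powr_powr flip: powr_realpow) (simp add: mult.commute)
  have "2 powr (- d) < (1::real)" using d by (simp add: powr_less_one)
  then have a: "a k > 0" "summable a" for k
    unfolding a_eq[abs_def] by (auto intro: summable_geometric)
  define R where "R k = K p * L k powr (p - 1)" for k
  define R' where "R' k = K q * L k powr (q - 1)" for k
  have flatY: "flat norm Y (R k) (1 / L k)" for k
    using flat_mono[OF Y.weak_star_auc_power_imp_flat[OF auc(1) c L] thr[OF pq(1)]] by (simp add: R_def)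
  have flatQ: "flat \<mu> UNIV (R' k) (1 / L k)" for k
    using flat_mono[OF Q.weak_star_auc_power_imp_flat[OF auc(2) c L] thr[OF pq(2)]] by (simp add: R'_def)
  have R1: "R k \<ge> 1" "R' k \<ge> 1" for k using K1[OF pq(1)] K1[OF pq(2)] by (auto simp: R_def R'_def)
  have bounds: "norm y \<le> 1 * norm y" "1 * norm y \<le> norm y" "1 * infdist y Y \<le> \<mu> y" for y :: 'a by (auto simp: \<mu>_def)
  obtain n :: "'a \<Rightarrow> real" and C A B where n: "seminorm n" "C > 0" "A > 0" "B > 0"
    "\<forall>x. A * norm x \<le> n x \<and> n x \<le> B * norm x"
    and scale: "\<forall>k x e. n x \<le> 1 \<longrightarrow> e > 0 \<longrightarrow> (\<forall>\<^sub>F y in finite_codim_filter.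
      norm y \<le> a k / (C * (R k * R' k * L k)) \<longrightarrow> n (x + y) \<le> 1 + 1 / (R k * R' k * (L k)\<^sup>2) + e)"
    by (rule three_space_renorming[where L = L and R = R and R' = R' and a = a and \<nu> = norm and \<mu> = \<mu>
          and \<alpha> = 1 and \<beta> = 1, OF Y L R1 seminorm_norm bounds(1,2) \<mu> \<mu>_le bounds(3) zero_less_one zero_less_one flatY flatQ a]) blast
  interpret E: equivalent_seminorm n A B by unfold_locales (use n in auto)
  define KK where "KK = K p * K q"
  have KK: "KK > 0" unfolding KK_def using K[of p] K[of q] by (intro mult_pos_pos) auto
  have RRL: "R k * R' k * L k = KK * L k powr (p + q - 1)" for k
  proof -
    have "L k powr (p - 1) * L k powr (q - 1) * L k powr 1 = L k powr ((p - 1) + (q - 1) + 1)"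
      by (simp only: powr_add)
    then show ?thesis using L[of k] by (simp add: R_def R'_def KK_def mult_ac algebra_simps)
  qed
  have RRLL: "R k * R' k * (L k)\<^sup>2 = KK * L k powr (p + q)" for k
  proof -
    have "L k powr (p + q - 1) * L k powr 1 = L k powr ((p + q - 1) + 1)" by (simp only: powr_add)
    then have "L k powr (p + q) = L k powr (p + q - 1) * L k" using L[of k] by simp
    then show ?thesis using RRL[of k] by (simp add: power2_eq_square mult_ac)
  qed
  have "\<exists>\<gamma>>0. \<forall>s. 0 < s \<longrightarrow> s \<le> 1 \<longrightarrow> (\<exists>k::nat.
    1 / (KK * (2 ^ k) powr (p + q)) \<le> A / 48 * s * ((2 ^ k) powr (- d) / (C * (KK * (2 ^ k) powr (p + q - 1)))) \<and>
    \<gamma> * s powr (p + q + \<delta>) \<le> A / 24 * s * ((2 ^ k) powr (- d) / (C * (KK * (2 ^ k) powr (p + q - 1)))))"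
    unfolding d_def by (rule scale_choice) (use pq \<delta> n KK in auto)
  then obtain \<gamma> where \<gamma>: "\<gamma> > 0" "\<forall>s. 0 < s \<longrightarrow> s \<le> 1 \<longrightarrow> (\<exists>k::nat.
    1 / (KK * (2 ^ k) powr (p + q)) \<le> A / 48 * s * ((2 ^ k) powr (- d) / (C * (KK * (2 ^ k) powr (p + q - 1)))) \<and>
    \<gamma> * s powr (p + q + \<delta>) \<le> A / 24 * s * ((2 ^ k) powr (- d) / (C * (KK * (2 ^ k) powr (p + q - 1)))))"
    by (elim exE conjE)
  have "weak_star_auc_power (renorm (type_space :: 'a nspace) n) \<gamma> (p + q + \<delta>)"
  proof (rule E.weak_star_auc_power_of_scales[OF _ _ scale[rule_format]])
    show "a k / (C * (R k * R' k * L k)) > 0" for k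
      unfolding RRL using a(1)[of k] n(2) KK L[of k] by simp
    show "1 / (R k * R' k * (L k)\<^sup>2) > 0" for k unfolding RRLL using KK L[of k] by simp
    show "\<exists>k. 1 / (R k * R' k * (L k)\<^sup>2) \<le> A / 48 * s * (a k / (C * (R k * R' k * L k))) \<and>
        \<gamma> * s powr (p + q + \<delta>) \<le> A / 24 * s * (a k / (C * (R k * R' k * L k)))" if "0 < s" "s \<le> 1" for s
      using \<gamma>(2)[rule_format, OF that] unfolding RRL RRLL unfolding a_def L_def .
  qed
  moreover have "equivalent_norm type_space n"
    unfolding equivalent_norm_def using n seminorm_add[OF n(1)] seminorm_scale[OF n(1)]
    by (auto simp: type_space_def)
  ultimately show ?thesis using that \<gamma>(1) by blast
qed

theorem theorem3p1:
  fixes X :: "'a::banach nspace" and Y :: "'a set"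
  defines "X \<equiv> type_space"
  assumes "separable_space (euclidean :: 'a topology)"
    and "subspace Y" and "closed Y"
  shows "(aus_renormable (subspace_of X Y) \<and> aus_renormable (quotient_space X Y)
            \<longrightarrow> aus_renormable X) \<and>
         (\<forall>p q c :: real. p \<ge> 1 \<and> q \<ge> 1 \<and> c > 0 \<and>
            weak_star_auc_power (subspace_of X Y) c p \<and>
            weak_star_auc_power (quotient_space X Y) c q \<longrightarrow>
            (\<forall>\<delta>>0. \<exists>N \<gamma>. equivalent_norm X N \<and> \<gamma> > 0 \<and>
               weak_star_auc_power (renorm X N) \<gamma> (p + q + \<delta>)))"
  unfolding X_def
  using aus_three_space[OF assms(3,4)] weak_star_auc_three_space[OF assms(3)] by metis

end
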